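(* Let $E/\mathbb{Q}$ be given by a Weierstrass model which is not minimal at the prime $p$, let $E_{\min}$ be a $p$-minimal model of $E$, and let $\Delta,\Delta_{\min}$ be their discriminants. Let $k=\frac{v_p(\Delta)-v_p(\Delta_{\min})}{12}$. Then for every $n\ge0$, $$E^n(\mathbb{Q}_p)\simeq E_{\min}^{n+k}(\mathbb{Q}_p).$$ In particular, if $k\ge1$, $$[E(\mathbb{Q}_p):E^0(\mathbb{Q}_p)]=[E_{\min}(\mathbb{Q}_p):E^k_{\min}(\mathbb{Q}_p)]=c_pN_pp^{k-1}.$$
   Context: For a Weierstrass model $E$, $E^0(\mathbb{Q}_p)$ is the set of points of $E(\mathbb{Q}_p)$ with non-singular reduction modulo $p$ (with respect to that model), and for $n\ge1$, $E^n(\mathbb{Q}_p)$ is the $n$-th step of the formal group filtration: $\{O\}\cup\{(x,y): v_p(x)\le -2n\}$. $c_p$ is the Tamagawa number of $E$ at $p$, i.e. $[E_{\min}(\mathbb{Q}_p):E^0_{\min}(\mathbb{Q}_p)]$, and $N_p=\#\tilde E_{\min,ns}(\mathbb{F}_p)$ is the number of non-singular points of the reduction of the minimal model. $v_p$ is the $p$-adic valuation. *)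

theory Defs
  imports "HOL-Algebra.Algebra" "HOL-Computational_Algebra.Computational_Algebra"
begin

definition rat_val :: "nat \<Rightarrow> rat \<Rightarrow> int" where
  "rat_val p r = (if r = 0 then 0 else
     int (multiplicity (int p) (fst (quotient_of r))) - int (multiplicity (int p) (snd (quotient_of r))))"

definition rat_pint :: "nat \<Rightarrow> rat \<Rightarrow> bool" where
  "rat_pint p r \<longleftrightarrow> r = 0 \<or> rat_val p r \<ge> 0"

definition rat_red0 :: "nat \<Rightarrow> rat \<Rightarrow> bool" where
  "rat_red0 p r \<longleftrightarrow> r = 0 \<or> rat_val p r > 0"

definition padic_cauchy :: "nat \<Rightarrow> (nat \<Rightarrow> rat) \<Rightarrow> bool" where
  "padic_cauchy p S \<longleftrightarrow> (\<forall>m::int. \<exists>N. \<forall>i\<ge>N. \<forall>j\<ge>N. S i - S j = 0 \<or> rat_val p (S i - S j) \<ge> m)"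

definition padic_null :: "nat \<Rightarrow> (nat \<Rightarrow> rat) \<Rightarrow> bool" where
  "padic_null p S \<longleftrightarrow> (\<forall>m::int. \<exists>N. \<forall>i\<ge>N. S i = 0 \<or> rat_val p (S i) \<ge> m)"

definition padic_class :: "nat \<Rightarrow> (nat \<Rightarrow> rat) \<Rightarrow> (nat \<Rightarrow> rat) set" where
  "padic_class p S = {T. padic_cauchy p T \<and> padic_null p (\<lambda>n. S n - T n)}"

definition padic_rep :: "(nat \<Rightarrow> rat) set \<Rightarrow> (nat \<Rightarrow> rat)" where
  "padic_rep A = (SOME S. S \<in> A)"

definition Qp :: "nat \<Rightarrow> (nat \<Rightarrow> rat) set ring" where
  "Qp p = \<lparr> carrier = {padic_class p S | S. padic_cauchy p S},
            monoid.mult = (\<lambda>A B. padic_class p (\<lambda>n. padic_rep A n * padic_rep B n)),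
            monoid.one = padic_class p (\<lambda>_. 1),
            ring.zero = padic_class p (\<lambda>_. 0),
            ring.add = (\<lambda>A B. padic_class p (\<lambda>n. padic_rep A n + padic_rep B n)) \<rparr>"

definition qp_of_rat :: "nat \<Rightarrow> rat \<Rightarrow> (nat \<Rightarrow> rat) set" where
  "qp_of_rat p r = padic_class p (\<lambda>_. r)"

definition qp_val :: "nat \<Rightarrow> (nat \<Rightarrow> rat) set \<Rightarrow> int" where
  "qp_val p A = (THE k. \<exists>N. \<forall>i\<ge>N. padic_rep A i \<noteq> 0 \<and> rat_val p (padic_rep A i) = k)"

definition qp_red0 :: "nat \<Rightarrow> (nat \<Rightarrow> rat) set \<Rightarrow> bool" where
  "qp_red0 p A \<longleftrightarrow> A = \<zero>\<^bsub>Qp p\<^esub> \<or> qp_val p A > 0"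

definition qp_int :: "nat \<Rightarrow> (nat \<Rightarrow> rat) set \<Rightarrow> bool" where
  "qp_int p A \<longleftrightarrow> A = \<zero>\<^bsub>Qp p\<^esub> \<or> qp_val p A \<ge> 0"

text \<open>Coefficients are given as a function c with c 1, c 2, c 3, c 4, c 6 = a1,a2,a3,a4,a6.\<close>

datatype 'a ecpt = Inf | Aff 'a 'a

definition wc_on :: "('a, 'm) ring_scheme \<Rightarrow> (nat \<Rightarrow> 'a) \<Rightarrow> 'a \<Rightarrow> 'a \<Rightarrow> bool" where
  "wc_on R c x y \<longleftrightarrow> x \<in> carrier R \<and> y \<in> carrier R \<and>
     (let pl = ring.add R; ti = monoid.mult R in
      pl (pl (ti y y) (ti (ti (c 1) x) y)) (ti (c 3) y)
      = pl (pl (pl (ti (ti x x) x) (ti (ti (c 2) x) x)) (ti (c 4) x)) (c 6))"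

definition wc_points :: "('a, 'm) ring_scheme \<Rightarrow> (nat \<Rightarrow> 'a) \<Rightarrow> 'a ecpt set" where
  "wc_points R c = {Inf} \<union> {Aff x y | x y. wc_on R c x y}"

text \<open>Standard addition law (Silverman, Alg. III.2.3).\<close>
definition wc_add :: "('a, 'm) ring_scheme \<Rightarrow> (nat \<Rightarrow> 'a) \<Rightarrow> 'a ecpt \<Rightarrow> 'a ecpt \<Rightarrow> 'a ecpt" where
  "wc_add R c P Q =
    (let pl = ring.add R; ti = monoid.mult R; mi = a_minus R; ng = a_inv R; iv = m_inv R;
         two = add_pow R (2::nat) (monoid.one R); three = add_pow R (3::nat) (monoid.one R) in
     (case P of Inf \<Rightarrow> Q
      | Aff x1 y1 \<Rightarrow> (case Q of Inf \<Rightarrow> P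
        | Aff x2 y2 \<Rightarrow>
          (if x1 = x2 \<and> pl (pl (pl y1 y2) (ti (c 1) x2)) (c 3) = ring.zero R then Inf
           else
           (let den = pl (pl (ti two y1) (ti (c 1) x1)) (c 3);
                lam = (if x1 = x2
                       then ti (mi (pl (pl (ti three (ti x1 x1)) (ti (ti two (c 2)) x1)) (c 4)) (ti (c 1) y1)) (iv den)
                       else ti (mi y2 y1) (iv (mi x2 x1)));
                nu = (if x1 = x2
                       then ti (mi (pl (pl (ng (ti (ti x1 x1) x1)) (ti (c 4) x1)) (ti two (c 6))) (ti (c 3) y1)) (iv den)
                       else ti (mi (ti y1 x2) (ti y2 x1)) (iv (mi x2 x1)));
                x3 = mi (mi (mi (pl (ti lam lam) (ti (c 1) lam)) (c 2)) x1) x2;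
                y3 = mi (mi (ng (ti (pl lam (c 1)) x3)) nu) (c 3)
            in Aff x3 y3)))))"

definition wc_group :: "('a, 'm) ring_scheme \<Rightarrow> (nat \<Rightarrow> 'a) \<Rightarrow> 'a ecpt monoid" where
  "wc_group R c = \<lparr> carrier = wc_points R c, monoid.mult = wc_add R c, monoid.one = Inf \<rparr>"

text \<open>A model is a coefficient function a :: nat => rat (a 1, a 2, a 3, a 4, a 6).\<close>

definition disc :: "(nat \<Rightarrow> rat) \<Rightarrow> rat" where
  "disc a = (let b2 = a 1 ^ 2 + 4 * a 2; b4 = 2 * a 4 + a 1 * a 3; b6 = a 3 ^ 2 + 4 * a 6;
                 b8 = a 1 ^ 2 * a 6 + 4 * a 2 * a 6 - a 1 * a 3 * a 4 + a 2 * a 3 ^ 2 - a 4 ^ 2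
             in - (b2 ^ 2 * b8) - 8 * b4 ^ 3 - 27 * b6 ^ 2 + 9 * b2 * b4 * b6)"

definition is_weierstrass :: "(nat \<Rightarrow> rat) \<Rightarrow> bool" where
  "is_weierstrass a \<longleftrightarrow> disc a \<noteq> 0"

definition p_integral_model :: "nat \<Rightarrow> (nat \<Rightarrow> rat) \<Rightarrow> bool" where
  "p_integral_model p a \<longleftrightarrow> (\<forall>i\<in>{1,2,3,4,6::nat}. rat_pint p (a i))"

text \<open>b is obtained from a by an admissible change of variables
  x = u^2 x' + r, y = u^3 y' + s u^2 x' + t over Q (Silverman Table 3.1).\<close>
definition models_iso :: "(nat \<Rightarrow> rat) \<Rightarrow> (nat \<Rightarrow> rat) \<Rightarrow> bool" where
  "models_iso a b \<longleftrightarrow> (\<exists>u r s t. u \<noteq> 0 \<and>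
     u * b 1 = a 1 + 2 * s \<and>
     u ^ 2 * b 2 = a 2 - s * a 1 + 3 * r - s ^ 2 \<and>
     u ^ 3 * b 3 = a 3 + r * a 1 + 2 * t \<and>
     u ^ 4 * b 4 = a 4 - s * a 3 + 2 * r * a 2 - (t + r * s) * a 1 + 3 * r ^ 2 - 2 * s * t \<and>
     u ^ 6 * b 6 = a 6 + r * a 4 + r ^ 2 * a 2 + r ^ 3 - t * a 3 - t ^ 2 - r * t * a 1)"

definition p_minimal :: "nat \<Rightarrow> (nat \<Rightarrow> rat) \<Rightarrow> bool" where
  "p_minimal p a \<longleftrightarrow> p_integral_model p a \<and>
     (\<forall>b. models_iso a b \<and> p_integral_model p b \<longrightarrow> rat_val p (disc a) \<le> rat_val p (disc b))"

definition Ecoef :: "nat \<Rightarrow> (nat \<Rightarrow> rat) \<Rightarrow> nat \<Rightarrow> (nat \<Rightarrow> rat) set" where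
  "Ecoef p a = (\<lambda>i. qp_of_rat p (a i))"

definition EQp :: "nat \<Rightarrow> (nat \<Rightarrow> rat) \<Rightarrow> (nat \<Rightarrow> rat) set ecpt monoid" where
  "EQp p a = wc_group (Qp p) (Ecoef p a)"

text \<open>E^0(Q_p): points with non-singular reduction mod p (w.r.t. the p-integral model a).
  A point with a non-integral coordinate reduces to the point at infinity (non-singular);
  an integral point reduces to a singular point iff both partial derivatives
  F_x = a1 y - 3x^2 - 2 a2 x - a4 and F_y = 2y + a1 x + a3 vanish mod p.\<close>
definition E0 :: "nat \<Rightarrow> (nat \<Rightarrow> rat) \<Rightarrow> (nat \<Rightarrow> rat) set ecpt set" where
  "E0 p a = {P \<in> wc_points (Qp p) (Ecoef p a). case P of Inf \<Rightarrow> True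
     | Aff x y \<Rightarrow> \<not> qp_int p x \<or> \<not> qp_int p y \<or>
        (let R = Qp p; c = Ecoef p a; pl = ring.add R; ti = monoid.mult R; mi = a_minus R;
             two = add_pow R (2::nat) (monoid.one R); three = add_pow R (3::nat) (monoid.one R);
             Fx = mi (mi (mi (ti (c 1) y) (ti three (ti x x))) (ti (ti two (c 2)) x)) (c 4);
             Fy = pl (pl (ti two y) (ti (c 1) x)) (c 3)
         in \<not> (qp_red0 p Fx \<and> qp_red0 p Fy))}"

definition Efilt :: "nat \<Rightarrow> (nat \<Rightarrow> rat) \<Rightarrow> nat \<Rightarrow> (nat \<Rightarrow> rat) set ecpt set" where
  "Efilt p a n = (if n = 0 then E0 p a else
     {P \<in> wc_points (Qp p) (Ecoef p a). case P of Inf \<Rightarrow> True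
        | Aff x y \<Rightarrow> x \<noteq> \<zero>\<^bsub>Qp p\<^esub> \<and> qp_val p x \<le> - 2 * int n})"

definition Eindex :: "nat \<Rightarrow> (nat \<Rightarrow> rat) \<Rightarrow> (nat \<Rightarrow> rat) set ecpt set \<Rightarrow> nat" where
  "Eindex p a H = card (RCOSETS (EQp p a) H)"

definition tamagawa :: "nat \<Rightarrow> (nat \<Rightarrow> rat) \<Rightarrow> nat" where
  "tamagawa p amin = Eindex p amin (E0 p amin)"

text \<open>Number of non-singular F_p-points of the reduction of the model (including the point at infinity).\<close>
definition Np :: "nat \<Rightarrow> (nat \<Rightarrow> rat) \<Rightarrow> nat" where
  "Np p a = card {(x, y) \<in> {0..<p} \<times> {0..<p}.
      (let S = of_nat x :: rat; T = of_nat y :: rat;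
           F = T ^ 2 + a 1 * S * T + a 3 * T - S ^ 3 - a 2 * S ^ 2 - a 4 * S - a 6;
           Fx = a 1 * T - 3 * S ^ 2 - 2 * a 2 * S - a 4;
           Fy = 2 * T + a 1 * S + a 3
       in rat_red0 p F \<and> \<not> (rat_red0 p Fx \<and> rat_red0 p Fy))} + 1"

end

theory Submission
  imports Defs "HOL-Library.Set_Algebras"
begin

text \<open>
  A change of variables with parameters \<open>u, r, s, t\<close> between two \<open>p\<close>-integral models has \<open>r, s, t\<close>
  integral as soon as \<open>u\<close> is, and \<open>k = v(u)\<close>. After translating, the model \<open>E\<close> has coefficients
  \<open>u\<^sup>i a\<^sub>i\<close>, so for \<open>k \<ge> 1\<close> its reduction is the cusp \<open>y\<^sup>2 = x\<^sup>3\<close>, and a point is non-singular modulo \<open>p\<close>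
  exactly if \<open>v(u\<^sup>2 x) \<le> 0\<close> for its coordinate \<open>x\<close> on the minimal model. This identifies
  \<open>E\<^sup>n\<close> with the step \<open>n + k\<close> of the filtration of the minimal model.

  The same identification, applied to the models \<open>p\<^sup>i\<^sup>k a\<^sub>i\<close>, reduces every index
  \<open>[E\<^sup>k : E\<^sup>k\<^sup>+\<^sup>1]\<close> to \<open>[E\<^sup>0 : E\<^sup>1]\<close> of some integral model. That index is the number of non-singular
  points of the reduction: fibres of the reduction map are cosets of \<open>E\<^sup>1\<close> (look at the line through two
  points modulo \<open>p\<close>), and the map is onto by Hensel's lemma. A cusp has \<open>p\<close> non-singular points.

  Associativity of the chord-tangent law is obtained from the ideal class group of the coordinate
  ring: a point goes to its maximal ideal, collinear points to a principal product, and no maximal ideal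
  of a point is principal, because the norm of a regular function never has degree 1.
\<close>

section \<open>The chord-tangent law\<close>

text \<open>Coefficients are values \<open>c 1, \<dots>, c 6\<close> of a function; without this declaration the simplifier
  would turn \<open>c 1\<close> into \<open>c (Suc 0)\<close>.\<close>

declare One_nat_def [simp del]

text \<open>The isomorphism of filtrations is the change of variables itself, so it only has to
  respect the addition formulas. Associativity enters where indices are multiplied along the
  filtration, and there for the minimal model alone: all other models enter through multiplicative
  bijections. The factor N_p p^(k-1) comes from the step E^0 / E^1 of the minimal model and from k -
  1 further steps with cuspidal reduction. The addition law splits into chords, tangents and
  opposite points and contains divisions. It is replaced by the three Vieta relations of a line,
  which treat chord and tangent alike, are polynomial, and carry over to a change of variables, to
  ideals of the coordinate ring and to congruences modulo p. Residue characteristics 2 and 3 are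
  included; where they could interfere, the way out is that 3 and a power of 2 cannot both be
  non-units.\<close>

definition on_curve :: "(nat \<Rightarrow> 'a::field) \<Rightarrow> 'a \<Rightarrow> 'a \<Rightarrow> bool" where
  "on_curve c x y \<longleftrightarrow> y * y + c 1 * x * y + c 3 * y = x * x * x + c 2 * x * x + c 4 * x + c 6"

definition sing_pt :: "(nat \<Rightarrow> 'a::field) \<Rightarrow> 'a \<Rightarrow> 'a \<Rightarrow> bool" where
  "sing_pt c x y \<longleftrightarrow> c 1 * y - 3 * (x * x) - 2 * c 2 * x - c 4 = 0 \<and> 2 * y + c 1 * x + c 3 = 0"

definition ec_add :: "(nat \<Rightarrow> 'a::field) \<Rightarrow> 'a ecpt \<Rightarrow> 'a ecpt \<Rightarrow> 'a ecpt" where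
  "ec_add c P Q = (case P of Inf \<Rightarrow> Q | Aff x1 y1 \<Rightarrow> (case Q of Inf \<Rightarrow> P | Aff x2 y2 \<Rightarrow>
     (if x1 = x2 \<and> y1 + y2 + c 1 * x2 + c 3 = 0 then Inf else
      (let den = 2 * y1 + c 1 * x1 + c 3;
           lam = (if x1 = x2 then (3 * (x1 * x1) + 2 * c 2 * x1 + c 4 - c 1 * y1) * inverse den
                  else (y2 - y1) * inverse (x2 - x1));
           nu = (if x1 = x2 then (- (x1 * x1 * x1) + c 4 * x1 + 2 * c 6 - c 3 * y1) * inverse den
                  else (y1 * x2 - y2 * x1) * inverse (x2 - x1));
           x3 = lam * lam + c 1 * lam - c 2 - x1 - x2;
           y3 = - ((lam + c 1) * x3) - nu - c 3
       in Aff x3 y3))))"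

fun ec_pt :: "(nat \<Rightarrow> 'a::field) \<Rightarrow> 'a ecpt \<Rightarrow> bool" where
  "ec_pt c Inf = True" | "ec_pt c (Aff x y) = on_curve c x y"

fun ec_neg :: "(nat \<Rightarrow> 'a::field) \<Rightarrow> 'a ecpt \<Rightarrow> 'a ecpt" where
  "ec_neg c Inf = Inf" | "ec_neg c (Aff x y) = Aff x (- y - c 1 * x - c 3)"

text \<open>The line \<open>y = l x + n\<close> meets the curve in points with \<open>x\<close>-coordinates \<open>x1, x2, x3\<close>, counted with
  multiplicity: these are the Vieta relations of the resulting cubic.\<close>

definition line_roots :: "(nat \<Rightarrow> 'a::field) \<Rightarrow> 'a \<Rightarrow> 'a \<Rightarrow> 'a \<Rightarrow> 'a \<Rightarrow> 'a \<Rightarrow> bool" where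
  "line_roots c l n x1 x2 x3 \<longleftrightarrow>
     x1 + x2 + x3 = l * l + c 1 * l - c 2 \<and>
     x1 * x2 + x1 * x3 + x2 * x3 = c 4 - 2 * l * n - c 1 * n - c 3 * l \<and>
     x1 * x2 * x3 = n * n + c 3 * n - c 6"

lemma line_roots_sym: "line_roots c l n x1 x2 x3 \<Longrightarrow> line_roots c l n x2 x1 x3" "line_roots c l n x1 x2 x3 \<Longrightarrow> line_roots c l n x1 x3 x2"
  by (auto simp: line_roots_def algebra_simps)

lemma same_x_same_y: assumes "on_curve c x y1" "on_curve c x y2" "y1 + y2 + c 1 * x + c 3 \<noteq> 0" shows "y1 = y2"
proof -
  have "(y1 - y2) * (y1 + y2 + c 1 * x + c 3) = 0" using assms(1,2) unfolding on_curve_def by Groebner_Basis.algebra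
  thus ?thesis using assms(3) by simp
qed

text \<open>The first Vieta relation defines the third root. The second is the difference of the two
  curve equations divided by \<open>x2 - x1\<close>, and the third then follows from one curve
  equation.\<close>

lemma ec_add_chord: 
  assumes "on_curve c x1 y1" "on_curve c x2 y2" "x1 \<noteq> x2" 
  defines "l \<equiv> (y2 - y1) * inverse (x2 - x1)" and "n \<equiv> (y1 * x2 - y2 * x1) * inverse (x2 - x1)"
  shows "y1 = l * x1 + n \<and> y2 = l * x2 + n \<and> line_roots c l n x1 x2 (l * l + c 1 * l - c 2 - x1 - x2)"
proof -
  have d: "x2 - x1 \<noteq> 0" using assms(3) by simp
  have l: "l * (x2 - x1) = y2 - y1" and n: "n * (x2 - x1) = y1 * x2 - y2 * x1"
    unfolding l_def n_def using d by auto
  have "(y1 - (l * x1 + n)) * (x2 - x1) = 0" "(y2 - (l * x2 + n)) * (x2 - x1) = 0"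
    using l n by Groebner_Basis.algebra+
  hence y: "y1 = l * x1 + n" "y2 = l * x2 + n" using d by auto
  define x3 where "x3 = l * l + c 1 * l - c 2 - x1 - x2"
  have "(x1 * x2 + x1 * x3 + x2 * x3 - (c 4 - 2 * l * n - c 1 * n - c 3 * l)) * (x2 - x1) = 0"
    using assms(1,2) unfolding on_curve_def y x3_def by Groebner_Basis.algebra
  hence e2: "x1 * x2 + x1 * x3 + x2 * x3 = c 4 - 2 * l * n - c 1 * n - c 3 * l" using d by simp
  have e3: "x1 * x2 * x3 = n * n + c 3 * n - c 6"
    using assms(1) e2 unfolding on_curve_def y x3_def by Groebner_Basis.algebra
  show ?thesis using y e2 e3 unfolding line_roots_def x3_def[symmetric] by (simp add: x3_def)
qed

text \<open>The equation of the tangent slope takes the place of the difference of two curve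
  equations: it says that the derivative of the cubic vanishes at the double root, which yields the
  second Vieta relation.\<close>

lemma ec_add_tangent: 
  assumes "on_curve c x1 y1" "2 * y1 + c 1 * x1 + c 3 \<noteq> 0"
  defines "l \<equiv> (3 * (x1 * x1) + 2 * c 2 * x1 + c 4 - c 1 * y1) * inverse (2 * y1 + c 1 * x1 + c 3)"
    and "n \<equiv> (- (x1 * x1 * x1) + c 4 * x1 + 2 * c 6 - c 3 * y1) * inverse (2 * y1 + c 1 * x1 + c 3)"
  shows "y1 = l * x1 + n \<and> line_roots c l n x1 x1 (l * l + c 1 * l - c 2 - x1 - x1)"
proof -
  define d where "d = 2 * y1 + c 1 * x1 + c 3"
  have d: "d \<noteq> 0" using assms(2) by (simp add: d_def)
  have l: "l * d = 3 * (x1 * x1) + 2 * c 2 * x1 + c 4 - c 1 * y1" 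
   and n: "n * d = - (x1 * x1 * x1) + c 4 * x1 + 2 * c 6 - c 3 * y1"
    unfolding l_def n_def d_def[symmetric] using d by auto
  have "(y1 - (l * x1 + n)) * d = 0"
    using l n assms(1) unfolding on_curve_def d_def by Groebner_Basis.algebra
  hence y: "y1 = l * x1 + n" using d by auto
  define x3 where "x3 = l * l + c 1 * l - c 2 - x1 - x1"
  have e2: "x1 * x1 + x1 * x3 + x1 * x3 = c 4 - 2 * l * n - c 1 * n - c 3 * l"
    using l unfolding y x3_def d_def by Groebner_Basis.algebra
  have e3: "x1 * x1 * x3 = n * n + c 3 * n - c 6"
    using assms(1) e2 unfolding on_curve_def y x3_def by Groebner_Basis.algebra
  show ?thesis using y e2 e3 unfolding line_roots_def x3_def[symmetric] by (simp add: x3_def)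
qed

text \<open>Chord and tangent are merged here. Most later arguments see only a line with three
  roots, a tangent being the case \<open>x1 = x2\<close>.\<close>

lemma ec_add_line:
  assumes "on_curve c x1 y1" "on_curve c x2 y2" "\<not> (x1 = x2 \<and> y1 + y2 + c 1 * x2 + c 3 = 0)"
  obtains l n x3 where "y1 = l * x1 + n" "y2 = l * x2 + n" "line_roots c l n x1 x2 x3"
    "ec_add c (Aff x1 y1) (Aff x2 y2) = ec_neg c (Aff x3 (l * x3 + n))"
proof (cases "x1 = x2")
  case True
  then have y: "y1 = y2" using assms same_x_same_y by metis
  have d: "2 * y1 + c 1 * x1 + c 3 \<noteq> 0" using assms(3) True y by auto
  let ?l = "(3 * (x1 * x1) + 2 * c 2 * x1 + c 4 - c 1 * y1) * inverse (2 * y1 + c 1 * x1 + c 3)"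
  let ?n = "(- (x1 * x1 * x1) + c 4 * x1 + 2 * c 6 - c 3 * y1) * inverse (2 * y1 + c 1 * x1 + c 3)"
  let ?x3 = "?l * ?l + c 1 * ?l - c 2 - x1 - x1"
  show thesis
  proof (rule that)
    show "ec_add c (Aff x1 y1) (Aff x2 y2) = ec_neg c (Aff ?x3 (?l * ?x3 + ?n))"
      using assms(3) True by (simp add: ec_add_def Let_def y algebra_simps)
  qed (use ec_add_tangent[OF assms(1) d] y True in \<open>simp_all\<close>)
next
  case False
  let ?l = "(y2 - y1) * inverse (x2 - x1)" and ?n = "(y1 * x2 - y2 * x1) * inverse (x2 - x1)"
  let ?x3 = "?l * ?l + c 1 * ?l - c 2 - x1 - x2"
  note * = ec_add_chord[OF assms(1,2) False]
  show thesis
  proof (rule that)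
    show "ec_add c (Aff x1 y1) (Aff x2 y2) = ec_neg c (Aff ?x3 (?l * ?x3 + ?n))"
      using False by (simp add: ec_add_def Let_def algebra_simps)
  qed (use * in \<open>simp_all\<close>)
qed

lemma line_roots_on_curve: "line_roots c l n x1 x2 x3 \<Longrightarrow> on_curve c x3 (l * x3 + n)"
  unfolding line_roots_def on_curve_def by Groebner_Basis.algebra

lemma on_curve_neg: "on_curve c x y \<Longrightarrow> on_curve c x (- y - c 1 * x - c 3)"
  unfolding on_curve_def by Groebner_Basis.algebra

lemma ec_pt_neg: "ec_pt c P \<Longrightarrow> ec_pt c (ec_neg c P)"
  by (cases P) (auto intro: on_curve_neg)

lemma ec_pt_add: assumes "ec_pt c P" "ec_pt c Q" shows "ec_pt c (ec_add c P Q)"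
proof (cases P)
  case Inf thus ?thesis using assms by (simp add: ec_add_def)
next
  case P: (Aff x1 y1)
  show ?thesis
  proof (cases Q)
    case Inf thus ?thesis using assms P by (simp add: ec_add_def)
  next
    case Q: (Aff x2 y2)
    show ?thesis
    proof (cases "x1 = x2 \<and> y1 + y2 + c 1 * x2 + c 3 = 0")
      case True thus ?thesis by (simp add: P Q ec_add_def)
    next
      case False
      obtain l n x3 where "line_roots c l n x1 x2 x3"
         "ec_add c (Aff x1 y1) (Aff x2 y2) = ec_neg c (Aff x3 (l * x3 + n))"
        using ec_add_line[OF _ _ False] assms unfolding P Q ec_pt.simps by metis
      thus ?thesis using line_roots_on_curve ec_pt_neg P Q by (metis ec_pt.simps(2))
    qed
  qed
qed

section \<open>The coordinate ring and associativity\<close>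

text \<open>Ideals of a commutative ring are the spans in the ring as a module over itself, and products of
  ideals are handled through products of generating sets.\<close>

interpretation idl: Modules.module "(*) :: 'a::comm_ring_1 \<Rightarrow> 'a \<Rightarrow> 'a"
  by unfold_locales (auto simp: algebra_simps)

text \<open>As a simplification rule this is associativity from right to left, which loops with \<open>ac_simps\<close>.\<close>

declare idl.scale_scale [simp del]

section \<open>Products of ideals given by generators\<close>

lemma span_times_mono:
  fixes S T H :: "'a::comm_ring_1 set"
  assumes "S \<subseteq> idl.span T" shows "S * H \<subseteq> idl.span (T * H)"
proof
  fix z assume "z \<in> S * H"
  then obtain s h where z: "z = s * h" "s \<in> S" "h \<in> H" by (auto elim: set_times_elim)
  have "idl.subspace {s. s * h \<in> idl.span (T * H)}"
    by (auto simp: idl.subspace_def distrib_right mult.assoc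
        intro: idl.span_zero idl.span_add idl.span_scale)
  moreover have "T \<subseteq> {s. s * h \<in> idl.span (T * H)}"
    using z(3) by (auto intro: idl.span_base)
  ultimately have "idl.span T \<subseteq> {s. s * h \<in> idl.span (T * H)}"
    by (rule idl.span_minimal[rotated])
  with assms z show "z \<in> idl.span (T * H)" by auto
qed

lemma span_times_cong:
  fixes S T H :: "'a::comm_ring_1 set"
  assumes "idl.span S = idl.span T" shows "idl.span (S * H) = idl.span (T * H)"
proof -
  have "S * H \<subseteq> idl.span (T * H)" "T * H \<subseteq> idl.span (S * H)"
    using assms idl.span_superset by (auto intro!: span_times_mono)
  thus ?thesis by (metis idl.span_eq)
qed

text \<open>To be read with \<open>a\<close> and \<open>e\<close> as x - x1 and x - x3,
  \<open>l\<close> as the line, \<open>l'\<close> as its conjugate, and \<open>d\<close> as the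
  derivative F_y at the point of contact, a unit. Since d = - l - l' - m a, multiplication by
  \<open>d\<close> pulls first a l, then l^2, and finally l itself into the ideal.\<close>

lemma span_times_eq_principal_double:
  fixes a e l l' d m u :: "'a::comm_ring_1"
  assumes abe: "l * l' = - (a * a * e)" and l': "l' = - l - m * a - d" and u: "u * d = 1"
  shows "idl.span ({a,l} * {a,l} * {e,l}) = idl.span {l}"
proof -
  let ?S = "idl.span ({a,l} * {a,l} * {e,l})"
  have S: "a * a * e \<in> ?S" "a * l * l \<in> ?S" "l * l * l \<in> ?S" "a * a * l \<in> ?S"
    by (rule idl.span_base, intro set_times_intro, simp_all)+
  have ll': "l * l' \<in> ?S" using S(1) unfolding abe by (rule idl.span_neg)
  have "d * (a * l) = - (a * (l * l') + a * l * l + m * (a * a * l))"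
    unfolding l' by (simp add: algebra_simps)
  also have "\<dots> \<in> ?S" by (intro idl.span_neg idl.span_add idl.span_scale S ll')
  finally have "u * (d * (a * l)) \<in> ?S" by (rule idl.span_scale)
  hence al: "a * l \<in> ?S" using u by (simp add: mult.assoc[symmetric])
  have "d * (l * l) = - (l * (l * l') + l * l * l + m * (a * l * l))"
    unfolding l' by (simp add: algebra_simps)
  also have "\<dots> \<in> ?S" by (intro idl.span_neg idl.span_add idl.span_scale S ll')
  finally have "u * (d * (l * l)) \<in> ?S" by (rule idl.span_scale)
  hence l2: "l * l \<in> ?S" using u by (simp add: mult.assoc[symmetric])
  have "d * l = - (l * l' + l * l + m * (a * l))"
    unfolding l' by (simp add: algebra_simps)
  also have "\<dots> \<in> ?S" by (intro idl.span_neg idl.span_add idl.span_scale S ll' l2 al)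
  finally have "u * (d * l) \<in> ?S" by (rule idl.span_scale)
  hence "l \<in> ?S" using u by (simp add: mult.assoc[symmetric])
  moreover have "{a,l} * {a,l} * {e,l} \<subseteq> idl.span {l}"
  proof
    fix z assume "z \<in> {a,l} * {a,l} * {e,l}"
    then have "z \<in> {a*a*e, a*a*l, a*l*e, a*l*l, l*a*e, l*a*l, l*l*e, l*l*l}"
      unfolding set_times_def by blast
    moreover have "l dvd a * a * e" using abe by (metis dvd_minus_iff dvd_triv_left)
    ultimately have "l dvd z" by (elim insertE emptyE) (simp_all add: dvd_mult dvd_mult2)
    then obtain r where "z = r * l" by (metis dvdE mult.commute)
    thus "z \<in> idl.span {l}" by (auto intro: idl.span_scale idl.span_base)
  qed
  ultimately show ?thesis by (subst idl.span_eq) auto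
qed

text \<open>The factors x - x1, x - x2, x - x3 differ by constants, which are units for distinct
  roots; combinations of the generators a b l, a l e and l b e with these units isolate
  \<open>l\<close>.\<close>

lemma span_times_eq_principal_distinct:
  fixes a b e l l' :: "'a::comm_ring_1"
  assumes abe: "l * l' = - (a * b * e)" and u: "u * (a - b) = 1" "v * (b - e) = 1" "w * (a - e) = 1"
  shows "idl.span ({a,l} * {b,l} * {e,l}) = idl.span {l}"
proof -
  let ?S = "idl.span ({a,l} * {b,l} * {e,l})"
  have S: "a * b * l \<in> ?S" "a * l * e \<in> ?S" "l * b * e \<in> ?S"
    by (rule idl.span_base, intro set_times_intro, simp_all)+
  have 1: "a * l = v * (a * b * l - a * l * e)"
  proof -
    have "v * (a * b * l - a * l * e) = v * (b - e) * (a * l)" by (simp add: algebra_simps)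
    thus ?thesis using u by simp
  qed
  have 2: "b * l = w * (a * b * l - l * b * e)"
  proof -
    have "w * (a * b * l - l * b * e) = w * (a - e) * (b * l)" by (simp add: algebra_simps)
    thus ?thesis using u by simp
  qed
  have 3: "l = u * (a * l - b * l)"
  proof -
    have "u * (a * l - b * l) = u * (a - b) * l" by (simp add: algebra_simps)
    thus ?thesis using u by simp
  qed
  have al: "a * l \<in> ?S" by (subst 1) (intro idl.span_scale idl.span_diff S)
  have bl: "b * l \<in> ?S" by (subst 2) (intro idl.span_scale idl.span_diff S)
  have "l \<in> ?S" by (subst (1) 3) (intro idl.span_scale idl.span_diff al bl)
  moreover have "{a,l} * {b,l} * {e,l} \<subseteq> idl.span {l}"
  proof
    fix z assume "z \<in> {a,l} * {b,l} * {e,l}"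
    then have "z \<in> {a*b*e, a*b*l, a*l*e, a*l*l, l*b*e, l*b*l, l*l*e, l*l*l}"
      unfolding set_times_def by blast
    moreover have "l dvd a * b * e" using abe by (metis dvd_minus_iff dvd_triv_left)
    ultimately have "l dvd z" by (elim insertE emptyE) (simp_all add: dvd_mult dvd_mult2)
    then obtain r where "z = r * l" by (metis dvdE mult.commute)
    thus "z \<in> idl.span {l}" by (auto intro: idl.span_scale idl.span_base)
  qed
  ultimately show ?thesis by (subst idl.span_eq) auto
qed

text \<open>The equation of the curve is part of the type class, so that the coordinate ring is a type and
  inherits the automation for commutative rings.\<close>

class weierstrass_field = field +
  fixes wcoef :: "nat \<Rightarrow> 'a"

declare [[typedef_overloaded]]

text \<open>\<open>Crd A B\<close> stands for \<open>A(x) + B(x) y\<close>.\<close>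

datatype (plugins only:) 'a::zero crd = Crd (crd0: "'a poly") (crd1: "'a poly")

text \<open>The equation of the curve reads y^2 = \<open>wcub\<close> - \<open>wlin\<close>
  y.\<close>

definition wlin :: "'a::weierstrass_field poly" where "wlin = [:wcoef 3, wcoef 1:]"
definition wcub :: "'a::weierstrass_field poly" where "wcub = [:wcoef 6, wcoef 4, wcoef 2, 1:]"

instantiation crd :: (weierstrass_field) comm_ring_1
begin
definition "0 = Crd 0 0"
definition "1 = Crd 1 0"
definition "f + g = Crd (crd0 f + crd0 g) (crd1 f + crd1 g)"
definition "f - g = Crd (crd0 f - crd0 g) (crd1 f - crd1 g)"
definition "- f = Crd (- crd0 f) (- crd1 f)"
definition "f * g = Crd (crd0 f * crd0 g + crd1 f * crd1 g * wcub)
   (crd0 f * crd1 g + crd1 f * crd0 g - crd1 f * crd1 g * wlin)"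
instance
proof
  fix f g h :: "'a crd"
  note d = zero_crd_def one_crd_def plus_crd_def minus_crd_def uminus_crd_def times_crd_def
  show "f + g + h = f + (g + h)" "f + g = g + f" "0 + f = f" "- f + f = 0" "f - g = f + - g"
    "1 * f = f" "(0 :: 'a crd) \<noteq> 1" by (simp_all add: d crd.expand)
  show "f * g = g * f" by (simp add: d ac_simps)
  show "(f + g) * h = f * h + g * h" by (simp add: d algebra_simps)
  show "f * g * h = f * (g * h)" by (simp add: d) (simp add: algebra_simps)
qed
end

lemmas crd_defs = zero_crd_def one_crd_def plus_crd_def minus_crd_def uminus_crd_def times_crd_def

text \<open>The product of \<open>A + B y\<close> with its conjugate under \<open>y \<mapsto> - y - a\<^sub>1 x - a\<^sub>3\<close>.\<close>

definition crd_norm :: "'a::weierstrass_field crd \<Rightarrow> 'a poly" where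
  "crd_norm f = crd0 f * crd0 f - crd0 f * crd1 f * wlin - crd1 f * crd1 f * wcub"

lemma crd_norm_mult: "crd_norm (f * g) = crd_norm f * crd_norm g"
  by (simp add: crd_norm_def crd_defs algebra_simps)

lemma degree_wcub: "degree (wcub :: 'a::weierstrass_field poly) = 3" by (simp add: wcub_def)
lemma degree_wlin: "degree (wlin :: 'a::weierstrass_field poly) \<le> 1" by (simp add: wlin_def)

text \<open>The degree is the maximum of the even number \<open>2 deg A\<close> and the odd number \<open>2 deg B + 3\<close>.\<close>

lemma degree_crd_norm:
  fixes f :: "'a::weierstrass_field crd"
  assumes "f \<noteq> 0" shows "crd_norm f \<noteq> 0" "degree (crd_norm f) \<noteq> 1"
proof -
  obtain A B where f: "f = Crd A B" by (cases f)
  have *: "crd_norm f = A * A - (A * B * wlin + B * B * wcub)" by (simp add: crd_norm_def f algebra_simps)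
  have "crd_norm f \<noteq> 0 \<and> degree (crd_norm f) \<noteq> 1"
  proof (cases "B = 0")
    case True
    then have "A \<noteq> 0" using assms f by (auto simp: crd_defs)
    thus ?thesis using True by (simp add: * degree_mult_eq) presburger
  next
    case B: False
    have w: "wcub \<noteq> (0::'a poly)" by (simp add: wcub_def)
    have d3: "degree (B * B * wcub) = 2 * degree B + 3"
      using B w by (simp add: degree_mult_eq degree_wcub)
    have d2: "degree (A * B * wlin) \<le> degree A + degree B + 1"
      using degree_mult_le[of "A * B" wlin] degree_mult_le[of A B] degree_wlin[where 'a='a] by linarith
    show ?thesis
    proof (cases "degree A \<ge> degree B + 2")
      case True
      hence A: "A \<noteq> 0" by auto
      have d1: "degree (A * A) = 2 * degree A" using A by (simp add: degree_mult_eq)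
      have "degree (A * B * wlin + B * B * wcub) < degree (A * A)"
        by (rule degree_add_less) (use d1 d2 d3 True in linarith)+
      hence "degree (crd_norm f) = 2 * degree A" unfolding * using d1
        by (metis degree_add_eq_left degree_minus diff_conv_add_uminus)
      thus ?thesis using True by auto
    next
      case False
      have d1: "degree (A * A) \<le> 2 * degree A" using degree_mult_le[of A A] by simp
      have "degree (A * A - A * B * wlin) < degree (B * B * wcub)"
        by (rule degree_diff_less) (use d1 d2 d3 False in linarith)+
      moreover have "crd_norm f = (A * A - A * B * wlin) - B * B * wcub" by (simp add: *)
      ultimately have "degree (crd_norm f) = 2 * degree B + 3" using d3
        by (metis degree_add_eq_right degree_minus diff_conv_add_uminus)
      thus ?thesis by auto
    qed
  qed
  thus "crd_norm f \<noteq> 0" "degree (crd_norm f) \<noteq> 1" by auto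
qed

lemma crd_norm_0: "crd_norm 0 = 0" by (simp add: crd_norm_def crd_defs)

instance crd :: (weierstrass_field) idom
proof
  fix f g :: "'a crd" assume "f \<noteq> 0" "g \<noteq> 0"
  hence "crd_norm (f * g) \<noteq> 0" using degree_crd_norm by (auto simp: crd_norm_mult)
  thus "f * g \<noteq> 0" by (auto simp: crd_norm_0)
qed

section \<open>Ideals of points and of collinear triples\<close>

definition crdX :: "'a::weierstrass_field crd" where "crdX = Crd [:0,1:] 0"
definition crdY :: "'a::weierstrass_field crd" where "crdY = Crd 0 1"
definition crdC :: "'a::weierstrass_field \<Rightarrow> 'a crd" where "crdC a = Crd [:a:] 0"

lemma crdC_hom: "crdC 0 = 0" "crdC 1 = 1" "crdC (a + b) = crdC a + crdC b" "crdC (a - b) = crdC a - crdC b"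
  "crdC (- a) = - crdC a" "crdC (a * b) = crdC a * crdC b" "crdC a = crdC b \<longleftrightarrow> a = b"
  by (auto simp: crdC_def crd_defs one_pCons)

lemma crdC_2: "crdC 2 = 2" and crdC_3: "crdC 3 = 3"
proof -
  show 2: "crdC 2 = 2" using crdC_hom(3)[of 1 1] by (simp add: crdC_hom(2))
  show "crdC 3 = 3" using crdC_hom(3)[of 1 2] by (simp add: crdC_hom(2) 2)
qed

lemmas crdC_simps = crdC_hom crdC_2 crdC_3

lemma crd_relation: "crdY * crdY + crdC (wcoef 1) * crdX * crdY + crdC (wcoef 3) * crdY
   = crdX * crdX * crdX + crdC (wcoef 2) * crdX * crdX + crdC (wcoef 4) * crdX + crdC (wcoef 6)"
  by (simp add: crdX_def crdY_def crdC_def crd_defs wlin_def wcub_def one_pCons)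

lemma crdX_neq: "crdX - crdC x \<noteq> 0" 
  by (simp add: crdX_def crdC_def crd_defs)

lemma line_neq: "crdY - crdC l * crdX - crdC n \<noteq> 0" 
  by (simp add: crdX_def crdY_def crdC_def crd_defs)

fun pt_gens :: "'a::weierstrass_field ecpt \<Rightarrow> 'a crd set" where
  "pt_gens Inf = {1}" | "pt_gens (Aff x y) = {crdX - crdC x, crdY - crdC y}"

text \<open>The generator y - y_P can be traded for the equation of any line y = l x + n through the
  point, so that collinear points share a generator.\<close>

lemma pt_gens_line: 
  "idl.span (pt_gens (Aff x (l * x + n))) = idl.span {crdX - crdC x, crdY - crdC l * crdX - crdC n}"
proof -
  let ?a = "crdX - crdC x" and ?l = "crdY - crdC l * crdX - crdC n"
  let ?b = "crdY - crdC (l * x + n)"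
  have "?b = ?l + crdC l * ?a" "?l = ?b - crdC l * ?a" by (simp_all add: crdC_simps algebra_simps)
  hence "?b \<in> idl.span {?a, ?l}" "?l \<in> idl.span {?a, ?b}"
    by (metis idl.span_add idl.span_diff idl.span_base idl.span_scale insertCI)+
  thus ?thesis by (simp add: idl.span_eq idl.span_base)
qed

text \<open>Put a = x - x_P, b = y - y_P and b' = y - y_(-P). The curve equation becomes b b' = a q,
  where q takes the value - F_x at the point. The product ideal contains a^2, a b', b a and b b';
  from these a is recovered by a b' - b a if F_y is nonzero, and by b b' if F_x is nonzero.
  Non-singularity provides one of the two.\<close>

lemma pt_gens_neg:
  fixes x y :: "'a::weierstrass_field"
  assumes on: "on_curve wcoef x y" and ns: "\<not> sing_pt wcoef x y"
  shows "idl.span (pt_gens (Aff x y) * pt_gens (ec_neg wcoef (Aff x y))) = idl.span {crdX - crdC x}"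
proof -
  define y' where "y' = - y - wcoef 1 * x - wcoef 3"
  define a where "a = crdX - crdC x"
  define b where "b = crdY - crdC y"
  define b' where "b' = crdY - crdC y'"
  define q where "q = crdX * crdX + crdC x * crdX + crdC x * crdC x + crdC (wcoef 2) * (crdX + crdC x) + crdC (wcoef 4)
     - crdC (wcoef 1) * crdY"
  have on': "crdC y * crdC y + crdC (wcoef 1) * crdC x * crdC y + crdC (wcoef 3) * crdC y
    = crdC x * crdC x * crdC x + crdC (wcoef 2) * crdC x * crdC x + crdC (wcoef 4) * crdC x + crdC (wcoef 6)"
    using arg_cong[OF on[unfolded on_curve_def], of crdC] by (simp add: crdC_simps)
  have bb: "b * b' = a * q"
    using on' crd_relation[where 'a='a] unfolding a_def b_def b'_def q_def y'_def crdC_simps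
    by Groebner_Basis.algebra
  let ?S = "{a, b} * {a, b'}"
  have S: "a * a \<in> idl.span ?S" "a * b' \<in> idl.span ?S" "b * a \<in> idl.span ?S" "b * b' \<in> idl.span ?S"
    by (rule idl.span_base, intro set_times_intro, simp_all)+
  have "a \<in> idl.span ?S"
  proof (cases "2 * y + wcoef 1 * x + wcoef 3 = 0")
    case False
    define d where "d = 2 * y + wcoef 1 * x + wcoef 3"
    have "a * b' - b * a = a * crdC d"
      unfolding a_def b_def b'_def y'_def d_def crdC_simps by (simp add: algebra_simps)
    hence "crdC (inverse d) * (a * b' - b * a) = crdC (inverse d * d) * a" by (simp add: crdC_simps ac_simps)
    also have "\<dots> = a" using False by (simp add: crdC_simps d_def)
    finally have "a = crdC (inverse d) * (a * b' - b * a)" ..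
    also have "\<dots> \<in> idl.span ?S" by (intro idl.span_scale idl.span_diff S)
    finally show ?thesis .
  next
    case True
    define e where "e = 3 * x * x + 2 * wcoef 2 * x + wcoef 4 - wcoef 1 * y"
    have e: "e \<noteq> 0" using ns True unfolding sing_pt_def e_def by (auto simp: algebra_simps)
    have "crdC e * a = b * b' - (crdX + 2 * crdC x + crdC (wcoef 2)) * (a * a) + crdC (wcoef 1) * (b * a)"
      unfolding bb unfolding a_def b_def e_def q_def crdC_simps by (simp add: algebra_simps)
    also have "\<dots> \<in> idl.span ?S" by (intro idl.span_scale idl.span_diff idl.span_add S)
    finally have "crdC (inverse e) * (crdC e * a) \<in> idl.span ?S" by (rule idl.span_scale)
    moreover have "crdC (inverse e) * (crdC e * a) = crdC (inverse e * e) * a" by (simp add: crdC_simps)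
    ultimately show ?thesis using e by (simp add: crdC_simps)
  qed
  moreover have "?S \<subseteq> idl.span {a}"
  proof
    fix z assume "z \<in> ?S"
    then have "z \<in> {a * a, a * b', b * a, b * b'}" unfolding set_times_def by blast
    hence "a dvd z" unfolding bb by auto
    then obtain r where "z = r * a" by (metis dvdE mult.commute)
    thus "z \<in> idl.span {a}" by (auto intro: idl.span_scale idl.span_base)
  qed
  ultimately have "idl.span ?S = idl.span {a}" by (subst idl.span_eq) auto
  thus ?thesis by (simp add: a_def b_def b'_def y'_def)
qed

text \<open>Contact of order two means F_x + l F_y = 0 at the point, so F_y = 0 would make F_x
  vanish as well.\<close>

lemma line_roots_double:
  assumes "line_roots c l n x1 x1 x3" "\<not> sing_pt c x1 (l * x1 + n)"
  shows "2 * (l * x1 + n) + c 1 * x1 + c 3 \<noteq> 0"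
proof
  assume 0: "2 * (l * x1 + n) + c 1 * x1 + c 3 = 0"
  have "c 1 * (l * x1 + n) - 3 * (x1 * x1) - 2 * c 2 * x1 - c 4 = 0"
    using assms(1) 0 unfolding line_roots_def by Groebner_Basis.algebra
  with 0 assms(2) show False by (simp add: sing_pt_def)
qed

text \<open>The left side is the norm of the line, a cubic in x with leading coefficient -1. The
  Vieta relations give its roots.\<close>

lemma line_times_conjugate:
  fixes l n :: "'a::weierstrass_field"
  assumes v: "line_roots wcoef l n x1 x2 x3"
  shows "(crdY - crdC l * crdX - crdC n) * (- crdY - crdC (wcoef 1) * crdX - crdC (wcoef 3) - crdC l * crdX - crdC n)
    = - ((crdX - crdC x1) * (crdX - crdC x2) * (crdX - crdC x3))"
proof -
  have "crdC x1 + crdC x2 + crdC x3 = crdC l * crdC l + crdC (wcoef 1) * crdC l - crdC (wcoef 2)"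
     "crdC x1 * crdC x2 + crdC x1 * crdC x3 + crdC x2 * crdC x3
       = crdC (wcoef 4) - 2 * crdC l * crdC n - crdC (wcoef 1) * crdC n - crdC (wcoef 3) * crdC l"
     "crdC x1 * crdC x2 * crdC x3 = crdC n * crdC n + crdC (wcoef 3) * crdC n - crdC (wcoef 6)"
    using v[unfolded line_roots_def, THEN conjunct1, THEN arg_cong[of _ _ crdC]]
    using v[unfolded line_roots_def, THEN conjunct2, THEN conjunct1, THEN arg_cong[of _ _ crdC]]
    using v[unfolded line_roots_def, THEN conjunct2, THEN conjunct2, THEN arg_cong[of _ _ crdC]]
    by (simp_all only: crdC_simps)
  thus ?thesis using crd_relation[where 'a='a] by Groebner_Basis.algebra
qed

lemma pt_gens_collinear_double:
  fixes l n :: "'a::weierstrass_field"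
  assumes v: "line_roots wcoef l n x1 x1 x3" and d: "2 * (l * x1 + n) + wcoef 1 * x1 + wcoef 3 \<noteq> 0"
  defines "L \<equiv> crdY - crdC l * crdX - crdC n"
  shows "idl.span ({crdX - crdC x1, L} * {crdX - crdC x1, L} * {crdX - crdC x3, L}) = idl.span {L}"
proof (rule span_times_eq_principal_double)
  let ?L' = "- crdY - crdC (wcoef 1) * crdX - crdC (wcoef 3) - crdC l * crdX - crdC n"
  let ?d = "2 * (l * x1 + n) + wcoef 1 * x1 + wcoef 3"
  show "L * ?L' = - ((crdX - crdC x1) * (crdX - crdC x1) * (crdX - crdC x3))"
    unfolding L_def by (rule line_times_conjugate[OF v])
  show "?L' = - L - crdC (wcoef 1 + 2 * l) * (crdX - crdC x1) - crdC ?d"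
    unfolding L_def crdC_simps by (simp add: algebra_simps)
  show "crdC (inverse ?d) * crdC ?d = 1" using d by (simp add: crdC_hom(6)[symmetric] crdC_hom(2))
qed

lemma pt_gens_collinear_distinct:
  fixes l n :: "'a::weierstrass_field"
  assumes v: "line_roots wcoef l n x1 x2 x3" and d: "x1 \<noteq> x2" "x2 \<noteq> x3" "x1 \<noteq> x3"
  defines "L \<equiv> crdY - crdC l * crdX - crdC n"
  shows "idl.span ({crdX - crdC x1, L} * {crdX - crdC x2, L} * {crdX - crdC x3, L}) = idl.span {L}"
proof -
  have u: "crdC (inverse (v - u)) * ((crdX - crdC u) - (crdX - crdC v)) = 1" if "u \<noteq> v" for u v :: 'a
  proof -
    have "(crdX - crdC u) - (crdX - crdC v) = crdC (v - u)" by (simp add: crdC_simps)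
    thus ?thesis using that by (simp add: crdC_hom(6)[symmetric] crdC_hom(2))
  qed
  show ?thesis
    by (rule span_times_eq_principal_distinct[OF line_times_conjugate[OF v, folded L_def] u[OF d(1)] u[OF d(2)] u[OF d(3)]])
qed

lemma pt_gens_collinear:
  fixes l n :: "'a::weierstrass_field"
  assumes v: "line_roots wcoef l n x1 x2 x3"
    and ns: "\<And>x y. on_curve wcoef x y \<Longrightarrow> \<not> sing_pt wcoef x (y::'a)"
  shows "idl.span (pt_gens (Aff x1 (l * x1 + n)) * pt_gens (Aff x2 (l * x2 + n)) * pt_gens (Aff x3 (l * x3 + n)))
    = idl.span {crdY - crdC l * crdX - crdC n}"
proof -
  define L where "L = crdY - crdC l * crdX - crdC n"
  define G where "G x = {crdX - crdC x, L}" for x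
  have g: "idl.span (pt_gens (Aff x (l * x + n)) * H) = idl.span (G x * H)" for x H
    unfolding L_def G_def by (rule span_times_cong, rule pt_gens_line)
  have "idl.span (pt_gens (Aff x1 (l * x1 + n)) * pt_gens (Aff x2 (l * x2 + n)) * pt_gens (Aff x3 (l * x3 + n)))
     = idl.span (pt_gens (Aff x1 (l * x1 + n)) * (pt_gens (Aff x2 (l * x2 + n)) * pt_gens (Aff x3 (l * x3 + n))))"
    by (simp only: mult.assoc)
  also have "\<dots> = idl.span (G x1 * (pt_gens (Aff x2 (l * x2 + n)) * pt_gens (Aff x3 (l * x3 + n))))" by (rule g)
  also have "\<dots> = idl.span (pt_gens (Aff x2 (l * x2 + n)) * (G x1 * pt_gens (Aff x3 (l * x3 + n))))"
    by (simp only: ac_simps)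
  also have "\<dots> = idl.span (G x2 * (G x1 * pt_gens (Aff x3 (l * x3 + n))))" by (rule g)
  also have "\<dots> = idl.span (pt_gens (Aff x3 (l * x3 + n)) * (G x1 * G x2))" by (simp only: ac_simps)
  also have "\<dots> = idl.span (G x3 * (G x1 * G x2))" by (rule g)
  also have "\<dots> = idl.span (G x1 * G x2 * G x3)" by (simp only: ac_simps)
  also have "\<dots> = idl.span {L}"
  proof -
    have d: "2 * (l * x + n) + wcoef 1 * x + wcoef 3 \<noteq> 0" if "line_roots wcoef l n x x z" for x z
      using line_roots_double[OF that] ns[OF line_roots_on_curve] that line_roots_sym by metis
    \<comment> \<open>A triple contact is included, since \<open>z\<close> may equal
      \<open>x\<close>.\<close>
    have dd: "idl.span (G x * G x * G z) = idl.span {L}" if "line_roots wcoef l n x x z" for x z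
      unfolding G_def L_def by (rule pt_gens_collinear_double[OF that d[OF that]])
    consider "x1 = x2" | "x1 = x3" | "x2 = x3" | "x1 \<noteq> x2" "x2 \<noteq> x3" "x1 \<noteq> x3" by blast
    thus ?thesis
    proof cases
      case 1 thus ?thesis using dd[of x1 x3] v by simp
    next
      case 2 thus ?thesis using dd[of x1 x2] line_roots_sym(2)[OF v] by (simp add: ac_simps)
    next
      case 3 thus ?thesis using dd[of x2 x1] line_roots_sym(2)[OF line_roots_sym(1)[OF v]] by (simp add: ac_simps)
    next
      case 4 thus ?thesis unfolding G_def L_def by (rule pt_gens_collinear_distinct[OF v])
    qed
  qed
  finally show ?thesis unfolding L_def .
qed

text \<open>Equality in the ideal class group, for ideals given by generators.\<close>

definition ideal_sim :: "'a::idom set \<Rightarrow> 'a set \<Rightarrow> bool" where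
  "ideal_sim S T \<longleftrightarrow> (\<exists>f g. f \<noteq> 0 \<and> g \<noteq> 0 \<and> idl.span ({f} * S) = idl.span ({g} * T))"

lemma ideal_sim_refl: "ideal_sim S S" unfolding ideal_sim_def by (rule exI[of _ 1], rule exI[of _ 1]) simp

lemma singleton_one_times: "{1} * S = S" "S * {1} = S" for S :: "'a::comm_monoid_mult set"
  by (auto simp: set_times_def)

lemma ideal_sim_sym: assumes "ideal_sim S T" shows "ideal_sim T S"
proof -
  from assms obtain f g where "f \<noteq> 0" "g \<noteq> 0" "idl.span ({f} * S) = idl.span ({g} * T)"
    unfolding ideal_sim_def by blast
  thus ?thesis unfolding ideal_sim_def by (intro exI[of _ g] exI[of _ f]) simp
qed

lemma ideal_sim_times: assumes "ideal_sim S T" shows "ideal_sim (S * H) (T * H)"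
proof -
  from assms obtain f g where fg: "f \<noteq> 0" "g \<noteq> 0" "idl.span ({f} * S) = idl.span ({g} * T)"
    unfolding ideal_sim_def by blast
  have "idl.span ({f} * (S * H)) = idl.span ({g} * (T * H))"
    using span_times_cong[OF fg(3), of H] by (simp only: mult.assoc)
  thus ?thesis unfolding ideal_sim_def using fg by (intro exI[of _ f] exI[of _ g]) simp
qed

lemma ideal_sim_trans: assumes "ideal_sim S T" "ideal_sim T U" shows "ideal_sim S U"
proof -
  from assms obtain f g f' g' where 
    1: "f \<noteq> 0" "g \<noteq> 0" "idl.span ({f} * S) = idl.span ({g} * T)" and 
    2: "f' \<noteq> 0" "g' \<noteq> 0" "idl.span ({f'} * T) = idl.span ({g'} * U)" unfolding ideal_sim_def by blast
  have s: "{a * b} = {a} * {b}" for a b :: 'a by (auto simp: set_times_def)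
  have "idl.span ({f' * f} * S) = idl.span ({f} * S * {f'})" by (simp only: s ac_simps)
  also have "\<dots> = idl.span ({g} * T * {f'})" by (rule span_times_cong[OF 1(3)])
  also have "\<dots> = idl.span ({f'} * T * {g})" by (simp only: ac_simps)
  also have "\<dots> = idl.span ({g'} * U * {g})" by (rule span_times_cong[OF 2(3)])
  also have "\<dots> = idl.span ({g' * g} * U)" by (simp only: s ac_simps)
  finally show ?thesis using 1 2 unfolding ideal_sim_def
    by (intro exI[of _ "f' * f"] exI[of _ "g' * g"]) simp
qed

lemma ideal_sim_times2: assumes "ideal_sim S T" shows "ideal_sim (H * S) (H * T)"
  using ideal_sim_times[OF assms, of H] by (simp only: mult.commute)

section \<open>Ideal classes of negatives and sums\<close>

lemma ideal_sim_neg: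
  assumes "ec_pt wcoef P" "\<And>x y. on_curve wcoef x y \<Longrightarrow> \<not> sing_pt wcoef x (y::'a::weierstrass_field)"
  shows "ideal_sim (pt_gens P * pt_gens (ec_neg wcoef P)) {1 :: 'a crd}"
proof (cases P)
  case Inf thus ?thesis by (simp add: ideal_sim_refl singleton_one_times)
next
  case (Aff x y)
  have "idl.span ({1} * (pt_gens P * pt_gens (ec_neg wcoef P))) = idl.span ({crdX - crdC x} * {1})"
    unfolding singleton_one_times Aff using assms(1) by (intro pt_gens_neg assms(2)) (simp_all add: Aff)
  thus ?thesis unfolding ideal_sim_def using crdX_neq[of x]
    by (intro exI[of _ 1] exI[of _ "crdX - crdC x"]) simp
qed

lemma ec_add_cases:
  assumes "ec_pt c P" "ec_pt c Q"
  obtains "P = Inf" "ec_add c P Q = Q" | "Q = Inf" "ec_add c P Q = P" 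
  | "Q = ec_neg c P" "ec_add c P Q = Inf" 
  | l n x1 x2 x3 where "P = Aff x1 (l * x1 + n)" "Q = Aff x2 (l * x2 + n)" "line_roots c l n x1 x2 x3" 
      "ec_add c P Q = ec_neg c (Aff x3 (l * x3 + n))"
proof (cases P)
  case Inf thus thesis using that(1) by (simp add: ec_add_def)
next
  case P: (Aff x1 y1)
  show thesis
  proof (cases Q)
    case Inf thus thesis using that(2) P by (simp add: ec_add_def)
  next
    case Q: (Aff x2 y2)
    show thesis
    proof (cases "x1 = x2 \<and> y1 + y2 + c 1 * x2 + c 3 = 0")
      case True
      hence "x1 = x2" "y1 + y2 + c 1 * x2 + c 3 = 0" by auto
      hence "y2 - (- y1 - c 1 * x1 - c 3) = 0" by (simp add: algebra_simps)
      hence "y2 = - y1 - c 1 * x1 - c 3" by simp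
      thus thesis using that(3) True by (simp add: P Q ec_add_def)
    next
      case False
      show thesis using ec_add_line[OF _ _ False] assms that(4) unfolding P Q ec_pt.simps by metis
    qed
  qed
qed

text \<open>If R is the third point on the line through P and Q, the product of the three ideals is
  principal. Multiplying by the ideal of -R cancels R and leaves the class of -R, which is P +
  Q.\<close>

lemma ideal_sim_add:
  assumes "ec_pt wcoef P" "ec_pt wcoef Q" and ns: "\<And>x y. on_curve wcoef x y \<Longrightarrow> \<not> sing_pt wcoef x (y::'a::weierstrass_field)"
  shows "ideal_sim (pt_gens (ec_add wcoef P Q)) (pt_gens P * pt_gens Q :: 'a crd set)"
  using assms(1,2)
proof (cases rule: ec_add_cases)
  case 1 thus ?thesis by (simp add: ideal_sim_refl singleton_one_times)
next
  case 2 thus ?thesis by (simp add: ideal_sim_refl singleton_one_times)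
next
  case 3 thus ?thesis using ideal_sim_sym[OF ideal_sim_neg[OF assms(1) ns]] by simp
next
  case (4 l n x1 x2 x3)
  define R where "R = Aff x3 (l * x3 + n)"
  have R: "ec_pt wcoef R" unfolding R_def using line_roots_on_curve[OF 4(3)] by simp
  let ?L = "crdY - crdC l * crdX - crdC n"
  have "idl.span ({1} * (pt_gens P * pt_gens Q * pt_gens R)) = idl.span ({?L} * {1})"
    unfolding singleton_one_times 4(1,2) R_def by (rule pt_gens_collinear[OF 4(3) ns])
  hence a: "ideal_sim (pt_gens P * pt_gens Q * pt_gens R) {1}" 
    unfolding ideal_sim_def using line_neq[of l n] by (intro exI[of _ 1] exI[of _ ?L]) simp
  have "ideal_sim ({1} * pt_gens (ec_neg wcoef R)) (pt_gens P * pt_gens Q * pt_gens R * pt_gens (ec_neg wcoef R))"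
    by (rule ideal_sim_times, rule ideal_sim_sym, rule a)
  moreover have "ideal_sim (pt_gens P * pt_gens Q * (pt_gens R * pt_gens (ec_neg wcoef R))) (pt_gens P * pt_gens Q * {1})"
    by (rule ideal_sim_times2, rule ideal_sim_neg[OF R ns])
  ultimately show ?thesis unfolding 4(4) R_def[symmetric] singleton_one_times mult.assoc
    by (rule ideal_sim_trans)
qed

section \<open>Non-principal ideals and associativity\<close>

definition crd_ev :: "'a::weierstrass_field \<Rightarrow> 'a \<Rightarrow> 'a crd \<Rightarrow> 'a" where
  "crd_ev x y f = poly (crd0 f) x + poly (crd1 f) x * y"

lemma crd_ev_hom: assumes "on_curve wcoef x y" 
  shows "crd_ev x y (f * g) = crd_ev x y f * crd_ev x y g" "crd_ev x y (f + g) = crd_ev x y f + crd_ev x y g"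
proof -
  have "y * y = poly wcub x - poly wlin x * y" 
    using assms unfolding on_curve_def wcub_def wlin_def by simp Groebner_Basis.algebra
  thus "crd_ev x y (f * g) = crd_ev x y f * crd_ev x y g"
    unfolding crd_ev_def crd_defs crd.sel poly_add poly_mult poly_diff by Groebner_Basis.algebra
qed (simp add: crd_ev_def crd_defs algebra_simps)

text \<open>The factors are the values at the point and at its negative, so a function vanishing at
  the point has a norm with root \<open>x\<close>.\<close>

lemma poly_crd_norm: assumes "on_curve wcoef x y" 
  shows "poly (crd_norm f) x = crd_ev x y f * crd_ev x (- y - wcoef 1 * x - wcoef 3) f"
proof -
  have *: "y * y = poly wcub x - poly wlin x * y" 
    using assms unfolding on_curve_def wcub_def wlin_def by simp Groebner_Basis.algebra
  have "poly wlin x = wcoef 3 + x * wcoef 1" by (simp add: wlin_def)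
  with * show ?thesis unfolding crd_ev_def crd_norm_def poly_add poly_mult poly_diff by Groebner_Basis.algebra
qed

text \<open>If \<open>h\<close> generated the ideal, then \<open>x - x\<^sub>P = r h\<close> and \<open>y - y\<^sub>P = r' h\<close> have norms of degree 2 and 3;
  since no norm has degree 1, \<open>h\<close> has a constant norm, although it vanishes at the point.\<close>

lemma not_principal: 
  assumes "ec_pt wcoef P" "ideal_sim (pt_gens P) {1 :: 'a::weierstrass_field crd}"
  shows "P = Inf"
proof (cases P)
  case (Aff x y)
  have on: "on_curve wcoef x y" using assms(1) Aff by simp
  let ?a = "crdX - crdC x" and ?b = "crdY - crdC y"
  obtain f g where fg: "f \<noteq> 0" "g \<noteq> 0" "idl.span ({f} * {?a, ?b}) = idl.span {g}"
    using assms(2) unfolding ideal_sim_def Aff pt_gens.simps singleton_one_times by blast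
  have s: "{f} * {?a, ?b} = {f * ?a, f * ?b}" by (auto simp: set_times_def)
  have sp: "idl.span {g} = range (\<lambda>k. k * g)" by (rule idl.span_singleton)
  have "f * ?a \<in> idl.span {g}" "f * ?b \<in> idl.span {g}" using fg(3) s by (metis idl.span_base insertCI)+
  then obtain r r' where r: "f * ?a = r * g" "f * ?b = r' * g" unfolding sp by blast
  have "g \<in> idl.span {f * ?a, f * ?b}" using fg(3) s by (metis idl.span_base insertCI)
  then obtain k where "g - k * (f * ?a) \<in> idl.span {f * ?b}" by (metis idl.span_breakdown_eq)
  then obtain k' where "g - k * (f * ?a) = k' * (f * ?b)" unfolding idl.span_singleton by blast
  hence g: "g = f * (k * ?a + k' * ?b)" by (simp add: algebra_simps)
  define h where "h = k * ?a + k' * ?b"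
  have a: "?a = r * h" and b: "?b = r' * h" using r fg(1) unfolding g h_def[symmetric]
    by (metis mult.left_commute mult_left_cancel)+
  have h0: "h \<noteq> 0" using g fg(2) h_def by auto
  have r0: "r \<noteq> 0" using a crdX_neq by (metis mult_zero_left)
  have r'0: "r' \<noteq> 0" using b line_neq[of 0 y] by (metis mult_zero_left crdC_hom(1) diff_zero)
  have na: "crd_norm ?a = [:- x, 1:] * [:- x, 1:]" by (simp add: crd_norm_def crdX_def crdC_def crd_defs)
  have nb: "crd_norm ?b = [:y * y, 0:] + [:y:] * wlin - wcub" by (simp add: crd_norm_def crdY_def crdC_def crd_defs)
  have "degree (crd_norm ?a) = 2" unfolding na by simp
  hence da: "degree (crd_norm r) + degree (crd_norm h) = 2" unfolding a crd_norm_mult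
    using degree_crd_norm(1)[OF r0] degree_crd_norm(1)[OF h0] by (metis degree_mult_eq)
  have "degree (crd_norm ?b) = 3" unfolding nb wcub_def wlin_def by simp
  hence db: "degree (crd_norm r') + degree (crd_norm h) = 3" unfolding b crd_norm_mult
    using degree_crd_norm(1)[OF r'0] degree_crd_norm(1)[OF h0] by (metis degree_mult_eq)
  have "degree (crd_norm h) = 0" using da db degree_crd_norm(2)[OF h0] degree_crd_norm(2)[OF r'0] by linarith
  then obtain e where e: "crd_norm h = [:e:]" by (rule degree_eq_zeroE)
  have "e \<noteq> 0" using degree_crd_norm(1)[OF h0] e by auto
  moreover have "crd_ev x y h = 0" unfolding h_def crd_ev_hom[OF on]
    by (simp add: crd_ev_def crdX_def crdY_def crdC_def crd_defs)
  hence "poly (crd_norm h) x = 0" using poly_crd_norm[OF on] by simp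
  ultimately show ?thesis unfolding e by simp
qed

lemma ec_add_eq_Inf_iff: "ec_add c (Aff x1 y1) (Aff x2 y2) = Inf \<longleftrightarrow> x1 = x2 \<and> y1 + y2 + c 1 * x2 + c 3 = 0"
  by (simp add: ec_add_def Let_def)

lemma ec_add_neg_eq_Inf: assumes "ec_add c P (ec_neg c Q) = Inf" shows "P = Q"
proof (cases P)
  case Inf thus ?thesis using assms by (cases Q) (simp_all add: ec_add_def)
next
  case P: (Aff x1 y1)
  show ?thesis
  proof (cases Q)
    case Inf thus ?thesis using assms P by (simp add: ec_add_def)
  next
    case (Aff x2 y2)
    thus ?thesis using assms unfolding P Aff ec_neg.simps ec_add_eq_Inf_iff by simp
  qed
qed

text \<open>Both bracketings have the class of the product of the three ideals. Their difference A +
  (-B) therefore has a principal ideal and is the point at infinity, and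
  \<open>ec_add_neg_eq_Inf\<close> reads off A = B from the formulas, without cancellation in a
  group.\<close>

theorem ec_add_assoc:
  fixes P Q R :: "'a::weierstrass_field ecpt"
  assumes on: "ec_pt wcoef P" "ec_pt wcoef Q" "ec_pt wcoef R" 
    and ns: "\<And>x y. on_curve wcoef x y \<Longrightarrow> \<not> sing_pt wcoef x (y::'a)"
  shows "ec_add wcoef (ec_add wcoef P Q) R = ec_add wcoef P (ec_add wcoef Q R)"
proof -
  let ?A = "ec_add wcoef (ec_add wcoef P Q) R" and ?B = "ec_add wcoef P (ec_add wcoef Q R)"
  note on' = on ec_pt_add ec_pt_neg
  note sim_add = ideal_sim_add[OF _ _ ns]
  have A: "ideal_sim (pt_gens ?A) (pt_gens P * pt_gens Q * pt_gens R)"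
  proof (rule ideal_sim_trans)
    show "ideal_sim (pt_gens ?A) (pt_gens (ec_add wcoef P Q) * pt_gens R)" by (intro sim_add on')
    have "ideal_sim (pt_gens (ec_add wcoef P Q)) (pt_gens P * pt_gens Q)" by (intro sim_add on')
    thus "ideal_sim (pt_gens (ec_add wcoef P Q) * pt_gens R) (pt_gens P * pt_gens Q * pt_gens R)" by (rule ideal_sim_times)
  qed
  have "ideal_sim (pt_gens ?B) (pt_gens P * (pt_gens Q * pt_gens R))"
  proof (rule ideal_sim_trans)
    show "ideal_sim (pt_gens ?B) (pt_gens P * pt_gens (ec_add wcoef Q R))" by (intro sim_add on')
    have "ideal_sim (pt_gens (ec_add wcoef Q R)) (pt_gens Q * pt_gens R)" by (intro sim_add on')
    thus "ideal_sim (pt_gens P * pt_gens (ec_add wcoef Q R)) (pt_gens P * (pt_gens Q * pt_gens R))" by (rule ideal_sim_times2)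
  qed
  hence AB: "ideal_sim (pt_gens ?A) (pt_gens ?B)"
    using ideal_sim_trans[OF A] ideal_sim_sym unfolding mult.assoc by blast
  let ?C = "ec_add wcoef ?A (ec_neg wcoef ?B)"
  have "ideal_sim (pt_gens ?C) (pt_gens ?A * pt_gens (ec_neg wcoef ?B))" by (intro sim_add on')
  moreover have "ideal_sim (pt_gens ?A * pt_gens (ec_neg wcoef ?B)) (pt_gens ?B * pt_gens (ec_neg wcoef ?B))"
    by (intro ideal_sim_times AB)
  moreover have "ideal_sim (pt_gens ?B * pt_gens (ec_neg wcoef ?B)) {1}" by (intro ideal_sim_neg[OF _ ns] on')
  ultimately have "ideal_sim (pt_gens ?C) {1}" by (blast intro: ideal_sim_trans)
  hence "?C = Inf" by (intro not_principal on')
  thus ?thesis by (rule ec_add_neg_eq_Inf)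
qed

section \<open>The valuation on rational numbers and Cauchy sequences\<close>

text \<open>\<open>v(r) \<ge> m\<close> with the convention \<open>v(0) = \<infinity>\<close>; note that \<open>rat_val p 0 = 0\<close>.\<close>

definition rge :: "nat \<Rightarrow> int \<Rightarrow> rat \<Rightarrow> bool" where
  "rge p m r \<longleftrightarrow> r = 0 \<or> rat_val p r \<ge> m"

lemma rat_val_frac:
  assumes "Factorial_Ring.prime p" "a \<noteq> 0" "b \<noteq> 0"
  shows "rat_val p (of_int a / of_int b) = int (multiplicity (int p) a) - int (multiplicity (int p) b)"
proof -
  obtain n d where q: "quotient_of (of_int a / of_int b) = (n, d)" by (cases "quotient_of (of_int a / of_int b :: rat)")
  have d: "d > 0" using quotient_of_denom_pos[OF q] .
  have "of_int a / of_int b = (of_int n / of_int d :: rat)" using quotient_of_div[OF q] .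
  hence "of_int (a * d) = (of_int (n * b) :: rat)" using assms d by (simp add: field_simps)
  hence e: "a * d = n * b" by (simp only: of_int_eq_iff)
  have n: "n \<noteq> 0" using e assms d by auto
  have pr: "prime_elem (int p)" using assms(1) by simp
  have "multiplicity (int p) a + multiplicity (int p) d = multiplicity (int p) n + multiplicity (int p) b"
    using e prime_elem_multiplicity_mult_distrib[OF pr] assms d n by (metis less_irrefl)
  thus ?thesis using assms by (simp add: rat_val_def q)
qed

lemma rge_frac:
  assumes "Factorial_Ring.prime p" "b \<noteq> 0"
  shows "rge p m (of_int a / of_int b) \<longleftrightarrow> a = 0 \<or> int (multiplicity (int p) a) - int (multiplicity (int p) b) \<ge> m"
  using rat_val_frac[OF assms(1) _ assms(2)] assms by (auto simp: rge_def)

lemma rat_val_mult: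
  assumes "Factorial_Ring.prime p" "r \<noteq> 0" "s \<noteq> 0" shows "rat_val p (r * s) = rat_val p r + rat_val p s"
proof -
  obtain a b where r: "r = of_int a / of_int b" "b \<noteq> 0" by (metis quotient_of_div quotient_of_denom_pos less_irrefl surj_pair)
  obtain c d where s: "s = of_int c / of_int d" "d \<noteq> 0" by (metis quotient_of_div quotient_of_denom_pos less_irrefl surj_pair)
  have ac: "a \<noteq> 0" "c \<noteq> 0" using assms r s by auto
  have pr: "prime_elem (int p)" using assms(1) by simp
  have "r * s = of_int (a * c) / of_int (b * d)" by (simp add: r s)
  thus ?thesis unfolding r s using ac r(2) s(2)
    by (simp only: rat_val_frac[OF assms(1)] mult_eq_0_iff simp_thms prime_elem_multiplicity_mult_distrib[OF pr])
qed

lemma rat_val_1: "rat_val p 1 = 0" by (simp add: rat_val_def)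

lemma rat_val_inverse:
  assumes "Factorial_Ring.prime p" "r \<noteq> 0" shows "rat_val p (inverse r) = - rat_val p r"
  using rat_val_mult[OF assms(1), of r "inverse r"] assms by (simp add: rat_val_1)

lemma rat_val_minus: "Factorial_Ring.prime p \<Longrightarrow> rat_val p (- r) = rat_val p r"
  using rat_val_mult[of p "-1" r] rat_val_mult[of p "-1" "-1"] rat_val_1[of p] by (cases "r = 0") auto

lemma rge_0 [simp]: "rge p m 0" by (simp add: rge_def)
lemma rge_mono: "rge p m r \<Longrightarrow> m' \<le> m \<Longrightarrow> rge p m' r" by (auto simp: rge_def)
lemma rge_mult: "Factorial_Ring.prime p \<Longrightarrow> rge p m r \<Longrightarrow> rge p n s \<Longrightarrow> rge p (m + n) (r * s)"
  by (cases "r = 0"; cases "s = 0") (auto simp: rge_def rat_val_mult)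
lemma rge_minus [simp]: "Factorial_Ring.prime p \<Longrightarrow> rge p m (- r) \<longleftrightarrow> rge p m r" by (simp add: rge_def rat_val_minus)
text \<open>A valuation below \<open>m\<close> is at most m - 1, whence the bound 1 - m.\<close>

lemma rge_inverse: "Factorial_Ring.prime p \<Longrightarrow> \<not> rge p m r \<Longrightarrow> rge p (1 - m) (inverse r)"
  by (auto simp: rge_def rat_val_inverse)
lemma rge_1: "rge p m 1 \<longleftrightarrow> m \<le> 0" by (simp add: rge_def rat_val_1)

lemma rge_add:
  assumes p: "Factorial_Ring.prime p" and "rge p m r" "rge p m s" shows "rge p m (r + s)"
proof -
  obtain a b where r: "r = of_int a / of_int b" "b \<noteq> 0" by (metis quotient_of_div quotient_of_denom_pos less_irrefl surj_pair)
  obtain c d where s: "s = of_int c / of_int d" "d \<noteq> 0" by (metis quotient_of_div quotient_of_denom_pos less_irrefl surj_pair)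
  have pr: "prime_elem (int p)" using p by simp
  have nu: "\<not> is_unit (int p)" using pr by (metis prime_elem_def)
  \<comment> \<open>Over the denominator b d the numerator has to be divisible by this power of p;
    \<open>nat\<close> turns a negative requirement into an empty one.\<close>
  define k where "k = nat (m + int (multiplicity (int p) b) + int (multiplicity (int p) d))"
  have e: "r + s = of_int (a * d + c * b) / of_int (b * d)" using r s by (simp add: field_simps)
  have "int p ^ k dvd a * d"
  proof (cases "a = 0")
    case False
    hence "int (multiplicity (int p) a) - int (multiplicity (int p) b) \<ge> m"
      using assms(2) rge_frac[OF p r(2)] r by auto
    hence "k \<le> multiplicity (int p) (a * d)" using False s(2)
      by (simp add: prime_elem_multiplicity_mult_distrib[OF pr] k_def)
    thus ?thesis by (rule multiplicity_dvd')
  qed simp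
  moreover have "int p ^ k dvd c * b"
  proof (cases "c = 0")
    case False
    hence "int (multiplicity (int p) c) - int (multiplicity (int p) d) \<ge> m"
      using assms(3) rge_frac[OF p s(2)] s by auto
    hence "k \<le> multiplicity (int p) (c * b)" using False r(2)
      by (simp add: prime_elem_multiplicity_mult_distrib[OF pr] k_def)
    thus ?thesis by (rule multiplicity_dvd')
  qed simp
  ultimately have dv: "int p ^ k dvd a * d + c * b" by simp
  show ?thesis
  proof (cases "a * d + c * b = 0")
    case False
    hence "k \<le> multiplicity (int p) (a * d + c * b)"
      using dv nu by (meson multiplicity_geI)
    hence "m \<le> int (multiplicity (int p) (a * d + c * b)) - int (multiplicity (int p) (b * d))"
      using r(2) s(2) by (simp add: prime_elem_multiplicity_mult_distrib[OF pr] k_def)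
    moreover have "b * d \<noteq> 0" using r s by simp
    ultimately show ?thesis using rge_frac[OF p] unfolding e by blast
  qed (simp add: e)
qed

lemma rge_diff: "Factorial_Ring.prime p \<Longrightarrow> rge p m r \<Longrightarrow> rge p m s \<Longrightarrow> rge p m (r - s)"
  using rge_add[of p m r "- s"] by simp

lemma rge_of_int: "Factorial_Ring.prime p \<Longrightarrow> rge p 0 (of_int a)"
  using rge_frac[of p 1 0 a] by simp

lemma rge_of_int_iff: assumes "Factorial_Ring.prime p" shows "rge p 1 (of_int a) \<longleftrightarrow> int p dvd a"
proof (cases "a = 0")
  case False
  have "\<not> is_unit (int p)" using assms by simp
  hence "1 \<le> multiplicity (int p) a \<longleftrightarrow> int p dvd a" using False multiplicity_eq_zero_iff[of a "int p"]
    by (metis One_nat_def less_one not_le not_less_eq_eq)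
  thus ?thesis using rge_frac[OF assms, of 1 1 a] False by simp
qed simp

lemma rge_prime_power: "Factorial_Ring.prime p \<Longrightarrow> rge p m (of_nat p ^ k) \<longleftrightarrow> m \<le> int k"
  using rge_frac[of p 1 m "int p ^ k"] by simp

lemma rge_ex: "\<exists>m. rge p m r" by (auto simp: rge_def)

text \<open>In lowest terms the denominator b of a p-integral number a / b is prime to p, so a times
  an inverse of b modulo p is the residue.\<close>

lemma rge_residue: assumes "Factorial_Ring.prime p" "rge p 0 r" shows "\<exists>x<p. rge p 1 (r - of_nat x)"
proof -
  obtain a b where ab: "quotient_of r = (a, b)" by (cases "quotient_of r")
  have b: "b > 0" and r: "r = of_int a / of_int b" and cop: "coprime a b"
    using quotient_of_denom_pos[OF ab] quotient_of_div[OF ab] quotient_of_coprime[OF ab] by auto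
  have "\<not> int p dvd b"
  proof
    assume pb: "int p dvd b"
    have "\<not> is_unit (int p)" using assms(1) by simp
    hence "\<not> int p dvd a" using cop pb coprime_common_divisor by blast
    hence a: "multiplicity (int p) a = 0" "a \<noteq> 0" by (auto intro: not_dvd_imp_multiplicity_0)
    have "multiplicity (int p) b > 0" using pb b assms(1) by (simp add: prime_multiplicity_gt_zero_iff)
    thus False using assms(2) rge_frac[OF assms(1), of b 0 a] a b unfolding r by auto
  qed
  hence "coprime b (int p)" using assms(1) by (metis coprime_commute prime_imp_coprime prime_nat_int_transfer)
  define c where "c = fst (bezout_coefficients b (int p))"
  have "c * b + snd (bezout_coefficients b (int p)) * int p = 1"
    unfolding c_def using \<open>coprime b (int p)\<close> by (simp add: bezout_coefficients_fst_snd)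
  hence c: "int p dvd 1 - b * c" by (metis add_diff_cancel_left' dvd_triv_right mult.commute)
  define x where "x = nat ((a * c) mod int p)"
  have p0: "int p > 0" using assms(1) prime_gt_0_nat by auto
  have x: "int x = (a * c) mod int p" unfolding x_def using p0 by simp
  have xp: "x < p" using x p0 by (metis of_nat_less_iff pos_mod_bound)
  have "int p dvd a * c - int x" unfolding x by simp
  hence "int p dvd a * (1 - b * c) + b * (a * c - int x)" using c by (intro dvd_add dvd_mult)
  hence dv: "int p dvd a - b * int x" by (simp add: algebra_simps)
  have "rge p 1 (of_int (a - b * int x))" using dv rge_of_int_iff[OF assms(1)] by blast
  moreover have "rge p 0 (inverse (of_int b))"
    using rge_inverse[OF assms(1), of 1 "of_int b"] rge_of_int_iff[OF assms(1)] \<open>\<not> int p dvd b\<close> by simp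
  ultimately have "rge p 1 (of_int (a - b * int x) * inverse (of_int b))"
    using rge_mult[OF assms(1), of 1 _ 0] by simp
  moreover have "of_int (a - b * int x) * inverse (of_int b) = r - of_nat x"
    unfolding r using b by (simp add: field_simps)
  ultimately show ?thesis using xp by auto
qed

lemma rge_residue_unique: assumes "Factorial_Ring.prime p" "x < p" "y < p" "rge p 1 (of_nat x - of_nat y)" shows "x = y"
proof -
  have "rge p 1 (of_int (int x - int y))" using assms by simp
  hence "int p dvd int x - int y" using rge_of_int_iff[OF assms(1)] by blast
  hence "int x mod int p = int y mod int p" by (simp add: mod_eq_dvd_iff)
  thus ?thesis using assms by simp
qed

section \<open>Cauchy sequences and null sequences\<close>

lemma cauchy_iff: "padic_cauchy p S \<longleftrightarrow> (\<forall>m. \<exists>N. \<forall>i\<ge>N. \<forall>j\<ge>N. rge p m (S i - S j))"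
  by (simp add: padic_cauchy_def rge_def)
lemma null_iff: "padic_null p S \<longleftrightarrow> (\<forall>m. \<exists>N. \<forall>i\<ge>N. rge p m (S i))"
  by (simp add: padic_null_def rge_def)

context
  fixes p :: nat assumes p: "Factorial_Ring.prime p"
begin

lemma cauchy_const: "padic_cauchy p (\<lambda>_. r)" by (simp add: cauchy_iff)
lemma null_const_iff: "padic_null p (\<lambda>_. r) \<longleftrightarrow> r = 0"
proof
  assume "padic_null p (\<lambda>_. r)"
  hence "\<And>m. rge p m r" unfolding null_iff by auto
  thus "r = 0" unfolding rge_def by (metis less_add_one not_le)
qed (simp add: null_iff)

lemma null_add: "padic_null p S \<Longrightarrow> padic_null p T \<Longrightarrow> padic_null p (\<lambda>n. S n + T n)"
  unfolding null_iff by (metis rge_add[OF p] le_trans linear)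
lemma null_minus: "padic_null p S \<Longrightarrow> padic_null p (\<lambda>n. - S n)"
  unfolding null_iff using rge_minus[OF p] by metis
lemma null_diff: "padic_null p S \<Longrightarrow> padic_null p T \<Longrightarrow> padic_null p (\<lambda>n. S n - T n)"
  using null_add[of S "\<lambda>n. - T n"] null_minus[of T] by simp

lemma cauchy_add: assumes "padic_cauchy p S" "padic_cauchy p T" shows "padic_cauchy p (\<lambda>n. S n + T n)"
  unfolding cauchy_iff
proof
  fix m
  from assms obtain N M where "\<forall>i\<ge>N. \<forall>j\<ge>N. rge p m (S i - S j)" "\<forall>i\<ge>M. \<forall>j\<ge>M. rge p m (T i - T j)"
    unfolding cauchy_iff by meson
  hence "\<forall>i\<ge>max N M. \<forall>j\<ge>max N M. rge p m ((S i - S j) + (T i - T j))" by (auto intro: rge_add[OF p])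
  hence "\<forall>i\<ge>max N M. \<forall>j\<ge>max N M. rge p m (S i + T i - (S j + T j))" by (simp only: add_diff_add)
  thus "\<exists>N. \<forall>i\<ge>N. \<forall>j\<ge>N. rge p m (S i + T i - (S j + T j))" by blast
qed

lemma cauchy_minus: assumes "padic_cauchy p S" shows "padic_cauchy p (\<lambda>n. - S n)"
proof -
  have "rge p m (- S i - - S j) \<longleftrightarrow> rge p m (S i - S j)" for m i j
    using rge_minus[OF p, of m "S i - S j"] by (simp add: algebra_simps)
  thus ?thesis using assms by (simp add: cauchy_iff)
qed

lemma cauchy_diff: "padic_cauchy p S \<Longrightarrow> padic_cauchy p T \<Longrightarrow> padic_cauchy p (\<lambda>n. S n - T n)"
  using cauchy_add[of S "\<lambda>n. - T n"] cauchy_minus[of T] by simp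

lemma cauchy_bounded: assumes "padic_cauchy p S" shows "\<exists>m N. \<forall>i\<ge>N. rge p m (S i)"
proof -
  obtain N where N: "\<forall>i\<ge>N. \<forall>j\<ge>N. rge p 0 (S i - S j)" using assms unfolding cauchy_iff by blast
  obtain m where m: "rge p m (S N)" using rge_ex by blast
  have "rge p (min 0 m) (S i)" if "i \<ge> N" for i
  proof -
    have "rge p (min 0 m) ((S i - S N) + S N)"
      by (rule rge_add[OF p], rule rge_mono[of p 0]) (use N m that in \<open>auto intro: rge_mono\<close>)
    thus ?thesis by simp
  qed
  thus ?thesis by blast
qed

lemma null_mult: assumes "padic_null p S" "padic_cauchy p T" shows "padic_null p (\<lambda>n. S n * T n)"
  unfolding null_iff
proof
  fix m
  obtain b N where b: "\<forall>i\<ge>N. rge p b (T i)" using cauchy_bounded[OF assms(2)] by blast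
  obtain M where M: "\<forall>i\<ge>M. rge p (m - b) (S i)" using assms(1) unfolding null_iff by blast
  have "rge p m (S i * T i)" if "i \<ge> max N M" for i
    using rge_mult[OF p, of "m - b" "S i" b "T i"] b M that by auto
  thus "\<exists>N. \<forall>i\<ge>N. rge p m (S i * T i)" by blast
qed

lemma cauchy_mult: assumes "padic_cauchy p S" "padic_cauchy p T" shows "padic_cauchy p (\<lambda>n. S n * T n)"
  unfolding cauchy_iff
proof
  fix m
  obtain a N where a: "\<forall>i\<ge>N. rge p a (S i)" using cauchy_bounded[OF assms(1)] by blast
  obtain b M where b: "\<forall>i\<ge>M. rge p b (T i)" using cauchy_bounded[OF assms(2)] by blast
  obtain N' where N': "\<forall>i\<ge>N'. \<forall>j\<ge>N'. rge p (m - b) (S i - S j)" using assms(1) unfolding cauchy_iff by blast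
  obtain M' where M': "\<forall>i\<ge>M'. \<forall>j\<ge>M'. rge p (m - a) (T i - T j)" using assms(2) unfolding cauchy_iff by blast
  have "rge p m (S i * T i - S j * T j)" if "i \<ge> max (max N M) (max N' M')" "j \<ge> max (max N M) (max N' M')" for i j
  proof -
    have "rge p m ((S i - S j) * T i)" using rge_mult[OF p, of "m - b" _ b] N' b that by fastforce
    moreover have "rge p m (S j * (T i - T j))" using rge_mult[OF p, of a _ "m - a"] M' a that by fastforce
    ultimately have "rge p m ((S i - S j) * T i + S j * (T i - T j))" by (rule rge_add[OF p])
    thus ?thesis by (simp add: algebra_simps)
  qed
  thus "\<exists>N. \<forall>i\<ge>N. \<forall>j\<ge>N. rge p m (S i * T i - S j * T j)" by blast
qed

text \<open>Once the differences have valuation at least \<open>m\<close>, the ultrametric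
  inequality gives the bound to all later terms or to none. This dichotomy is what bounds the
  inverses of a non-null sequence.\<close>

lemma eventually_not_rge:
  assumes "padic_cauchy p S" "\<not> (\<exists>N. \<forall>i\<ge>N. rge p m (S i))" shows "\<exists>N. \<forall>i\<ge>N. \<not> rge p m (S i)"
proof -
  obtain N where N: "\<forall>i\<ge>N. \<forall>j\<ge>N. rge p m (S i - S j)" using assms(1) unfolding cauchy_iff by blast
  obtain i where i: "i \<ge> N" "\<not> rge p m (S i)" using assms(2) by blast
  have "\<not> rge p m (S j)" if "j \<ge> N" for j
    using rge_add[OF p, of m "S i - S j" "S j"] N i that by auto
  thus ?thesis by blast
qed

lemma not_null_bounded: assumes "padic_cauchy p S" "\<not> padic_null p S" shows "\<exists>m N. \<forall>i\<ge>N. \<not> rge p m (S i)"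
proof -
  obtain m where m: "\<not> (\<exists>N. \<forall>i\<ge>N. rge p m (S i))" using assms(2) unfolding null_iff by blast
  show ?thesis using eventually_not_rge[OF assms(1) m] by (rule exI)
qed

lemma cauchy_inverse: assumes "padic_cauchy p S" "\<not> padic_null p S" shows "padic_cauchy p (\<lambda>n. inverse (S n))"
  unfolding cauchy_iff
proof
  fix m
  obtain b N where b: "\<forall>i\<ge>N. \<not> rge p b (S i)" using not_null_bounded[OF assms] by blast
  \<comment> \<open>The difference of the inverses is (S_j - S_i) / (S_i S_j). Each of the two
    inverses has valuation at least 1 - b, and the precision required here compensates for
    both.\<close>
  obtain M where M: "\<forall>i\<ge>M. \<forall>j\<ge>M. rge p (m - 2 * (1 - b)) (S i - S j)" using assms(1) unfolding cauchy_iff by blast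
  have "rge p m (inverse (S i) - inverse (S j))" if "i \<ge> max N M" "j \<ge> max N M" for i j
  proof -
    have "rge p (1 - b) (inverse (S i))" "rge p (1 - b) (inverse (S j))" using b that rge_inverse[OF p] by auto
    moreover have "rge p (m - 2 * (1 - b)) (S j - S i)" using M that by auto
    ultimately have "rge p ((m - 2 * (1 - b)) + ((1 - b) + (1 - b))) ((S j - S i) * (inverse (S i) * inverse (S j)))"
      by (intro rge_mult[OF p])
    moreover have "S i \<noteq> 0" "S j \<noteq> 0" using b that by (metis max.bounded_iff rge_0)+
    hence "(S j - S i) * (inverse (S i) * inverse (S j)) = inverse (S i) - inverse (S j)" by (simp add: field_simps)
    ultimately show ?thesis by simp
  qed
  thus "\<exists>N. \<forall>i\<ge>N. \<forall>j\<ge>N. rge p m (inverse (S i) - inverse (S j))" by blast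
qed

lemma null_inverse_diff:
  assumes "padic_cauchy p S" "padic_cauchy p T" "\<not> padic_null p S" "\<not> padic_null p T"
    "padic_null p (\<lambda>n. S n - T n)"
  shows "padic_null p (\<lambda>n. inverse (S n) - inverse (T n))"
  unfolding null_iff
proof
  fix m
  obtain b N where b: "\<forall>i\<ge>N. \<not> rge p b (S i)" using not_null_bounded[OF assms(1,3)] by blast
  obtain b' N' where b': "\<forall>i\<ge>N'. \<not> rge p b' (T i)" using not_null_bounded[OF assms(2,4)] by blast
  obtain M where M: "\<forall>i\<ge>M. rge p (m - (1 - b) - (1 - b')) (S i - T i)" using assms(5) unfolding null_iff by blast
  have "rge p m (inverse (S i) - inverse (T i))" if "i \<ge> max (max N N') M" for i
  proof -
    have "rge p (1 - b) (inverse (S i))" "rge p (1 - b') (inverse (T i))" using b b' that rge_inverse[OF p] by auto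
    moreover have "rge p (m - (1 - b) - (1 - b')) (T i - S i)" using M that
      using rge_minus[OF p, of "m - (1 - b) - (1 - b')" "S i - T i"] by auto
    ultimately have "rge p ((m - (1 - b) - (1 - b')) + ((1 - b) + (1 - b'))) ((T i - S i) * (inverse (S i) * inverse (T i)))"
      by (intro rge_mult[OF p])
    moreover have "S i \<noteq> 0" "T i \<noteq> 0" using b b' that by (metis max.bounded_iff rge_0)+
    hence "(T i - S i) * (inverse (S i) * inverse (T i)) = inverse (S i) - inverse (T i)" by (simp add: field_simps)
    ultimately show ?thesis by simp
  qed
  thus "\<exists>N. \<forall>i\<ge>N. rge p m (inverse (S i) - inverse (T i))" by blast
qed

end

section \<open>The field of \<open>p\<close>-adic numbers as a type\<close>

text \<open>A type cannot depend on the variable \<open>p\<close>. It can depend on a constant, though: let \<open>test_pair\<close> be a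
  counterexample to the theorem if there is one, and arbitrary otherwise. It then suffices to prove the
  theorem for this one pair of a prime \<open>pp\<close> and a minimal model, and for it the \<open>p\<close>-adic numbers form a
  type of class \<open>field\<close>.\<close>

definition filtration_claim :: "nat \<Rightarrow> (nat \<Rightarrow> rat) \<Rightarrow> bool" where
  "filtration_claim p b \<longleftrightarrow> (\<forall>a. is_weierstrass a \<longrightarrow> p_integral_model p a \<longrightarrow> \<not> p_minimal p a \<longrightarrow>
     models_iso a b \<longrightarrow> p_minimal p b \<longrightarrow>
     (let k = nat ((rat_val p (disc a) - rat_val p (disc b)) div 12) in
       (\<forall>n. ((EQp p a)\<lparr>carrier := Efilt p a n\<rparr>) \<cong> ((EQp p b)\<lparr>carrier := Efilt p b (n + k)\<rparr>))
         \<and> (k \<ge> 1 \<longrightarrow>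
           Eindex p a (E0 p a) = Eindex p b (Efilt p b k)
         \<and> Eindex p b (Efilt p b k) = tamagawa p b * Np p b * p ^ (k - 1))))"

text \<open>The model is fixed together with the prime because the class
  \<open>weierstrass_field\<close> ties one set of coefficients to each type. The default value
  keeps \<open>prime_pp\<close> unconditional.\<close>

definition test_pair :: "nat \<times> (nat \<Rightarrow> rat)" where
  "test_pair = (if \<exists>q. Factorial_Ring.prime (fst q) \<and> \<not> filtration_claim (fst q) (snd q)
     then SOME q. Factorial_Ring.prime (fst q) \<and> \<not> filtration_claim (fst q) (snd q) else (2, \<lambda>_. 0))"

definition pp :: nat where "pp = fst test_pair"
definition test_model :: "nat \<Rightarrow> rat" where "test_model = snd test_pair"

lemma prime_pp: "Factorial_Ring.prime pp"
  unfolding pp_def test_pair_def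
  using someI_ex[of "\<lambda>q. Factorial_Ring.prime (fst q) \<and> \<not> filtration_claim (fst q) (snd q)"] by auto

lemma filtration_claim_from_test: 
  assumes "filtration_claim pp test_model" "Factorial_Ring.prime p" shows "filtration_claim p b"
proof (rule ccontr)
  assume "\<not> filtration_claim p b"
  hence "\<exists>q. Factorial_Ring.prime (fst q) \<and> \<not> filtration_claim (fst q) (snd q)" using assms(2) by auto
  from someI_ex[OF this] this assms(1) show False by (simp add: pp_def test_model_def test_pair_def)
qed

definition padic_rel :: "(nat \<Rightarrow> rat) \<Rightarrow> (nat \<Rightarrow> rat) \<Rightarrow> bool" where
  "padic_rel S T \<longleftrightarrow> padic_cauchy pp S \<and> padic_cauchy pp T \<and> padic_null pp (\<lambda>n. S n - T n)"

lemma padic_rel_refl_iff: "padic_rel S S \<longleftrightarrow> padic_cauchy pp S"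
  by (simp add: padic_rel_def null_iff)

lemma padic_relI: "padic_cauchy pp S \<Longrightarrow> padic_cauchy pp T \<Longrightarrow> padic_null pp (\<lambda>n. S n - T n) \<Longrightarrow> padic_rel S T"
  by (simp add: padic_rel_def)

lemma padic_rel_sym: "padic_rel S T \<Longrightarrow> padic_rel T S"
  using null_minus[OF prime_pp, of "\<lambda>n. S n - T n"] by (simp add: padic_rel_def)

lemma padic_rel_trans: "padic_rel S T \<Longrightarrow> padic_rel T U \<Longrightarrow> padic_rel S U"
  using null_add[OF prime_pp, of "\<lambda>n. S n - T n" "\<lambda>n. T n - U n"] by (simp add: padic_rel_def)

lemma padic_rel_null: assumes "padic_rel S T" shows "padic_null pp S \<longleftrightarrow> padic_null pp T"
proof
  assume "padic_null pp S" thus "padic_null pp T" 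
    using assms null_diff[OF prime_pp, of S "\<lambda>n. S n - T n"] by (simp add: padic_rel_def)
next
  assume "padic_null pp T" thus "padic_null pp S" 
    using assms null_add[OF prime_pp, of T "\<lambda>n. S n - T n"] by (simp add: padic_rel_def)
qed

quotient_type padic = "nat \<Rightarrow> rat" / partial: padic_rel
proof (rule part_equivpI)
  show "\<exists>S. padic_rel S S" using cauchy_const[OF prime_pp] by (auto simp: padic_rel_refl_iff)
  show "symp padic_rel" by (auto intro: sympI padic_rel_sym)
  show "transp padic_rel" by (auto intro: transpI padic_rel_trans)
qed

lemma null_add_diff: assumes "padic_null pp (\<lambda>n. A n - A' n)" "padic_null pp (\<lambda>n. B n - B' n)"
  shows "padic_null pp (\<lambda>n. A n + B n - (A' n + B' n))"
  using null_add[OF prime_pp assms] by (simp add: add_diff_add)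

lemma null_mult_diff: assumes "padic_rel A A'" "padic_rel B B'"
  shows "padic_null pp (\<lambda>n. A n * B n - (A' n * B' n))"
proof -
  have "padic_null pp (\<lambda>n. (A n - A' n) * B n + (B n - B' n) * A' n)"
    using assms unfolding padic_rel_def by (intro null_add null_mult prime_pp) auto
  thus ?thesis by (simp add: algebra_simps)
qed

instantiation padic :: field
begin

lift_definition zero_padic :: padic is "\<lambda>_. 0" by (simp add: padic_rel_refl_iff cauchy_const prime_pp)
lift_definition one_padic :: padic is "\<lambda>_. 1" by (simp add: padic_rel_refl_iff cauchy_const prime_pp)
lift_definition plus_padic :: "padic \<Rightarrow> padic \<Rightarrow> padic" is "\<lambda>S T n. S n + T n"
  by (simp add: padic_rel_def cauchy_add prime_pp null_add_diff)
lift_definition uminus_padic :: "padic \<Rightarrow> padic" is "\<lambda>S n. - S n"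
proof -
  fix S T assume "padic_rel S T"
  thus "padic_rel (\<lambda>n. - S n) (\<lambda>n. - T n)"
    using null_minus[OF prime_pp, of "\<lambda>n. S n - T n"] by (simp add: padic_rel_def cauchy_minus prime_pp)
qed
lift_definition times_padic :: "padic \<Rightarrow> padic \<Rightarrow> padic" is "\<lambda>S T n. S n * T n"
proof -
  fix S S' T T' assume "padic_rel S S'" "padic_rel T T'"
  from null_mult_diff[OF this] this show "padic_rel (\<lambda>n. S n * T n) (\<lambda>n. S' n * T' n)"
    by (simp add: padic_rel_def cauchy_mult prime_pp)
qed
text \<open>Null sequences go to 0, as \<open>inverse 0 = 0\<close> demands. A non-null Cauchy
  sequence has only finitely many zero terms, which do not affect its class.\<close>

lift_definition inverse_padic :: "padic \<Rightarrow> padic" 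
  is "\<lambda>S. if padic_null pp S then (\<lambda>_. 0) else (\<lambda>n. inverse (S n))"
proof -
  fix S T assume ST: "padic_rel S T"
  show "padic_rel (if padic_null pp S then \<lambda>_. 0 else (\<lambda>n. inverse (S n)))
     (if padic_null pp T then \<lambda>_. 0 else (\<lambda>n. inverse (T n)))"
    using ST padic_rel_null[OF ST] unfolding padic_rel_def
    by (simp add: cauchy_const prime_pp null_const_iff cauchy_inverse null_inverse_diff)
qed
definition minus_padic :: "padic \<Rightarrow> padic \<Rightarrow> padic" where "x - y = x + - y" for x y :: padic
definition divide_padic :: "padic \<Rightarrow> padic \<Rightarrow> padic" where "x div y = x * inverse y" for x y :: padic

lemma padic_relI': "padic_cauchy pp S \<Longrightarrow> S = T \<Longrightarrow> padic_rel S T" by (simp add: padic_rel_refl_iff)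

instance
proof
  fix x y z :: padic
  show "x + y + z = x + (y + z)"
    by transfer (auto simp: padic_rel_refl_iff algebra_simps intro!: padic_relI' cauchy_add prime_pp)
  show "x + y = y + x"
    by transfer (auto simp: padic_rel_refl_iff algebra_simps intro!: padic_relI' cauchy_add prime_pp)
  show "0 + x = x" by transfer (auto simp: padic_rel_refl_iff)
  show "- x + x = 0" by transfer (auto simp: padic_rel_refl_iff intro!: padic_relI' cauchy_const prime_pp)
  show "x - y = x + - y" by (simp add: minus_padic_def)
  show "x * y * z = x * (y * z)"
    by transfer (auto simp: padic_rel_refl_iff algebra_simps intro!: padic_relI' cauchy_mult prime_pp)
  show "x * y = y * x"
    by transfer (auto simp: padic_rel_refl_iff algebra_simps intro!: padic_relI' cauchy_mult prime_pp)
  show "1 * x = x" by transfer (auto simp: padic_rel_refl_iff)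
  show "(x + y) * z = x * z + y * z"
    by transfer (auto simp: padic_rel_refl_iff algebra_simps intro!: padic_relI' cauchy_add cauchy_mult prime_pp)
  show "(0::padic) \<noteq> 1" by transfer (simp add: padic_rel_def null_const_iff[OF prime_pp])
  show "inverse 0 = (0::padic)" by transfer (auto simp: null_const_iff[OF prime_pp] padic_rel_refl_iff cauchy_const[OF prime_pp])
  show "x div y = x * inverse y" by (simp add: divide_padic_def)
  show "inverse x * x = 1" if "x \<noteq> 0"
    using that
  proof transfer
    fix S assume S: "padic_rel S S" "\<not> padic_rel S (\<lambda>_. 0)"
    have c: "padic_cauchy pp S" using S by (simp add: padic_rel_refl_iff)
    have n: "\<not> padic_null pp S" using S c cauchy_const[OF prime_pp] by (auto simp: padic_rel_def)
    obtain m N where N: "\<forall>i\<ge>N. \<not> rge pp m (S i)" using not_null_bounded[OF prime_pp c n] by blast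
    hence "inverse (S i) * S i - 1 = 0" if "i \<ge> N" for i using that by (metis left_inverse rge_0 right_minus_eq)
    hence "padic_null pp (\<lambda>i. inverse (S i) * S i - 1)" unfolding null_iff by (metis rge_0)
    thus "padic_rel (\<lambda>n. (if padic_null pp S then \<lambda>_. 0 else (\<lambda>n. inverse (S n))) n * S n) (\<lambda>_. 1)"
      using n c by (auto intro!: padic_relI cauchy_mult cauchy_inverse cauchy_const prime_pp)
  qed
qed
end

lift_definition const_padic :: "rat \<Rightarrow> padic" is "\<lambda>r _. r" by (simp add: padic_rel_refl_iff cauchy_const prime_pp)

lemma const_padic_hom: "const_padic 0 = 0" "const_padic 1 = 1" "const_padic (r + s) = const_padic r + const_padic s"
  "const_padic (r * s) = const_padic r * const_padic s" "const_padic (- r) = - const_padic r"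
  by (transfer; simp add: padic_rel_refl_iff cauchy_const prime_pp)+

lemma const_padic_inj: "const_padic r = const_padic s \<longleftrightarrow> r = s"
  by transfer (simp add: padic_rel_def cauchy_const prime_pp null_const_iff[OF prime_pp])

lemma const_padic_of_nat: "const_padic (of_nat n) = of_nat n"
  by (induction n) (simp_all add: const_padic_hom)

instance padic :: field_char_0
  by standard (metis const_padic_inj const_padic_of_nat injI of_nat_eq_iff)

lemma const_padic_of_int: "const_padic (of_int n) = of_int n"
proof (cases n rule: int_diff_cases)
  case (diff a b)
  have "const_padic (of_nat a + - of_nat b) = of_nat a - of_nat b"
    by (simp only: const_padic_hom const_padic_of_nat diff_conv_add_uminus)
  thus ?thesis using diff by simp
qed

lemma of_rat_padic: "of_rat r = const_padic r"
proof -
  obtain a b where ab: "r = of_int a / of_int b" "b \<noteq> 0" by (metis quotient_of_div quotient_of_denom_pos less_irrefl surj_pair)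
  hence "r * of_int b = of_int a" by simp
  hence "const_padic r * of_int b = of_int a" by (metis const_padic_hom(4) const_padic_of_int)
  hence "const_padic r = of_int a / of_int b" using ab(2) by (simp add: nonzero_eq_divide_eq)
  thus ?thesis using ab by (simp add: of_rat_divide)
qed

section \<open>The valuation on the type of p-adic numbers\<close>

lift_definition vge :: "int \<Rightarrow> padic \<Rightarrow> bool" is "\<lambda>m S. \<exists>N. \<forall>i\<ge>N. rge pp m (S i)"
proof -
  have *: "\<exists>N. \<forall>i\<ge>N. rge pp m (T i)" if h: "padic_rel S T" "\<exists>N. \<forall>i\<ge>N. rge pp m (S i)" for m S T
  proof -
    obtain N where N: "\<forall>i\<ge>N. rge pp m (S i)" using h by blast
    obtain M where M: "\<forall>i\<ge>M. rge pp m (S i - T i)" using h unfolding padic_rel_def null_iff by blast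
    have "rge pp m (T i)" if "i \<ge> max N M" for i
      using rge_diff[OF prime_pp, of m "S i" "S i - T i"] N M that by simp
    thus ?thesis by blast
  qed
  fix m S T assume "padic_rel S T"
  thus "(\<exists>N. \<forall>i\<ge>N. rge pp m (S i)) = (\<exists>N. \<forall>i\<ge>N. rge pp m (T i))" using * padic_rel_sym by blast
qed

lemma vge_of_rat [simp]: "vge m (of_rat r) \<longleftrightarrow> rge pp m r"
  unfolding of_rat_padic by transfer auto

lemma vge_0 [simp]: "vge m 0" using vge_of_rat[of m 0] by simp
lemma vge_1 [simp]: "vge m 1 \<longleftrightarrow> m \<le> 0" using vge_of_rat[of m 1] by (simp add: rge_1)

lemma vge_mono: "vge m x \<Longrightarrow> m' \<le> m \<Longrightarrow> vge m' x"
proof transfer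
  fix m m' :: int and S :: "nat \<Rightarrow> rat" assume "\<exists>N. \<forall>i\<ge>N. rge pp m (S i)" and le: "m' \<le> m"
  then obtain N where "\<forall>i\<ge>N. rge pp m (S i)" by blast
  hence "\<forall>i\<ge>N. rge pp m' (S i)" using rge_mono[OF _ le] by simp
  thus "\<exists>N. \<forall>i\<ge>N. rge pp m' (S i)" by blast
qed

lemma vge_add: "vge m x \<Longrightarrow> vge m y \<Longrightarrow> vge m (x + y)"
proof transfer
  fix m and S T :: "nat \<Rightarrow> rat" assume S: "\<exists>N. \<forall>i\<ge>N. rge pp m (S i)" and T: "\<exists>N. \<forall>i\<ge>N. rge pp m (T i)"
  obtain N where N: "\<forall>i\<ge>N. rge pp m (S i)" using S by blast
  obtain M where M: "\<forall>i\<ge>M. rge pp m (T i)" using T by blast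
  from N M have "\<forall>i\<ge>max N M. rge pp m (S i + T i)" by (simp add: rge_add prime_pp)
  thus "\<exists>N. \<forall>i\<ge>N. rge pp m (S i + T i)" by blast
qed
lemma vge_mult: "vge m x \<Longrightarrow> vge n y \<Longrightarrow> vge (m + n) (x * y)"
proof transfer
  fix m n and S T :: "nat \<Rightarrow> rat" assume S: "\<exists>N. \<forall>i\<ge>N. rge pp m (S i)" and T: "\<exists>N. \<forall>i\<ge>N. rge pp n (T i)"
  obtain N where N: "\<forall>i\<ge>N. rge pp m (S i)" using S by blast
  obtain M where M: "\<forall>i\<ge>M. rge pp n (T i)" using T by blast
  from N M have "\<forall>i\<ge>max N M. rge pp (m + n) (S i * T i)" by (simp add: rge_mult prime_pp)
  thus "\<exists>N. \<forall>i\<ge>N. rge pp (m + n) (S i * T i)" by blast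
qed
lemma vge_minus [simp]: "vge m (- x) \<longleftrightarrow> vge m x" by transfer (simp add: prime_pp)
lemma vge_diff: "vge m x \<Longrightarrow> vge m y \<Longrightarrow> vge m (x - y)" using vge_add[of m x "- y"] by simp

lemma vge_inverse: "\<not> vge m x \<Longrightarrow> vge (1 - m) (inverse x)"
proof transfer
  fix m and S :: "nat \<Rightarrow> rat" assume S: "padic_rel S S" "\<not> (\<exists>N. \<forall>i\<ge>N. rge pp m (S i))"
  obtain N where N: "\<forall>i\<ge>N. \<not> rge pp m (S i)"
    using eventually_not_rge[OF prime_pp S(1)[unfolded padic_rel_refl_iff] S(2)] by blast
  have "\<not> padic_null pp S"
  proof
    assume "padic_null pp S"
    then obtain M where "\<forall>i\<ge>M. rge pp m (S i)" unfolding null_iff by blast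
    from this[rule_format, of "max N M"] N[rule_format, of "max N M"] show False by simp
  qed
  moreover have "\<forall>i\<ge>N. rge pp (1 - m) (inverse (S i))" using N by (simp add: rge_inverse[OF prime_pp])
  hence "\<exists>N. \<forall>i\<ge>N. rge pp (1 - m) (inverse (S i))" by blast
  ultimately show "\<exists>N. \<forall>i\<ge>N. rge pp (1 - m) ((if padic_null pp S then \<lambda>_. 0 else (\<lambda>n. inverse (S n))) i)" by simp
qed

lemma vge_dense: "\<exists>r. vge m (x - of_rat r)"
proof -
  have "\<exists>r. vge m (x + - const_padic r)"
  proof transfer
    fix x m assume "padic_rel x x"
    then obtain N where "\<forall>i\<ge>N. \<forall>j\<ge>N. rge pp m (x i - x j)" unfolding padic_rel_refl_iff cauchy_iff by blast
    hence "\<forall>i\<ge>N. rge pp m (x i + - x N)" by simp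
    thus "\<exists>r. \<exists>N. \<forall>i\<ge>N. rge pp m (x i + - r)" by blast
  qed
  thus ?thesis by (simp add: of_rat_padic)
qed

lemma vge_residue: assumes "vge 0 x" shows "\<exists>n<pp. vge 1 (x - of_nat n)"
proof -
  obtain r where r: "vge 1 (x - of_rat r)" using vge_dense by blast
  have "vge 0 (x - (x - of_rat r))" by (rule vge_diff[OF assms vge_mono[OF r]]) simp
  hence "rge pp 0 r" by simp
  then obtain n where n: "n < pp" "rge pp 1 (r - of_nat n)" using rge_residue[OF prime_pp] by blast
  have "vge 1 (of_rat (r - of_nat n))" using n by simp
  from vge_add[OF r this] have "vge 1 (x - of_nat n)" by (simp add: of_rat_diff)
  thus ?thesis using n by blast
qed

lemma vge_residue_unique: assumes "m < pp" "n < pp" "vge 1 (of_nat m - of_nat n)" shows "m = n"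
proof -
  have "vge 1 (of_rat (of_nat m - of_nat n))" using assms by (simp add: of_rat_diff)
  hence "rge pp 1 (of_nat m - of_nat n)" by simp
  thus ?thesis using rge_residue_unique[OF prime_pp] assms by blast
qed

text \<open>All polynomials to which Hensel's lemma is applied have rational coefficients, so the Newton-like
  iteration \<open>x \<mapsto> x - u f(x)\<close> runs through rational numbers and completeness is not needed.\<close>

lemma contraction_root:
  fixes f :: "rat \<Rightarrow> rat" and F :: "padic \<Rightarrow> padic"
  assumes x0: "rge pp 0 x0" "rge pp 1 (f x0)" and u: "rge pp 0 u"
    and f: "\<And>x y m. rge pp 0 x \<Longrightarrow> rge pp 0 y \<Longrightarrow> rge pp 1 (x - x0) \<Longrightarrow> rge pp 1 (y - x0) \<Longrightarrow>
       rge pp m (x - y) \<Longrightarrow> rge pp (m + 1) (x - y - u * (f x - f y))"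
    and u': "\<And>x m. rge pp m (u * f x) \<Longrightarrow> rge pp m (f x)"
    and F: "\<And>S. padic_cauchy pp S \<Longrightarrow> F (abs_padic S) = abs_padic (\<lambda>n. f (S n)) \<and> padic_cauchy pp (\<lambda>n. f (S n))"
  shows "\<exists>x. F x = 0 \<and> vge 1 (x - of_rat x0)"
proof -
  define S where "S = rec_nat x0 (\<lambda>_ x. x - u * f x)"
  have S0: "S 0 = x0" and SS: "\<And>n. S (Suc n) = S n - u * f (S n)" by (simp_all add: S_def)
  \<comment> \<open>The correction \<open>u * f (S n)\<close> is the distance from one iterate to
    the next. The contraction hypothesis, applied to two consecutive iterates, gains one digit for
    it.\<close>
  have *: "rge pp 0 (S n) \<and> rge pp 1 (S n - x0) \<and> rge pp (int n + 1) (u * f (S n))" for n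
  proof (induction n)
    case 0 thus ?case using x0 rge_mult[OF prime_pp u x0(2)] by (simp add: S0)
  next
    case (Suc n)
    let ?d = "u * f (S n)"
    have d: "rge pp (int n + 1) ?d" using Suc by simp
    have "rge pp 1 ?d" by (rule rge_mono[OF d]) simp
    hence 1: "rge pp 1 (S (Suc n) - x0)" using Suc rge_diff[OF prime_pp, of 1 "S n - x0" ?d] by (simp add: SS algebra_simps)
    have "rge pp 0 ((S (Suc n) - x0) + x0)" using 1 x0(1) by (intro rge_add prime_pp) (auto intro: rge_mono)
    hence 2: "rge pp 0 (S (Suc n))" by simp
    have "rge pp (int n + 1) (S n - S (Suc n))" using d by (simp add: SS)
    from f[OF _ 2 _ 1 this] Suc have "rge pp (int n + 1 + 1) (S n - S (Suc n) - u * (f (S n) - f (S (Suc n))))" by blast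
    moreover have "S n - S (Suc n) - u * (f (S n) - f (S (Suc n))) = u * f (S (Suc n))" by (simp add: SS algebra_simps)
    ultimately show ?case using 1 2 by (simp add: algebra_simps)
  qed
  have step: "rge pp (int N) (S (N + k) - S N)" for N k
  proof (induction k)
    case (Suc k)
    have "rge pp (int N) (u * f (S (N + k)))" using *[of "N + k"] by (elim conjE) (erule rge_mono, simp)
    from rge_diff[OF prime_pp Suc this] show ?case by (simp add: SS algebra_simps)
  qed simp
  have c: "padic_cauchy pp S" unfolding cauchy_iff
  proof
    fix m
    have "rge pp m (S i - S j)" if "i \<ge> nat m" "j \<ge> nat m" for i j
    proof -
      have "rge pp m (S i - S (nat m))" "rge pp m (S j - S (nat m))"
        using step[of "nat m" "i - nat m"] step[of "nat m" "j - nat m"] that by (auto intro: rge_mono)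
      from rge_diff[OF prime_pp this] show ?thesis by simp
    qed
    thus "\<exists>N. \<forall>i\<ge>N. \<forall>j\<ge>N. rge pp m (S i - S j)" by blast
  qed
  have n: "padic_null pp (\<lambda>n. f (S n))" unfolding null_iff
  proof
    fix m
    have "rge pp m (f (S i))" if "i \<ge> nat m" for i
    proof (rule u', rule rge_mono)
      show "rge pp (int i + 1) (u * f (S i))" using * by blast
    qed (use that in simp)
    thus "\<exists>N. \<forall>i\<ge>N. rge pp m (f (S i))" by blast
  qed
  have "F (abs_padic S) = abs_padic (\<lambda>n. f (S n))" using F[OF c] by blast
  also have "\<dots> = 0" unfolding zero_padic.abs_eq
    using F[OF c] n by (intro Quotient_rel_abs[OF Quotient_padic]) (simp add: padic_rel_def cauchy_const prime_pp)
  finally have 1: "F (abs_padic S) = 0" .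
  have "vge 1 (abs_padic (\<lambda>n. S n + - x0))"
    using * cauchy_diff[OF prime_pp c cauchy_const[OF prime_pp], of x0] by (subst vge.abs_eq) (simp_all add: padic_rel_refl_iff)
  moreover have "abs_padic (\<lambda>n. S n + - x0) = abs_padic S - of_rat x0"
    unfolding of_rat_padic const_padic.abs_eq minus_padic_def
    using c cauchy_const[OF prime_pp] cauchy_minus[OF prime_pp cauchy_const[OF prime_pp]]
    by (simp add: plus_padic.abs_eq uminus_padic.abs_eq padic_rel_refl_iff)
  ultimately show ?thesis using 1 by auto
qed

section \<open>Reduction of collinear points\<close>

lemma vge_mult_0: "vge 0 x \<Longrightarrow> vge 0 y \<Longrightarrow> vge 0 (x * y)" using vge_mult[of 0 x 0 y] by simp
lemma vge_mult_l: "vge 1 x \<Longrightarrow> vge 0 y \<Longrightarrow> vge 1 (x * y)" using vge_mult[of 1 x 0 y] by simp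
lemma vge_1_0: "vge 1 x \<Longrightarrow> vge 0 x" by (erule vge_mono) simp
lemma vge_numeral [simp]: "vge 0 (numeral k)"
  using vge_of_rat[of 0 "numeral k"] rge_of_int[OF prime_pp, of "numeral k"] by simp

lemma vge_0_1: "vge 0 1" by simp

lemmas vge_rules = vge_add vge_diff vge_mult_l vge_mult_0 vge_minus[THEN iffD2] vge_numeral vge_0_1

lemma vge_inverse_1: "\<not> vge 0 x \<Longrightarrow> vge 1 (inverse x)" using vge_inverse[of 0 x] by simp
lemma not_vge_nonzero: "\<not> vge m x \<Longrightarrow> x \<noteq> 0" by auto

lemma vge_prime: assumes "vge 1 (x * y)" "vge 0 x" "vge 0 y" shows "vge 1 x \<or> vge 1 y"
proof (rule ccontr)
  assume n: "\<not> (vge 1 x \<or> vge 1 y)"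
  hence "vge 0 (inverse x * inverse y)" using vge_inverse[of 1 x] vge_inverse[of 1 y] by (simp add: vge_mult_0)
  from vge_mult_l[OF assms(1) this] have "vge 1 ((x * inverse x) * (y * inverse y))" by (simp only: ac_simps)
  moreover have "x \<noteq> 0" "y \<noteq> 0" using n by auto
  ultimately have "vge 1 1" by simp
  thus False by simp
qed

text \<open>The valuation ring is integrally closed: for a non-integral root x, division by x^2
  would write 1 as an integral multiple of 1 / x, which lies in the maximal ideal.\<close>

lemma vge_monic2: assumes "x * x + a * x = b" "vge 0 a" "vge 0 b" shows "vge 0 x"
proof (rule ccontr)
  assume n: "\<not> vge 0 x"
  define z where "z = inverse x"
  have z: "vge 1 z" "x * z = 1" using vge_inverse_1[OF n] not_vge_nonzero[OF n] by (simp_all add: z_def)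
  have "z * (b * z - a) = (x * z) * (x * z) + a * z * (x * z) - a * z"
    unfolding assms(1)[symmetric] by (simp add: algebra_simps)
  hence "1 = z * (b * z - a)" unfolding z(2) by simp
  also have "vge 1 \<dots>" using z vge_1_0[OF z(1)] assms by - (assumption | rule vge_rules)+
  finally show False by simp
qed

lemma vge_monic3: assumes "x * x * x + a * x * x + b * x = d" "vge 0 a" "vge 0 b" "vge 0 d" shows "vge 0 x"
proof (rule ccontr)
  assume n: "\<not> vge 0 x"
  define z where "z = inverse x"
  have z: "vge 1 z" "x * z = 1" using vge_inverse_1[OF n] not_vge_nonzero[OF n] by (simp_all add: z_def)
  have "z * (d * z * z - a - b * z) = (x * z) * (x * z) * (x * z) + a * z * (x * z) * (x * z)
      + b * z * z * (x * z) - a * z - b * z * z"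
    unfolding assms(1)[symmetric] by (simp add: algebra_simps)
  hence "1 = z * (d * z * z - a - b * z)" unfolding z(2) by simp
  also have "vge 1 \<dots>" using z vge_1_0[OF z(1)] assms by - (assumption | rule vge_rules)+
  finally show False by simp
qed

section \<open>Integral models and integral coordinates\<close>

definition icoef :: "(nat \<Rightarrow> padic) \<Rightarrow> bool" where
  "icoef c \<longleftrightarrow> vge 0 (c 1) \<and> vge 0 (c 2) \<and> vge 0 (c 3) \<and> vge 0 (c 4) \<and> vge 0 (c 6)"

lemma icoefD: assumes "icoef c"
  shows "vge 0 (c 1)" "vge 0 (c 2)" "vge 0 (c 3)" "vge 0 (c 4)" "vge 0 (c 6)"
  using assms by (auto simp: icoef_def)

lemma integral_y: assumes "icoef c" "on_curve c x y" "vge 0 x" shows "vge 0 y"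
proof (rule vge_monic2)
  show "y * y + (c 1 * x + c 3) * y = x * x * x + c 2 * x * x + c 4 * x + c 6"
    using assms(2) unfolding on_curve_def by Groebner_Basis.algebra
qed (insert assms(3) icoefD[OF assms(1)], (assumption | rule vge_rules)+)

text \<open>What has to be excluded is v(x) = -1. If v(y) >= -1, divide the curve equation by x^3;
  otherwise v(1/y) >= 2 and division by y^2 works. In both cases 1 would lie in the maximal
  ideal.\<close>

lemma not_integral_x: assumes ic: "icoef c" and on: "on_curve c x y" and n: "\<not> vge 0 x" shows "\<not> vge (-1) x"
proof
  assume x1: "vge (-1) x"
  note c = icoefD[OF ic]
  show False
  proof (cases "vge (-1) y")
    case True
    define z where "z = inverse x"
    have z: "vge 1 z" "x * z = 1" using vge_inverse_1[OF n] not_vge_nonzero[OF n] by (simp_all add: z_def)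
    have yz: "vge 0 (y * z)" using vge_mult[OF True z(1)] by simp
    have "1 = z * ((y * z) * (y * z) + c 1 * (y * z) + c 3 * (y * z) * z - c 2 - c 4 * z - c 6 * z * z)"
      using on z(2) unfolding on_curve_def by Groebner_Basis.algebra
    also have "vge 1 \<dots>" using z vge_1_0[OF z(1)] yz c by - (assumption | rule vge_rules)+
    finally show False by simp
  next
    case False
    define w where "w = inverse y"
    have w: "vge 2 w" "y * w = 1" using vge_inverse[OF False] not_vge_nonzero[OF False] by (simp_all add: w_def)
    have xw: "vge 1 (x * w)" using vge_mult[OF x1 w(1)] by simp
    have w0: "vge 1 w" by (rule vge_mono[OF w(1)]) simp
    have x2w: "vge 0 (x * x * w)" using vge_mult[OF x1 xw] by (simp add: mult.assoc)
    have "1 = (x * w) * (x * x * w + c 2 * (x * w) + c 4 * w - c 1) + w * (c 6 * w - c 3)"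
      using on w(2) unfolding on_curve_def by Groebner_Basis.algebra
    also have "vge 1 \<dots>" using w0 xw x2w c vge_1_0[OF w0] vge_1_0[OF xw] by - (assumption | rule vge_rules)+
    finally show False by simp
  qed
qed

definition dFx :: "(nat \<Rightarrow> padic) \<Rightarrow> padic \<Rightarrow> padic \<Rightarrow> padic" where
  "dFx c x y = c 1 * y - 3 * (x * x) - 2 * c 2 * x - c 4"
definition dFy :: "(nat \<Rightarrow> padic) \<Rightarrow> padic \<Rightarrow> padic \<Rightarrow> padic" where
  "dFy c x y = 2 * y + c 1 * x + c 3"

text \<open>The Vieta relations are symmetric in the roots, so a statement about the third point can
  be read for each of the three by permuting the parameters.\<close>

locale collinear =
  fixes c :: "nat \<Rightarrow> padic" and l n x1 x2 x3 y1 y2 y3 :: padic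
  assumes ic: "icoef c" and v: "line_roots c l n x1 x2 x3"
    and y1: "y1 = l * x1 + n" and y2: "y2 = l * x2 + n" and y3: "y3 = l * x3 + n"
begin

lemma collinear_23: "collinear c l n x1 x3 x2 y1 y3 y2" 
  by unfold_locales (use ic v y1 y2 y3 in \<open>auto intro: line_roots_sym\<close>)
lemma collinear_12: "collinear c l n x2 x1 x3 y2 y1 y3" 
  by unfold_locales (use ic v y1 y2 y3 in \<open>auto intro: line_roots_sym\<close>)

lemma cs: "vge 0 (c 1)" "vge 0 (c 2)" "vge 0 (c 3)" "vge 0 (c 4)" "vge 0 (c 6)"
  using icoefD[OF ic] .

lemma on3: "on_curve c x3 y3" using line_roots_on_curve[OF v] y3 by simp
lemma int_y3: "vge 0 x3 \<Longrightarrow> vge 0 y3" using integral_y[OF ic on3] .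

lemma int_n: assumes "vge 0 x3" "vge 0 l" shows "vge 0 n"
proof -
  have "n = y3 - l * x3" using y3 by simp
  also have "vge 0 \<dots>" using assms int_y3[OF assms(1)] by - (assumption | rule vge_rules)+
  finally show ?thesis .
qed

lemma int_x3: assumes "vge 0 l" "vge 0 n" shows "vge 0 x3"
proof (rule vge_monic3)
  show "x3 * x3 * x3 + (c 2 - l * l - c 1 * l) * x3 * x3 + (c 4 - 2 * l * n - c 1 * n - c 3 * l) * x3
     = n * n + c 3 * n - c 6"
    using on3 unfolding on_curve_def y3 by Groebner_Basis.algebra
qed (insert assms cs, (assumption | rule vge_rules)+)

lemma int_l: assumes "vge 0 x1" "vge 0 x2" "vge 0 x3" shows "vge 0 l"
proof (rule vge_monic2)
  show "l * l + c 1 * l = x1 + x2 + x3 + c 2" using v unfolding line_roots_def by Groebner_Basis.algebra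
qed (insert assms cs, (assumption | rule vge_rules)+)

lemmas all_y = collinear.int_y3[OF collinear.collinear_23[OF collinear_12]] collinear.int_y3[OF collinear_23] int_y3

text \<open>If \<open>x3\<close> were integral, the slope \<open>l\<close> would not be. Then \<open>(x1 + x2) / l\<^sup>2\<close> is a unit and
  \<open>x1 x2 / l\<^sup>2\<close> is integral, but their quotient \<open>1/x1 + 1/x2\<close> lies in the maximal ideal.\<close>

lemma two_kernel: assumes "\<not> vge 0 x1" "\<not> vge 0 x2" shows "\<not> vge 0 x3"
proof
  assume x3: "vge 0 x3"
  \<comment> \<open>With \<open>x3\<close> integral, an integral slope would make the whole line
    integral, and then each root satisfies a monic integral cubic.\<close>
  have "\<not> vge 0 l" using int_n[OF x3] collinear.int_x3[OF collinear_23] assms(2) by blast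
  define m where "m = inverse l"
  have m: "vge 1 m" "l * m = 1" using \<open>\<not> vge 0 l\<close> vge_inverse_1 not_vge_nonzero by (auto simp: m_def)
  note m0 = vge_1_0[OF m(1)]
  define z1 where "z1 = inverse x1"
  define z2 where "z2 = inverse x2"
  have z1: "vge 1 z1" "x1 * z1 = 1" using assms vge_inverse_1 not_vge_nonzero by (auto simp: z1_def)
  have z2: "vge 1 z2" "x2 * z2 = 1" using assms vge_inverse_1 not_vge_nonzero by (auto simp: z2_def)
  note y3' = int_y3[OF x3]
  have s: "m * m * (x1 + x2) = 1 + c 1 * m - c 2 * m * m - m * m * x3"
    using v m(2) unfolding line_roots_def by Groebner_Basis.algebra
  have si: "vge 0 (m * m * (x1 + x2))" unfolding s using m0 cs x3 by - (assumption | rule vge_rules)+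
  have "m * m * (x1 * x2) = m * m * c 4 - 2 * m * y3 + 2 * x3 - c 1 * m * (m * y3 - x3) - c 3 * m
      - m * m * (x1 + x2) * x3"
    using v m(2) unfolding line_roots_def y3 by Groebner_Basis.algebra
  also have "vge 0 \<dots>" using m0 cs x3 y3' si by - (assumption | rule vge_rules)+
  finally have p: "vge 0 (m * m * (x1 * x2))" .
  have "1 = (z1 + z2) * (m * m * (x1 * x2)) - m * (c 1 - c 2 * m - m * x3)"
    using s z1(2) z2(2) by Groebner_Basis.algebra
  also have "vge 1 \<dots>" using p z1 z2 m m0 cs x3 by - (assumption | rule vge_rules)+
  finally show False by simp
qed

text \<open>The slope cannot be integral, for otherwise the line and hence \<open>x3\<close> would
  be. So the line becomes vertical modulo p, and its two integral points are opposite there.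
  Dividing the differences by the slope makes this precise.\<close>

lemma one_kernel: assumes "vge 0 x1" "vge 0 x2" "\<not> vge 0 x3"
  shows "vge 1 (x1 - x2)" "vge 1 (y1 + y2 + c 1 * x2 + c 3)"
proof -
  note L = collinear.collinear_23[OF collinear_12]
  have "\<not> vge 0 l"
    using collinear.int_n[OF L assms(1)] int_x3 assms(3) by blast
  define m where "m = inverse l"
  have m: "vge 1 m" "l * m = 1" using \<open>\<not> vge 0 l\<close> vge_inverse_1 not_vge_nonzero by (auto simp: m_def)
  have yi: "vge 0 y1" "vge 0 y2" using assms all_y by auto
  have "x1 - x2 = m * (y1 - y2)" using m(2) unfolding y1 y2 by Groebner_Basis.algebra
  also have "vge 1 \<dots>" using m yi by - (assumption | rule vge_rules)+
  finally show "vge 1 (x1 - x2)" .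
  have "y1 + y2 + c 1 * x2 + c 3 = m * (x1 * x1 + x1 * x2 + x2 * x2 + c 2 * (x1 + x2) + c 4 - c 1 * y1)"
    using m(2) v unfolding y1 y2 line_roots_def by Groebner_Basis.algebra
  also have "vge 1 \<dots>" using m yi cs assms by - (assumption | rule vge_rules)+
  finally show "vge 1 (y1 + y2 + c 1 * x2 + c 3)" .
qed

text \<open>For an integral slope, x1 = x2 modulo p implies y1 = y2 modulo p. Opposite points then
  coincide, so F_y vanishes, and the identity F_x + l F_y = - (x1 - x2)(x1 - x3) makes F_x vanish
  too.\<close>

lemma opposite_singular: assumes "vge 0 x1" "vge 0 x2" "vge 0 x3" "vge 1 (x1 - x2)" "vge 1 (y1 + y2 + c 1 * x1 + c 3)"
  shows "vge 1 (dFx c x1 y1)" "vge 1 (dFy c x1 y1)"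
proof -
  have l: "vge 0 l" using int_l assms by blast
  have "dFy c x1 y1 = (y1 + y2 + c 1 * x1 + c 3) + (x1 - x2) * l" unfolding dFy_def y1 y2 by (simp add: algebra_simps)
  also have "vge 1 \<dots>" using assms l by - (assumption | rule vge_rules)+
  finally show Fy: "vge 1 (dFy c x1 y1)" .
  have "dFx c x1 y1 = - ((x1 - x2) * (x1 - x3)) - dFy c x1 y1 * l"
    using v unfolding dFx_def dFy_def y1 line_roots_def by Groebner_Basis.algebra
  also have "vge 1 \<dots>" using assms l Fy by - (assumption | rule vge_rules)+
  finally show "vge 1 (dFx c x1 y1)" .
qed

text \<open>The line meets the reduced curve with multiplicity at least two in a singular point, so one of the
  other two points has the same reduction.\<close>

lemma singular_third: assumes "vge 0 x1" "vge 0 x2" "vge 0 x3" "vge 1 (dFx c x3 y3)" "vge 1 (dFy c x3 y3)"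
  shows "(vge 1 (dFx c x1 y1) \<and> vge 1 (dFy c x1 y1)) \<or> (vge 1 (dFx c x2 y2) \<and> vge 1 (dFy c x2 y2))"
proof -
  have l: "vge 0 l" using int_l assms by blast
  have "(x3 - x1) * (x3 - x2) = - dFx c x3 y3 - dFy c x3 y3 * l"
    using v unfolding dFx_def dFy_def y3 line_roots_def by Groebner_Basis.algebra
  also have "vge 1 \<dots>" using assms l by - (assumption | rule vge_rules)+
  finally have "vge 1 (x3 - x1) \<or> vge 1 (x3 - x2)" using assms by (intro vge_prime) (auto intro: vge_diff)
  moreover have "vge 1 (dFx c x y) \<and> vge 1 (dFy c x y)" if d: "vge 1 (x3 - x)" and x: "vge 0 x" and y: "y = l * x + n" for x y
  proof
    have "dFy c x y = dFy c x3 y3 - (x3 - x) * (2 * l + c 1)" unfolding dFy_def y y3 by (simp add: algebra_simps)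
    also have "vge 1 \<dots>" using assms d l cs by - (assumption | rule vge_rules)+
    finally show "vge 1 (dFy c x y)" .
    have "dFx c x y = dFx c x3 y3 - (x3 - x) * (c 1 * l - 3 * (x + x3) - 2 * c 2)"
      unfolding dFx_def y y3 by (simp add: algebra_simps)
    also have "vge 1 \<dots>" using assms d l cs x by - (assumption | rule vge_rules)+
    finally show "vge 1 (dFx c x y)" .
  qed
  ultimately show ?thesis using assms y1 y2 by blast
qed

end

text \<open>\<open>in_kernel\<close> describes \<open>E\<^sup>1\<close> and \<open>nonsing_red\<close> describes \<open>E\<^sup>0\<close>.\<close>

fun in_kernel :: "padic ecpt \<Rightarrow> bool" where
  "in_kernel Inf = True" | "in_kernel (Aff x y) = (\<not> vge 0 x)"

fun nonsing_red :: "(nat \<Rightarrow> padic) \<Rightarrow> padic ecpt \<Rightarrow> bool" where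
  "nonsing_red c Inf = True" | "nonsing_red c (Aff x y) = (vge 0 x \<longrightarrow> \<not> (vge 1 (dFx c x y) \<and> vge 1 (dFy c x y)))"

text \<open>Intended for integral points, whose reductions can be compared by coordinates; points of
  the kernel are treated separately.\<close>

fun same_red :: "padic ecpt \<Rightarrow> padic ecpt \<Rightarrow> bool" where
  "same_red (Aff x1 y1) (Aff x2 y2) = (vge 1 (x1 - x2) \<and> vge 1 (y1 - y2))" | "same_red _ _ = False"

section \<open>Reduction and the addition law\<close>

lemma in_kernel_neg [simp]: "in_kernel (ec_neg c P) = in_kernel P" by (cases P) auto

lemma ec_neg_ec_neg [simp]: "ec_neg c (ec_neg c P) = P" by (cases P) auto

lemma in_kernel_nonsing_red: "in_kernel P \<Longrightarrow> nonsing_red c P" by (cases P) auto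

text \<open>The involution y -> - y - a_1 x - a_3 preserves the curve and hence its singular points.
  The second point is only required to be opposite modulo p, because this is what
  \<open>one_kernel\<close> delivers.\<close>

lemma opposite_nonsing_red:
  assumes "icoef c" "vge 0 x1" "vge 0 x2" "vge 0 y1" "vge 0 y2" "vge 1 (x1 - x2)" "vge 1 (y1 + y2 + c 1 * x2 + c 3)"
     "vge 1 (dFx c x1 y1)" "vge 1 (dFy c x1 y1)"
  shows "vge 1 (dFx c x2 y2)" "vge 1 (dFy c x2 y2)"
proof -
  note cs = icoefD[OF assms(1)]
  have "dFy c x2 y2 = (y1 + y2 + c 1 * x2 + c 3) * 2 - dFy c x1 y1 + (x1 - x2) * c 1"
    unfolding dFy_def by (simp add: algebra_simps)
  also have "vge 1 \<dots>" using assms cs by - (assumption | rule vge_rules)+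
  finally show "vge 1 (dFy c x2 y2)" .
  have "dFx c x2 y2 = dFx c x1 y1 + (y1 + y2 + c 1 * x2 + c 3) * c 1 - dFy c x1 y1 * c 1
     + (x1 - x2) * (c 1 * c 1 + 3 * (x1 + x2) + 2 * c 2)"
    unfolding dFx_def dFy_def by (simp add: algebra_simps)
  also have "vge 1 \<dots>" using assms cs by - (assumption | rule vge_rules)+
  finally show "vge 1 (dFx c x2 y2)" .
qed

lemma nonsing_red_neg: assumes "icoef c" "ec_pt c P" "nonsing_red c P" shows "nonsing_red c (ec_neg c P)"
proof (cases P)
  case (Aff x y)
  define y' where "y' = - y - c 1 * x - c 3"
  have "\<not> (vge 1 (dFx c x y') \<and> vge 1 (dFy c x y'))" if "vge 0 x"
  proof
    assume a: "vge 1 (dFx c x y') \<and> vge 1 (dFy c x y')"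
    have y: "vge 0 y" "vge 0 y'" using integral_y[OF assms(1) _ that] on_curve_neg[of c x y] assms(2) Aff unfolding y'_def by auto
    have "vge 1 (dFx c x y)" "vge 1 (dFy c x y)"
      using opposite_nonsing_red[OF assms(1) that that y(2,1)] a by (simp_all add: y'_def)
    thus False using assms(3) that Aff by simp
  qed
  thus ?thesis using Aff by (simp add: y'_def)
qed simp

text \<open>Suppose that the third point on the line is singular modulo p. If both summands are
  integral, one of them has the same reduction; if exactly one is, it is opposite to the third point
  modulo p; if none is, the third point lies in the kernel. Each case is a contradiction.\<close>

lemma nonsing_red_add: assumes ic: "icoef c" and on: "ec_pt c P" "ec_pt c Q" and ns: "nonsing_red c P" "nonsing_red c Q" shows "nonsing_red c (ec_add c P Q)"
  using on
proof (cases rule: ec_add_cases)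
  case (4 l n x1 x2 x3)
  let ?y1 = "l * x1 + n" and ?y2 = "l * x2 + n" and ?y3 = "l * x3 + n"
  interpret L: collinear c l n x1 x2 x3 ?y1 ?y2 ?y3 by unfold_locales (use 4 ic in auto)
  interpret L12: collinear c l n x2 x1 x3 ?y2 ?y1 ?y3 by (rule L.collinear_12)
  interpret L13: collinear c l n x1 x3 x2 ?y1 ?y3 ?y2 by (rule L.collinear_23)
  interpret L23: collinear c l n x2 x3 x1 ?y2 ?y3 ?y1 by (rule L12.collinear_23)
  have "nonsing_red c (Aff x3 ?y3)"
  proof (rule ccontr)
    assume "\<not> nonsing_red c (Aff x3 ?y3)"
    hence s: "vge 0 x3" "vge 1 (dFx c x3 ?y3)" "vge 1 (dFy c x3 ?y3)" by auto
    have op: False if "vge 0 x" "vge 0 (l * x + n)" "vge 1 (x3 - x)" "vge 1 (?y3 + (l * x + n) + c 1 * x + c 3)" 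
      "nonsing_red c (Aff x (l * x + n))" for x
      using opposite_nonsing_red[OF ic s(1) that(1) L.int_y3[OF s(1)] that(2,3,4) s(2,3)] that(1,5) by simp
    consider "vge 0 x1" "vge 0 x2" | "vge 0 x1" "\<not> vge 0 x2" | "\<not> vge 0 x1" "vge 0 x2" | "\<not> vge 0 x1" "\<not> vge 0 x2" by blast
    thus False
    proof cases
      case 1
      thus False using L.singular_third s ns 4 by auto
    next
      case 2
      have "collinear c l n x3 x1 x2 ?y3 ?y1 ?y2" by (rule L13.collinear_12)
      from collinear.one_kernel[OF this s(1) 2] show False using op[of x1] 2 ns 4 L.all_y by auto
    next
      case 3
      have "collinear c l n x3 x2 x1 ?y3 ?y2 ?y1" by (rule L23.collinear_12)
      from collinear.one_kernel[OF this s(1) 3(2,1)] show False using op[of x2] 3 ns 4 L.all_y by auto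
    next
      case 4
      thus False using L.two_kernel s by blast
    qed
  qed
  moreover have "ec_pt c (Aff x3 ?y3)" using L.on3 by simp
  ultimately show ?thesis unfolding 4(4) by (intro nonsing_red_neg ic)
qed (use ns in simp_all)

text \<open>The line through P and -Q has its third point in the kernel exactly if P and -Q are
  opposite modulo p. Non-singularity of P is used from right to left: an integral third point would
  make its reduction singular.\<close>

lemma in_kernel_diff_iff:
  assumes ic: "icoef c" and on: "ec_pt c P" "ec_pt c Q" and ns: "nonsing_red c P" and int: "\<not> in_kernel P" "\<not> in_kernel Q"
  shows "in_kernel (ec_add c P (ec_neg c Q)) \<longleftrightarrow> same_red P Q"
  using on(1) ec_pt_neg[OF on(2)]
proof (cases rule: ec_add_cases)
  case 1 thus ?thesis using int by simp
next
  case 2 thus ?thesis using int by (cases Q) simp_all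
next
  case 3
  hence "Q = P" by (metis ec_neg_ec_neg)
  thus ?thesis using 3 int by (cases P) auto
next
  case (4 l n x1 x2 x3)
  let ?y1 = "l * x1 + n" and ?y2 = "l * x2 + n" and ?y3 = "l * x3 + n"
  interpret L: collinear c l n x1 x2 x3 ?y1 ?y2 ?y3 by unfold_locales (use 4 ic in auto)
  have Q: "Q = Aff x2 (- ?y2 - c 1 * x2 - c 3)" using 4(2) ec_neg_ec_neg[of c Q] by simp
  have i: "vge 0 x1" "vge 0 x2" using int 4(1) Q by auto
  show ?thesis
  proof
    assume "in_kernel (ec_add c P (ec_neg c Q))"
    hence "\<not> vge 0 x3" unfolding 4(4) by simp
    from L.one_kernel[OF i this] show "same_red P Q" unfolding Q 4(1) by (simp add: algebra_simps)
  next
    assume "same_red P Q"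
    hence cg: "vge 1 (x1 - x2)" "vge 1 (?y1 + ?y2 + c 1 * x2 + c 3)" unfolding Q 4(1) by (simp_all add: algebra_simps)
    have "?y1 + ?y2 + c 1 * x1 + c 3 = (?y1 + ?y2 + c 1 * x2 + c 3) + (x1 - x2) * c 1" by (simp add: algebra_simps)
    also have "vge 1 \<dots>" using cg L.cs by - (assumption | rule vge_rules)+
    finally have cg': "vge 1 (?y1 + ?y2 + c 1 * x1 + c 3)" .
    have "\<not> vge 0 x3" using L.opposite_singular[OF i _ cg(1) cg'] ns i unfolding 4(1) by auto
    thus "in_kernel (ec_add c P (ec_neg c Q))" unfolding 4(4) by simp
  qed
qed

section \<open>Changes of variables\<close>

text \<open>One statement covers both uses: the equation of the curve is quadratic in y, with
  \<open>c3 = 0\<close>, and cubic in x.\<close>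

lemma hensel_cubic:
  fixes c0 c1 c2 c3 x0 :: rat
  defines "F \<equiv> \<lambda>x::padic. of_rat c0 + of_rat c1 * x + of_rat c2 * x * x + of_rat c3 * x * x * x"
  assumes ci: "rge pp 0 c0" "rge pp 0 c1" "rge pp 0 c2" "rge pp 0 c3" and x0: "rge pp 0 x0"
    and f0: "rge pp 1 (c0 + c1 * x0 + c2 * x0 * x0 + c3 * x0 * x0 * x0)"
    and d0: "\<not> rge pp 1 (c1 + 2 * c2 * x0 + 3 * c3 * x0 * x0)"
  shows "\<exists>x. F x = 0 \<and> vge 1 (x - of_rat x0)"
proof -
  define f where "f = (\<lambda>x. c0 + c1 * x + c2 * x * x + c3 * x * x * x)"
  define d where "d = c1 + 2 * c2 * x0 + 3 * c3 * x0 * x0"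
  define u where "u = inverse d"
  have d: "d \<noteq> 0" "\<not> rge pp 1 d" using d0 by (auto simp: d_def)
  have ud: "d * u = 1" using d by (simp add: u_def)
  have u: "rge pp 0 u" using rge_inverse[OF prime_pp d(2)] by (simp add: u_def)
  have nm: "rge pp 0 (numeral k)" for k using rge_of_int[OF prime_pp, of "numeral k"] by simp
  have m0: "rge pp 0 (x * y)" if "rge pp 0 x" "rge pp 0 y" for x y using rge_mult[OF prime_pp that] by simp
  have m1: "rge pp 1 (x * y)" if "rge pp 1 x" "rge pp 0 y" for x y using rge_mult[OF prime_pp that] by simp
  note rs = rge_add[OF prime_pp] rge_diff[OF prime_pp] m1 m0 nm rge_minus[OF prime_pp, THEN iffD2]
  have di: "rge pp 0 d" unfolding d_def using ci x0 by - (assumption | rule rs)+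
  show ?thesis
  proof (rule contraction_root[of x0 f u F])
    show "rge pp 0 x0" by fact
    show "rge pp 1 (f x0)" using f0 by (simp add: f_def)
    show "rge pp 0 u" by fact
    fix x m assume h: "rge pp m (u * f x)"
    have "f x = d * (u * f x)" using ud by (simp add: mult.assoc[symmetric])
    also have "rge pp m \<dots>" using rge_mult[OF prime_pp di h] by simp
    finally show "rge pp m (f x)" .
  next
    fix x y m assume h: "rge pp 0 x" "rge pp 0 y" "rge pp 1 (x - x0)" "rge pp 1 (y - x0)" "rge pp m (x - y)"
    \<comment> \<open>The divided difference of \<open>f\<close> at x and y is congruent to the
      derivative \<open>d\<close> at \<open>x0\<close>, because all three arguments agree modulo p.
      With u = 1 / d this is the gain of one digit.\<close>
    have "x - y - u * (f x - f y) = (x - y) * (u * (d - (c1 + c2 * (x + y) + c3 * (x * x + x * y + y * y))))"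
      using ud unfolding f_def by Groebner_Basis.algebra
    moreover have "rge pp 1 (u * (d - (c1 + c2 * (x + y) + c3 * (x * x + x * y + y * y))))"
    proof -
      have "u * (d - (c1 + c2 * (x + y) + c3 * (x * x + x * y + y * y)))
         = (x - x0) * (- (u * (c2 + c3 * (x + x0 + y)))) + (y - x0) * (- (u * (c2 + c3 * (y + 2 * x0))))"
        unfolding d_def by (simp add: algebra_simps)
      also have "rge pp 1 \<dots>" using h ci x0 u by - (assumption | rule rs)+
      finally show ?thesis .
    qed
    ultimately show "rge pp (m + 1) (x - y - u * (f x - f y))" using rge_mult[OF prime_pp h(5)] by simp
  next
    fix S assume S: "padic_cauchy pp S"
    note cc = cauchy_const[OF prime_pp] cauchy_add[OF prime_pp] cauchy_mult[OF prime_pp] S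
    show "F (abs_padic S) = abs_padic (\<lambda>n. f (S n)) \<and> padic_cauchy pp (\<lambda>n. f (S n))"
    proof
      show c: "padic_cauchy pp (\<lambda>n. f (S n))" unfolding f_def by (intro cc)
      have t: "abs_padic A * abs_padic B = abs_padic (\<lambda>n. A n * B n)" if "padic_cauchy pp A" "padic_cauchy pp B" for A B
        using that by (simp add: times_padic.abs_eq padic_rel_refl_iff)
      have p: "abs_padic A + abs_padic B = abs_padic (\<lambda>n. A n + B n)" if "padic_cauchy pp A" "padic_cauchy pp B" for A B
        using that by (simp add: plus_padic.abs_eq padic_rel_refl_iff)
      show "F (abs_padic S) = abs_padic (\<lambda>n. f (S n))"
        unfolding F_def f_def of_rat_padic const_padic.abs_eq by (simp add: t p cc)
    qed
  qed
qed

section \<open>Admissible substitutions and the addition law\<close>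

definition chg :: "(nat \<Rightarrow> 'a::field) \<Rightarrow> (nat \<Rightarrow> 'a) \<Rightarrow> 'a \<Rightarrow> 'a \<Rightarrow> 'a \<Rightarrow> 'a \<Rightarrow> bool" where
  "chg a b u r s t \<longleftrightarrow> u \<noteq> 0 \<and>
     u * b 1 = a 1 + 2 * s \<and>
     u ^ 2 * b 2 = a 2 - s * a 1 + 3 * r - s ^ 2 \<and>
     u ^ 3 * b 3 = a 3 + r * a 1 + 2 * t \<and>
     u ^ 4 * b 4 = a 4 - s * a 3 + 2 * r * a 2 - (t + r * s) * a 1 + 3 * r ^ 2 - 2 * s * t \<and>
     u ^ 6 * b 6 = a 6 + r * a 4 + r ^ 2 * a 2 + r ^ 3 - t * a 3 - t ^ 2 - r * t * a 1"

lemma models_iso_chg: "models_iso a b \<longleftrightarrow> (\<exists>u r s t. chg a b u r s t)"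
  by (simp add: models_iso_def chg_def)

lemma chg_of_rat: assumes "chg a b u r s t"
  shows "chg (\<lambda>i. of_rat (a i) :: 'a::field_char_0) (\<lambda>i. of_rat (b i)) (of_rat u) (of_rat r) (of_rat s) (of_rat t)"
proof -
  note a = assms[unfolded chg_def]
  have e: "of_rat (u * b 1) = (of_rat (a 1 + 2 * s) :: 'a)" "of_rat (u ^ 2 * b 2) = (of_rat (a 2 - s * a 1 + 3 * r - s ^ 2) :: 'a)"
    "of_rat (u ^ 3 * b 3) = (of_rat (a 3 + r * a 1 + 2 * t) :: 'a)"
    "of_rat (u ^ 4 * b 4) = (of_rat (a 4 - s * a 3 + 2 * r * a 2 - (t + r * s) * a 1 + 3 * r ^ 2 - 2 * s * t) :: 'a)"
    "of_rat (u ^ 6 * b 6) = (of_rat (a 6 + r * a 4 + r ^ 2 * a 2 + r ^ 3 - t * a 3 - t ^ 2 - r * t * a 1) :: 'a)"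
    using a by simp_all
  show ?thesis unfolding chg_def using a e[unfolded of_rat_add of_rat_diff of_rat_mult of_rat_power of_rat_numeral_eq]
    by simp
qed

fun chg_pt :: "'a::field \<Rightarrow> 'a \<Rightarrow> 'a \<Rightarrow> 'a \<Rightarrow> 'a ecpt \<Rightarrow> 'a ecpt" where
  "chg_pt u r s t Inf = Inf" | "chg_pt u r s t (Aff x y) = Aff (u ^ 2 * x + r) (u ^ 3 * y + s * u ^ 2 * x + t)"

lemma on_curve_chg: assumes "chg a b u r s t" 
  shows "on_curve a (u ^ 2 * x + r) (u ^ 3 * y + s * u ^ 2 * x + t) \<longleftrightarrow> on_curve b x y"
proof -
  let ?X = "u ^ 2 * x + r" and ?Y = "u ^ 3 * y + s * u ^ 2 * x + t"
  have "(?Y * ?Y + a 1 * ?X * ?Y + a 3 * ?Y) - (?X * ?X * ?X + a 2 * ?X * ?X + a 4 * ?X + a 6)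
    = u ^ 6 * ((y * y + b 1 * x * y + b 3 * y) - (x * x * x + b 2 * x * x + b 4 * x + b 6))"
    using assms unfolding chg_def by Groebner_Basis.algebra
  moreover have "u ^ 6 \<noteq> 0" using assms by (simp add: chg_def)
  ultimately show ?thesis unfolding on_curve_def by (metis mult_eq_0_iff right_minus_eq)
qed

lemma chg_pt_neg: assumes "chg a b u r s t" shows "chg_pt u r s t (ec_neg b P) = ec_neg a (chg_pt u r s t P)"
proof (cases P)
  case (Aff x y)
  have "u ^ 3 * (- y - b 1 * x - b 3) + s * u ^ 2 * x + t
     = - (u ^ 3 * y + s * u ^ 2 * x + t) - a 1 * (u ^ 2 * x + r) - a 3"
    using assms unfolding chg_def by Groebner_Basis.algebra
  thus ?thesis using Aff by simp
qed simp

text \<open>The new slope and intercept come from rewriting u^3 (l x + n) + s u^2 x + t as a linear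
  expression in u^2 x + r. The elementary symmetric functions of the new roots are expanded first in
  those of the old ones.\<close>

lemma line_roots_chg: assumes "chg a b u r s t" "line_roots b l n x1 x2 x3"
  shows "line_roots a (u * l + s) (u ^ 3 * n + t - r * (u * l + s)) (u ^ 2 * x1 + r) (u ^ 2 * x2 + r) (u ^ 2 * x3 + r)"
proof -
  note c = assms(1)[unfolded chg_def] and v = assms(2)[unfolded line_roots_def]
  have 1: "(u ^ 2 * x1 + r) + (u ^ 2 * x2 + r) + (u ^ 2 * x3 + r) = (u * l + s) * (u * l + s) + a 1 * (u * l + s) - a 2"
    using c v by Groebner_Basis.algebra
  define L where "L = u * l + s"
  define N where "N = u ^ 3 * n + t - r * (u * l + s)"
  have "(u ^ 2 * x1 + r) * (u ^ 2 * x2 + r) + (u ^ 2 * x1 + r) * (u ^ 2 * x3 + r) + (u ^ 2 * x2 + r) * (u ^ 2 * x3 + r)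
    = u ^ 4 * (x1 * x2 + x1 * x3 + x2 * x3) + 2 * r * (u ^ 2 * (x1 + x2 + x3)) + 3 * r ^ 2"
    by Groebner_Basis.algebra
  also have "\<dots> = a 4 - 2 * L * N - a 1 * N - a 3 * L"
    using c v unfolding L_def N_def by Groebner_Basis.algebra
  finally have 2: "(u ^ 2 * x1 + r) * (u ^ 2 * x2 + r) + (u ^ 2 * x1 + r) * (u ^ 2 * x3 + r) + (u ^ 2 * x2 + r) * (u ^ 2 * x3 + r)
    = a 4 - 2 * L * N - a 1 * N - a 3 * L" .
  have "(u ^ 2 * x1 + r) * (u ^ 2 * x2 + r) * (u ^ 2 * x3 + r)
    = u ^ 6 * (x1 * x2 * x3) + r * (u ^ 4 * (x1 * x2 + x1 * x3 + x2 * x3)) + r ^ 2 * (u ^ 2 * (x1 + x2 + x3)) + r ^ 3"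
    by Groebner_Basis.algebra
  also have "\<dots> = N * N + a 3 * N - a 6"
    using c v unfolding L_def N_def by Groebner_Basis.algebra
  finally show ?thesis using 1 2 unfolding line_roots_def L_def N_def by blast
qed

text \<open>Converse to \<open>ec_add_line\<close>: any line with the right roots computes the sum,
  because the line is determined by the two points.\<close>

lemma ec_add_line_roots:
  assumes v: "line_roots c l n x1 x2 x3" and no: "\<not> (x1 = x2 \<and> (l * x1 + n) + (l * x2 + n) + c 1 * x2 + c 3 = 0)"
  shows "ec_add c (Aff x1 (l * x1 + n)) (Aff x2 (l * x2 + n)) = ec_neg c (Aff x3 (l * x3 + n))"
proof -
  have on: "on_curve c x1 (l * x1 + n)" "on_curve c x2 (l * x2 + n)" using line_roots_on_curve v line_roots_sym by blast+
  obtain l' n' x3' where a: "l * x1 + n = l' * x1 + n'" "l * x2 + n = l' * x2 + n'" "line_roots c l' n' x1 x2 x3'"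
    "ec_add c (Aff x1 (l * x1 + n)) (Aff x2 (l * x2 + n)) = ec_neg c (Aff x3' (l' * x3' + n'))"
    using ec_add_line[OF on no] .
  have l: "l = l'"
  proof (cases "x1 = x2")
    case False
    have "(l - l') * (x1 - x2) = 0" using a(1,2) by Groebner_Basis.algebra
    thus ?thesis using False by simp
  next
    case True
    \<comment> \<open>For a double root the Vieta relations fix the slope only up to the factor F_y,
      which is nonzero since the point is not its own negative.\<close>
    have "(l - l') * (2 * (l * x1 + n) + c 1 * x1 + c 3) = 0"
      using v a(1,3) unfolding line_roots_def True by Groebner_Basis.algebra
    moreover have "2 * (l * x1 + n) + c 1 * x1 + c 3 \<noteq> 0" using no True by (simp add: algebra_simps)
    ultimately show ?thesis by simp
  qed
  hence n: "n = n'" using a(1) by simp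
  have "x3 = x3'" using v a(3) unfolding line_roots_def l by Groebner_Basis.algebra
  thus ?thesis using a(4) l n by simp
qed

text \<open>An affine substitution maps lines to lines and opposite points to opposite points. The
  sum is transported with its line, so the quotients in the addition formulas are never
  compared.\<close>

lemma chg_pt_add: assumes c: "chg a b u r s t" and on: "ec_pt b P" "ec_pt b Q"
  shows "chg_pt u r s t (ec_add b P Q) = ec_add a (chg_pt u r s t P) (chg_pt u r s t Q)"
proof -
  have opp: "ec_add a (chg_pt u r s t R) (ec_neg a (chg_pt u r s t R)) = Inf" for R
    by (cases "chg_pt u r s t R") (simp_all add: ec_add_def)
  show ?thesis
  proof (cases "Q = ec_neg b P")
    case True
    moreover have "ec_add b P (ec_neg b P) = Inf" by (cases P) (simp_all add: ec_add_def)
    ultimately show ?thesis using opp by (simp add: chg_pt_neg[OF c])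
  next
    case False
    from on show ?thesis
    proof (cases rule: ec_add_cases)
      case 1 thus ?thesis by (simp add: ec_add_def)
    next
      case 2 thus ?thesis by (cases P) (simp_all add: ec_add_def)
    next
      case 3 thus ?thesis using False by simp
    next
      case (4 l n x1 x2 x3)
      define L where "L = u * l + s"
      define N where "N = u ^ 3 * n + t - r * (u * l + s)"
      have ch: "chg_pt u r s t (Aff x (l * x + n)) = Aff (u ^ 2 * x + r) (L * (u ^ 2 * x + r) + N)" for x
        by (simp add: L_def N_def algebra_simps power2_eq_square power3_eq_cube)
      have u: "u \<noteq> 0" using c by (simp add: chg_def)
      have no: "\<not> (u ^ 2 * x1 + r = u ^ 2 * x2 + r \<and>
          (L * (u ^ 2 * x1 + r) + N) + (L * (u ^ 2 * x2 + r) + N) + a 1 * (u ^ 2 * x2 + r) + a 3 = 0)"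
      proof
        assume A: "u ^ 2 * x1 + r = u ^ 2 * x2 + r \<and>
          (L * (u ^ 2 * x1 + r) + N) + (L * (u ^ 2 * x2 + r) + N) + a 1 * (u ^ 2 * x2 + r) + a 3 = 0"
        hence x: "x1 = x2" using u by simp
        have "u ^ 3 * ((l * x1 + n) + (l * x2 + n) + b 1 * x2 + b 3) = 0"
          using A c unfolding chg_def L_def N_def x by Groebner_Basis.algebra
        hence "(l * x1 + n) + (l * x2 + n) + b 1 * x2 + b 3 = 0" using u by simp
        moreover have "y2 = - y1 - b 1 * x1 - b 3" if "y1 + y2 + b 1 * x2 + b 3 = 0" for y1 y2
        proof -
          have "y2 - (- y1 - b 1 * x1 - b 3) = 0" using that x by (simp add: algebra_simps)
          thus ?thesis by simp
        qed
        ultimately have "l * x2 + n = - (l * x1 + n) - b 1 * x1 - b 3" by blast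
        thus False using False 4(1,2) x by simp
      qed
      have "ec_add a (chg_pt u r s t P) (chg_pt u r s t Q) = ec_neg a (Aff (u ^ 2 * x3 + r) (L * (u ^ 2 * x3 + r) + N))"
        unfolding 4(1,2) ch
        by (rule ec_add_line_roots[OF _ no]) (use line_roots_chg[OF c 4(3)] in \<open>simp add: L_def N_def\<close>)
      thus ?thesis unfolding 4(4) chg_pt_neg[OF c] ch by simp
    qed
  qed
qed

lemma chg_pt_bij: assumes c: "chg a b u r s t" shows "bij_betw (chg_pt u r s t) {P. ec_pt b P} {P. ec_pt a P}"
proof -
  have u: "u \<noteq> 0" using c by (simp add: chg_def)
  have on: "ec_pt a (chg_pt u r s t P) \<longleftrightarrow> ec_pt b P" for P by (cases P) (simp_all add: on_curve_chg[OF c])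
  have "inj (chg_pt u r s t)"
  proof (rule injI)
    fix P Q assume "chg_pt u r s t P = chg_pt u r s t Q" thus "P = Q"
      using u by (cases P; cases Q) auto
  qed
  moreover have "\<exists>P. Q = chg_pt u r s t P" for Q
  proof (cases Q)
    case Inf thus ?thesis by (auto intro: exI[of _ Inf])
  next
    case (Aff x y)
    show ?thesis
      by (rule exI[of _ "Aff ((x - r) / u ^ 2) ((y - s * (x - r) - t) / u ^ 3)"]) (use u Aff in simp)
  qed
  hence "Q \<in> chg_pt u r s t ` {P. ec_pt b P}" if "ec_pt a Q" for Q using that on by (metis image_eqI mem_Collect_eq)
  ultimately show ?thesis unfolding bij_betw_def using on by (auto intro: inj_on_subset)
qed

text \<open>The two hypotheses on \<open>u\<close> together say v(u) = k.\<close>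

lemma vge_scale2: assumes u: "vge k u" "\<not> vge (k + 1) u" shows "vge (m + 2 * k) (u ^ 2 * x) \<longleftrightarrow> vge m x"
proof
  assume "vge m x"
  from vge_mult[OF vge_mult[OF u(1) u(1)] this] show "vge (m + 2 * k) (u ^ 2 * x)"
    by (simp add: power2_eq_square algebra_simps)
next
  assume h: "vge (m + 2 * k) (u ^ 2 * x)"
  have i: "vge (- k) (inverse u)" using vge_inverse[OF u(2)] by simp
  have "u \<noteq> 0" using u(2) by auto
  hence "inverse u * u = 1" by simp
  hence "inverse u * inverse u * (u ^ 2 * x) = x" by Groebner_Basis.algebra
  moreover have "vge m (inverse u * inverse u * (u ^ 2 * x))" using vge_mult[OF vge_mult[OF i i] h] by simp
  ultimately show "vge m x" by (simp only:)
qed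

section \<open>Invariants and the discriminant\<close>

definition B2 :: "(nat \<Rightarrow> 'a::field) \<Rightarrow> 'a" where "B2 a = a 1 ^ 2 + 4 * a 2"
definition B4 :: "(nat \<Rightarrow> 'a::field) \<Rightarrow> 'a" where "B4 a = 2 * a 4 + a 1 * a 3"
definition B6 :: "(nat \<Rightarrow> 'a::field) \<Rightarrow> 'a" where "B6 a = a 3 ^ 2 + 4 * a 6"
definition B8 :: "(nat \<Rightarrow> 'a::field) \<Rightarrow> 'a" where
  "B8 a = a 1 ^ 2 * a 6 + 4 * a 2 * a 6 - a 1 * a 3 * a 4 + a 2 * a 3 ^ 2 - a 4 ^ 2"

text \<open>Only u and r occur, so r can be bounded and discriminants compared without knowledge of
  s and t.\<close>

lemma chg_B: assumes "chg a b u r s t"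
  shows "u ^ 2 * B2 b = B2 a + 12 * r" "u ^ 4 * B4 b = B4 a + r * B2 a + 6 * r ^ 2"
    "u ^ 6 * B6 b = B6 a + 2 * r * B4 a + r ^ 2 * B2 a + 4 * r ^ 3"
    "u ^ 8 * B8 b = B8 a + 3 * r * B6 a + 3 * r ^ 2 * B4 a + r ^ 3 * B2 a + 3 * r ^ 4"
  using assms unfolding chg_def B2_def B4_def B6_def B8_def by Groebner_Basis.algebra+

lemma B8_eq: "4 * B8 a = B2 a * B6 a - B4 a ^ 2"
  unfolding B2_def B4_def B6_def B8_def by Groebner_Basis.algebra

definition wdisc :: "(nat \<Rightarrow> 'a::field) \<Rightarrow> 'a" where
  "wdisc a = - (B2 a ^ 2 * B8 a) - 8 * B4 a ^ 3 - 27 * B6 a ^ 2 + 9 * B2 a * B4 a * B6 a"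

lemma disc_wdisc: "disc a = wdisc a"
  by (simp add: disc_def wdisc_def Let_def B2_def B4_def B6_def B8_def)

lemma wdisc_of_rat: "wdisc (\<lambda>i. of_rat (a i) :: 'a::field_char_0) = of_rat (wdisc a)"
  by (simp add: wdisc_def B2_def B4_def B6_def B8_def of_rat_add of_rat_diff of_rat_minus of_rat_mult of_rat_power)

text \<open>After expansion all powers of r have to cancel. Besides the transformation formulas this
  uses only the relation 4 b_8 = b_2 b_6 - b_4^2. The exponent here is the source of the 12 in the
  definition of k.\<close>

lemma chg_wdisc: assumes "chg a b u r s t" shows "wdisc a = u ^ 12 * wdisc b"
proof -
  define p2 p4 p6 p8 where "p2 = B2 a" and "p4 = B4 a" and "p6 = B6 a" and "p8 = B8 a"
  have 8: "4 * p8 = p2 * p6 - p4 ^ 2" unfolding p2_def p4_def p6_def p8_def by (rule B8_eq)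
  have "u ^ 12 * wdisc b = - ((u ^ 2 * B2 b) ^ 2 * (u ^ 8 * B8 b)) - 8 * (u ^ 4 * B4 b) ^ 3 - 27 * (u ^ 6 * B6 b) ^ 2
     + 9 * (u ^ 2 * B2 b) * (u ^ 4 * B4 b) * (u ^ 6 * B6 b)"
    unfolding wdisc_def by Groebner_Basis.algebra
  also have "\<dots> = - ((p2 + 12 * r) ^ 2 * (p8 + 3 * r * p6 + 3 * r ^ 2 * p4 + r ^ 3 * p2 + 3 * r ^ 4))
     - 8 * (p4 + r * p2 + 6 * r ^ 2) ^ 3 - 27 * (p6 + 2 * r * p4 + r ^ 2 * p2 + 4 * r ^ 3) ^ 2
     + 9 * (p2 + 12 * r) * (p4 + r * p2 + 6 * r ^ 2) * (p6 + 2 * r * p4 + r ^ 2 * p2 + 4 * r ^ 3)"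
    unfolding chg_B[OF assms] p2_def p4_def p6_def p8_def ..
  also have "\<dots> = - (p2 ^ 2 * p8) - 8 * p4 ^ 3 - 27 * p6 ^ 2 + 9 * p2 * p4 * p6"
    using 8 by Groebner_Basis.algebra
  finally show ?thesis by (simp add: wdisc_def p2_def p4_def p6_def p8_def)
qed

text \<open>The three conditions are solved for a_3, a_4 and a_6, which makes the discriminant
  vanish identically in a_1, a_2 and the coordinates of the point.\<close>

lemma sing_pt_wdisc: assumes "on_curve c x y" "sing_pt c x y" shows "wdisc c = 0"
proof -
  have c3: "c 3 = - 2 * y - c 1 * x" and c4: "c 4 = c 1 * y - 3 * x * x - 2 * c 2 * x"
    using assms(2) unfolding sing_pt_def by Groebner_Basis.algebra+
  have c6: "c 6 = y * y + c 1 * x * y + c 3 * y - (x * x * x + c 2 * x * x + c 4 * x)"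
    using assms(1) unfolding on_curve_def by Groebner_Basis.algebra
  define p q where "p = c 1" and "q = c 2"
  show ?thesis unfolding wdisc_def B2_def B4_def B6_def B8_def c6 c4 c3 p_def[symmetric] q_def[symmetric]
    by Groebner_Basis.algebra
qed

text \<open>If \<open>r\<close> were not integral, the transformation formulas of \<open>b\<^sub>6\<close> and \<open>b\<^sub>8\<close>, with leading terms
  \<open>4 r\<^sup>3\<close> and \<open>3 r\<^sup>4\<close>, would put both 4 and 3 into the maximal ideal.\<close>

lemma chg_integral: 
  assumes c: "chg a b u r s t" and ia: "icoef a" and ib: "icoef b" and u: "vge 0 u"
  shows "vge 0 r" "vge 0 s" "vge 0 t"
proof -
  note as = icoefD[OF ia] icoefD[OF ib]
  have pw: "vge 0 (x ^ k)" if "vge 0 x" for x k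
    by (induction k) (use that in \<open>auto intro: vge_mult_0\<close>)
  note rs = vge_rules pw
  have B: "vge 0 (B2 a)" "vge 0 (B4 a)" "vge 0 (B6 a)" "vge 0 (B8 a)" "vge 0 (B6 b)" "vge 0 (B8 b)"
    unfolding B2_def B4_def B6_def B8_def using as by - (assumption | rule rs)+
  show r: "vge 0 r"
  proof (rule ccontr)
    assume n: "\<not> vge 0 r"
    define z where "z = inverse r"
    have z: "vge 1 z" "r * z = 1" using vge_inverse_1[OF n] not_vge_nonzero[OF n] by (simp_all add: z_def)
    have 4: "4 = z * (z * z * (u ^ 6 * B6 b - B6 a) - 2 * z * B4 a - B2 a)"
    proof -
      have "z * (z * z * (u ^ 6 * B6 b - B6 a) - 2 * z * B4 a - B2 a) = 2 * B4 a * z * z * (r * z)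
         + B2 a * z * (r * z) ^ 2 + 4 * (r * z) ^ 3 - 2 * z * z * B4 a - z * B2 a"
        unfolding chg_B(3)[OF c] by Groebner_Basis.algebra
      thus ?thesis unfolding z(2) by simp
    qed
    have 3: "3 = z * (z * z * z * (u ^ 8 * B8 b - B8 a) - 3 * z * z * B6 a - 3 * z * B4 a - B2 a)"
    proof -
      have "z * (z * z * z * (u ^ 8 * B8 b - B8 a) - 3 * z * z * B6 a - 3 * z * B4 a - B2 a)
        = 3 * B6 a * z * z * z * (r * z) + 3 * B4 a * z * z * (r * z) ^ 2 + B2 a * z * (r * z) ^ 3 + 3 * (r * z) ^ 4
         - 3 * z * z * z * B6 a - 3 * z * z * B4 a - z * B2 a"
        unfolding chg_B(4)[OF c] by Groebner_Basis.algebra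
      thus ?thesis unfolding z(2) by simp
    qed
    have "vge 1 4" by (subst 4) (insert z vge_1_0[OF z(1)] B u, (assumption | rule rs)+)
    moreover have "vge 1 3" by (subst 3) (insert z vge_1_0[OF z(1)] B u, (assumption | rule rs)+)
    ultimately have "vge 1 (4 - 3)" by (rule vge_diff)
    thus False by simp
  qed
  show s: "vge 0 s"
  proof (rule vge_monic2)
    show "s * s + a 1 * s = a 2 + 3 * r - u ^ 2 * b 2" using c unfolding chg_def by (simp add: algebra_simps power2_eq_square)
  qed (insert as r u, (assumption | rule rs)+)
  show "vge 0 t"
  proof (rule vge_monic2)
    show "t * t + (a 3 + r * a 1) * t = a 6 + r * a 4 + r ^ 2 * a 2 + r ^ 3 - u ^ 6 * b 6"
      using c unfolding chg_def by (simp add: algebra_simps power2_eq_square)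
  qed (insert as r u, (assumption | rule rs)+)
qed

section \<open>The filtration\<close>

text \<open>\<open>v(x) \<le> - 2 n\<close> is expressed as the negation of \<open>v(x) \<ge> 1 - 2 n\<close>.\<close>

definition filt :: "(nat \<Rightarrow> padic) \<Rightarrow> nat \<Rightarrow> padic ecpt \<Rightarrow> bool" where
  "filt c n P \<longleftrightarrow> ec_pt c P \<and> (if n = 0 then nonsing_red c P else
     case P of Inf \<Rightarrow> True | Aff x y \<Rightarrow> \<not> vge (1 - 2 * int n) x)"

text \<open>The filtration asks for v(x) <= -2 and the kernel for v(x) < 0;
  \<open>not_integral_x\<close> closes the gap at -1.\<close>

lemma filt_1: assumes "icoef c" shows "filt c 1 P \<longleftrightarrow> ec_pt c P \<and> in_kernel P"
proof (cases P)
  case (Aff x y)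
  have "vge (- 1) x \<longleftrightarrow> vge 0 x" if "on_curve c x y" using not_integral_x[OF assms that] vge_mono[of 0 x "-1"] by auto
  thus ?thesis using Aff by (auto simp: filt_def)
qed (simp add: filt_def)

text \<open>Here \<open>w\<close> and \<open>v\<close> are coordinates on the model with
  coefficients u^i b_i. The identities \<open>eq\<close>, \<open>fy\<close> and \<open>fx\<close>
  exhibit v^2 = w^3, F_y = 2 v and F_x = - 3 w^2 up to terms with a factor u and a multiple of F_y,
  so the only singular reduction is w = v = 0.\<close>

lemma nonsing_red_chg:
  assumes c: "chg a b u r s t" and ia: "icoef a" and ib: "icoef b" and u: "vge 1 u" and on: "on_curve b x y"
  shows "nonsing_red a (chg_pt u r s t (Aff x y)) \<longleftrightarrow> \<not> vge 1 (u ^ 2 * x)"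
proof -
  define w v where "w = u ^ 2 * x" and "v = u ^ 3 * y"
  define x' y' where "x' = u ^ 2 * x + r" and "y' = u ^ 3 * y + s * u ^ 2 * x + t"
  note i = chg_integral[OF c ia ib vge_1_0[OF u]]
  note as = icoefD[OF ia] icoefD[OF ib]
  have on': "on_curve a x' y'" using on_curve_chg[OF c] on by (simp add: x'_def y'_def)
  have fy: "dFy a x' y' = v * 2 + u * (b 1 * w + u * u * b 3)"
    using c unfolding chg_def dFy_def x'_def y'_def w_def v_def by Groebner_Basis.algebra
  have fx: "dFx a x' y' = u * (b 1 * v - 2 * u * b 2 * w - u * u * u * b 4) - w * (3 * w) - dFy a x' y' * s"
    using c unfolding chg_def dFy_def dFx_def x'_def y'_def w_def v_def by Groebner_Basis.algebra
  have eq: "v * v = w * (w * w) + u * (u * b 2 * w * w + u * u * u * b 4 * w + u * u * u * u * u * b 6 - b 1 * w * v - u * u * b 3 * v)"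
    using on unfolding on_curve_def w_def v_def by Groebner_Basis.algebra
  show ?thesis
  proof (cases "vge 0 w")
    case False
    have "\<not> vge 0 x'"
    proof
      assume "vge 0 x'"
      hence "vge 0 (x' - r)" using i by (intro vge_diff)
      thus False using False by (simp add: x'_def w_def)
    qed
    moreover have "\<not> vge 1 w" using False vge_1_0 by blast
    ultimately show ?thesis by (simp add: x'_def w_def)
  next
    case w: True
    have x': "vge 0 x'" using w i unfolding x'_def w_def by (intro vge_add)
    have yi: "vge 0 y'" by (rule integral_y[OF ia on' x'])
    have "v = y' - s * w - t" unfolding y'_def v_def w_def by (simp add: algebra_simps)
    also have "vge 0 \<dots>" using w yi i by - (assumption | rule vge_rules)+
    finally have v: "vge 0 v" .
    note u0 = vge_1_0[OF u]
    have "(vge 1 (dFx a x' y') \<and> vge 1 (dFy a x' y')) \<longleftrightarrow> vge 1 w"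
    proof
      assume X1: "vge 1 w"
      have "vge 1 (v * v)" unfolding eq using X1 w v u u0 as by - (assumption | rule vge_rules)+
      hence Y1: "vge 1 v" using vge_prime v by blast
      have Fy: "vge 1 (dFy a x' y')" unfolding fy using w X1 Y1 v u u0 as by - (assumption | rule vge_rules)+
      have "vge 1 (dFx a x' y')" unfolding fx using w X1 Y1 v u u0 as Fy i by - (assumption | rule vge_rules)+
      thus "vge 1 (dFx a x' y') \<and> vge 1 (dFy a x' y')" using Fy by blast
    next
      assume A: "vge 1 (dFx a x' y') \<and> vge 1 (dFy a x' y')"
      hence A1: "vge 1 (dFx a x' y')" and A2: "vge 1 (dFy a x' y')" by auto
      show "vge 1 w"
      proof (rule ccontr)
        assume X1: "\<not> vge 1 w"
        \<comment> \<open>With w a unit, F_x puts 3 into the maximal ideal. By (2 v)^2 = 4 w^3 up to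
          multiples of u, F_y puts 4 there, and 4 - 3 = 1. This covers every residue
          characteristic.\<close>
        have "w * (3 * w) = u * (b 1 * v - 2 * u * b 2 * w - u * u * u * b 4) - dFx a x' y' - dFy a x' y' * s"
          using fx by (simp add: algebra_simps)
        also have "vge 1 \<dots>" using w v u u0 as A1 A2 i by - (assumption | rule vge_rules)+
        finally have "vge 1 (w * (3 * w))" .
        hence "vge 1 (3 * w)" using vge_prime[OF _ w vge_mult_0[OF vge_numeral w]] X1 by blast
        hence 3: "vge 1 3" using vge_prime[of 3 w] w X1 by auto
        have "v * 2 = dFy a x' y' - u * (b 1 * w + u * u * b 3)" using fy by simp
        also have "vge 1 \<dots>" using w v u u0 as A2 by - (assumption | rule vge_rules)+
        finally have Y2: "vge 1 (v * 2)" .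
        have "w * (w * (w * 4)) = v * 2 * (v * 2)
          - u * (u * b 2 * w * w + u * u * u * b 4 * w + u * u * u * u * u * b 6 - b 1 * w * v - u * u * b 3 * v) * 4"
          using eq by Groebner_Basis.algebra
        also have "vge 1 \<dots>" using w v u u0 as Y2 by - (assumption | rule vge_rules)+
        finally have "vge 1 (w * (w * (w * 4)))" .
        hence "vge 1 (w * (w * 4))" using vge_prime[OF _ w vge_mult_0[OF w vge_mult_0[OF w vge_numeral]]] X1 by blast
        hence "vge 1 (w * 4)" using vge_prime[OF _ w vge_mult_0[OF w vge_numeral]] X1 by blast
        hence "vge 1 4" using vge_prime[of w 4] w X1 by auto
        from vge_diff[OF this 3] show False by simp
      qed
    qed
    thus ?thesis using x' by (simp add: x'_def y'_def w_def)
  qed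
qed

lemma filt_chg:
  assumes c: "chg a b u r s t" and ia: "icoef a" and ib: "icoef b" 
    and k: "k \<ge> 1" "vge (int k) u" "\<not> vge (int k + 1) u" and on: "ec_pt b P"
  shows "filt a n (chg_pt u r s t P) \<longleftrightarrow> filt b (n + k) P"
proof (cases P)
  case Inf thus ?thesis by (simp add: filt_def)
next
  case P: (Aff x y)
  have u: "vge 1 u" by (rule vge_mono[OF k(2)]) (use k(1) in simp)
  have r: "vge 0 r" using chg_integral[OF c ia ib vge_1_0[OF u]] by simp
  have onb: "on_curve b x y" using on P by simp
  hence ona: "ec_pt a (chg_pt u r s t P)" using P by (simp add: on_curve_chg[OF c])
  have sc: "vge (1 - 2 * int n) (u ^ 2 * x) \<longleftrightarrow> vge (1 - 2 * int (n + k)) x"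
    using vge_scale2[OF k(2,3), of "1 - 2 * int (n + k)" x] by simp
  show ?thesis
  proof (cases "n = 0")
    case True
    thus ?thesis using nonsing_red_chg[OF c ia ib u onb] sc P on ona k(1) by (simp add: filt_def)
  next
    case False
    \<comment> \<open>For n >= 1 the bound is not positive, so the translation by the integral
      \<open>r\<close> does not affect it.\<close>
    have le: "1 - 2 * int n \<le> 0" using False by simp
    have "vge (1 - 2 * int n) (u ^ 2 * x + r) \<longleftrightarrow> vge (1 - 2 * int n) (u ^ 2 * x)"
      using vge_add[of "1 - 2 * int n" "u ^ 2 * x" r] vge_diff[of "1 - 2 * int n" "u ^ 2 * x + r" r] vge_mono[OF r le] by auto
    thus ?thesis using False sc P on ona k(1) by (simp add: filt_def)
  qed
qed

text \<open>The second substitution after the inverse of the first. It connects two models reached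
  from a common third one, as required for comparing a minimal model with a witness of
  non-minimality.\<close>

lemma chg_comp:
  fixes a b c :: "nat \<Rightarrow> 'a::field"
  assumes ab: "chg a b u r s t" and ac: "chg a c u1 r1 s1 t1"
  shows "chg b c (u1 / u) ((r1 - r) / u ^ 2) ((s1 - s) / u) ((t1 - t - s * (r1 - r)) / u ^ 3)"
proof -
  have u: "u \<noteq> 0" "u1 \<noteq> 0" using ab ac by (auto simp: chg_def)
  define U R S T where "U = u1 / u" and "R = (r1 - r) / u ^ 2" and "S = (s1 - s) / u" and "T = (t1 - t - s * (r1 - r)) / u ^ 3"
  have e: "u1 = u * U" "r1 = u ^ 2 * R + r" "s1 = u * S + s" "t1 = u ^ 3 * T + s * u ^ 2 * R + t"
    unfolding U_def R_def S_def T_def using u by (simp_all add: field_simps power2_eq_square power3_eq_cube)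
  \<comment> \<open>The identities are proved after multiplication by a power of \<open>u\<close>,
    where they are polynomial.\<close>
  have can: "p = q" if "u ^ k * p = u ^ k * q" for p q k using that u by simp
  note B = ab[unfolded chg_def, THEN conjunct2] and C = ac[unfolded chg_def e, THEN conjunct2]
  note B1 = B[THEN conjunct1] and B2 = B[THEN conjunct2, THEN conjunct1]
    and B3 = B[THEN conjunct2, THEN conjunct2, THEN conjunct1]
    and B4 = B[THEN conjunct2, THEN conjunct2, THEN conjunct2, THEN conjunct1]
    and B6 = B[THEN conjunct2, THEN conjunct2, THEN conjunct2, THEN conjunct2]
  note C1 = C[THEN conjunct1] and C2 = C[THEN conjunct2, THEN conjunct1]
    and C3 = C[THEN conjunct2, THEN conjunct2, THEN conjunct1]
    and C4 = C[THEN conjunct2, THEN conjunct2, THEN conjunct2, THEN conjunct1]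
    and C6 = C[THEN conjunct2, THEN conjunct2, THEN conjunct2, THEN conjunct2]
  have A1: "a 1 = u * b 1 - 2 * s" using B1 by (simp add: algebra_simps)
  have A2: "a 2 = u ^ 2 * b 2 + s * a 1 - 3 * r + s ^ 2" using B2 by (simp add: algebra_simps)
  have A3: "a 3 = u ^ 3 * b 3 - r * a 1 - 2 * t" using B3 by (simp add: algebra_simps)
  have A4: "a 4 = u ^ 4 * b 4 + s * a 3 - 2 * r * a 2 + (t + r * s) * a 1 - 3 * r ^ 2 + 2 * s * t"
    using B4 by (simp add: algebra_simps)
  have A6: "a 6 = u ^ 6 * b 6 - r * a 4 - r ^ 2 * a 2 - r ^ 3 + t * a 3 + t ^ 2 + r * t * a 1"
    using B6 by (simp add: algebra_simps)
  have "u ^ 1 * (U * c 1) = (u * U) * c 1" by (simp add: power_mult_distrib)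
  also have "(u * U) * c 1 = u ^ 1 * (b 1 + 2 * S)"
    unfolding C1 A6 A4 A3 A2 A1 by Groebner_Basis.algebra
  finally have 1: "U * c 1 = b 1 + 2 * S" by (rule can)
  have "u ^ 2 * (U ^ 2 * c 2) = (u * U) ^ 2 * c 2" by (simp add: power_mult_distrib)
  also have "(u * U) ^ 2 * c 2 = u ^ 2 * (b 2 - S * b 1 + 3 * R - S ^ 2)"
    unfolding C2 A6 A4 A3 A2 A1 by Groebner_Basis.algebra
  finally have 2: "U ^ 2 * c 2 = b 2 - S * b 1 + 3 * R - S ^ 2" by (rule can)
  have "u ^ 3 * (U ^ 3 * c 3) = (u * U) ^ 3 * c 3" by (simp add: power_mult_distrib)
  also have "(u * U) ^ 3 * c 3 = u ^ 3 * (b 3 + R * b 1 + 2 * T)"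
    unfolding C3 A6 A4 A3 A2 A1 by Groebner_Basis.algebra
  finally have 3: "U ^ 3 * c 3 = b 3 + R * b 1 + 2 * T" by (rule can)
  have "u ^ 4 * (U ^ 4 * c 4) = (u * U) ^ 4 * c 4" by (simp add: power_mult_distrib)
  also have "(u * U) ^ 4 * c 4 = u ^ 4 * (b 4 - S * b 3 + 2 * R * b 2 - (T + R * S) * b 1 + 3 * R ^ 2 - 2 * S * T)"
    unfolding C4 A6 A4 A3 A2 A1 by Groebner_Basis.algebra
  finally have 4: "U ^ 4 * c 4 = b 4 - S * b 3 + 2 * R * b 2 - (T + R * S) * b 1 + 3 * R ^ 2 - 2 * S * T" by (rule can)
  have "u ^ 6 * (U ^ 6 * c 6) = (u * U) ^ 6 * c 6" by (simp add: power_mult_distrib)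
  also have "(u * U) ^ 6 * c 6 = u ^ 6 * (b 6 + R * b 4 + R ^ 2 * b 2 + R ^ 3 - T * b 3 - T ^ 2 - R * T * b 1)"
    unfolding C6 A6 A4 A3 A2 A1 by Groebner_Basis.algebra
  finally have 6: "U ^ 6 * c 6 = b 6 + R * b 4 + R ^ 2 * b 2 + R ^ 3 - T * b 3 - T ^ 2 - R * T * b 1" by (rule can)
  have "U \<noteq> 0" using u by (simp add: U_def)
  thus ?thesis using 1 2 3 4 6 unfolding U_def[symmetric] R_def[symmetric] S_def[symmetric] T_def[symmetric] chg_def by blast
qed

section \<open>Counting reductions\<close>

definition residue :: "padic \<Rightarrow> nat" where "residue x = (SOME n. n < pp \<and> vge 1 (x - of_nat n))"

lemma residue: assumes "vge 0 x" shows "residue x < pp" "vge 1 (x - of_nat (residue x))"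
  using someI_ex[OF vge_residue[OF assms]] unfolding residue_def by auto

lemma residue_unique: assumes "vge 0 x" "n < pp" "vge 1 (x - of_nat n)" shows "residue x = n"
proof -
  have "vge 1 ((x - of_nat n) - (x - of_nat (residue x)))" by (rule vge_diff[OF assms(3) residue(2)[OF assms(1)]])
  hence "vge 1 (of_nat (residue x) - of_nat n)" by simp
  thus ?thesis using vge_residue_unique[OF residue(1)[OF assms(1)] assms(2)] by simp
qed

lemma residue_eq_iff: assumes "vge 0 x" "vge 0 y" shows "residue x = residue y \<longleftrightarrow> vge 1 (x - y)"
proof
  assume e: "residue x = residue y"
  have "vge 1 ((x - of_nat (residue x)) - (y - of_nat (residue y)))" by (rule vge_diff[OF residue(2)[OF assms(1)] residue(2)[OF assms(2)]])
  thus "vge 1 (x - y)" using e by simp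
next
  assume "vge 1 (x - y)"
  from vge_add[OF this residue(2)[OF assms(2)]] have "vge 1 (x - of_nat (residue y))" by simp
  thus "residue x = residue y" using residue_unique[OF assms(1) residue(1)[OF assms(2)]] by simp
qed

section \<open>The reduction map and its fibres\<close>

fun red_pt :: "padic ecpt \<Rightarrow> (nat \<times> nat) option" where
  "red_pt Inf = None" | "red_pt (Aff x y) = (if vge 0 x then Some (residue x, residue y) else None)"

lemma red_pt_None_iff: "red_pt P = None \<longleftrightarrow> in_kernel P" by (cases P) auto

lemma in_kernel_add_iff1: assumes "icoef c" "ec_pt c P" "ec_pt c Q" "in_kernel P" shows "in_kernel (ec_add c P Q) \<longleftrightarrow> in_kernel Q"
  using assms(2,3)
proof (cases rule: ec_add_cases)
  case 3 thus ?thesis using assms(4) by simp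
next
  case (4 l n x1 x2 x3)
  interpret L: collinear c l n x1 x2 x3 "l * x1 + n" "l * x2 + n" "l * x3 + n" by unfold_locales (use 4 assms in auto)
  show ?thesis using L.two_kernel collinear.two_kernel[OF L.collinear_23] assms(4) 4 by auto
qed (use assms in simp_all)

lemma in_kernel_add_iff2: assumes "icoef c" "ec_pt c P" "ec_pt c Q" "in_kernel Q" shows "in_kernel (ec_add c P Q) \<longleftrightarrow> in_kernel P"
  using assms(2,3)
proof (cases rule: ec_add_cases)
  case 3 thus ?thesis using assms(4) by simp
next
  case (4 l n x1 x2 x3)
  interpret L: collinear c l n x1 x2 x3 "l * x1 + n" "l * x2 + n" "l * x3 + n" by unfold_locales (use 4 assms in auto)
  show ?thesis using L.two_kernel collinear.two_kernel[OF collinear.collinear_23[OF L.collinear_12]] assms(4) 4 by auto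
qed (use assms in simp_all)

lemma red_pt_eq_iff:
  assumes ic: "icoef c" and on: "ec_pt c P" "ec_pt c Q" and ns: "nonsing_red c P"
  shows "in_kernel (ec_add c P (ec_neg c Q)) \<longleftrightarrow> red_pt P = red_pt Q"
proof (cases "in_kernel P \<or> in_kernel Q")
  case True
  hence "in_kernel (ec_add c P (ec_neg c Q)) \<longleftrightarrow> in_kernel P \<and> in_kernel Q"
    using in_kernel_add_iff1[OF ic on(1) ec_pt_neg[OF on(2)]] in_kernel_add_iff2[OF ic on(1) ec_pt_neg[OF on(2)]] by auto
  thus ?thesis using True red_pt_None_iff by metis
next
  case False
  then obtain x1 y1 x2 y2 where P: "P = Aff x1 y1" "Q = Aff x2 y2" "vge 0 x1" "vge 0 x2"
    by (cases P; cases Q) auto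
  have "vge 0 y1" "vge 0 y2" using integral_y[OF ic] on P by auto
  hence "red_pt P = red_pt Q \<longleftrightarrow> same_red P Q" using P by (simp add: residue_eq_iff)
  thus ?thesis using in_kernel_diff_iff[OF ic on ns] False by simp
qed

section \<open>The image of the reduction map\<close>

definition wpol :: "(nat \<Rightarrow> 'a::field) \<Rightarrow> 'a \<Rightarrow> 'a \<Rightarrow> 'a" where
  "wpol c x y = y ^ 2 + c 1 * x * y + c 3 * y - x ^ 3 - c 2 * x ^ 2 - c 4 * x - c 6"

lemma on_curve_wpol: "on_curve c x y \<longleftrightarrow> wpol c x y = 0"
proof -
  have "wpol c x y = (y * y + c 1 * x * y + c 3 * y) - (x * x * x + c 2 * x * x + c 4 * x + c 6)"
    by (simp add: wpol_def power2_eq_square power3_eq_cube algebra_simps)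
  thus ?thesis by (simp add: on_curve_def)
qed

lemma cong_polys:
  assumes ic: "icoef c" and i: "vge 0 x" "vge 0 y" "vge 0 x'" "vge 0 y'" and d: "vge 1 (x - x')" "vge 1 (y - y')"
  shows "vge 1 (wpol c x y) \<longleftrightarrow> vge 1 (wpol c x' y')" "vge 1 (dFx c x y) \<longleftrightarrow> vge 1 (dFx c x' y')"
    "vge 1 (dFy c x y) \<longleftrightarrow> vge 1 (dFy c x' y')"
proof -
  have iff: "vge 1 p \<longleftrightarrow> vge 1 q" if "vge 1 (p - q)" for p q
    using vge_add[OF that, of q] vge_diff[of 1 p "p - q"] that by auto
  note cs = icoefD[OF ic]
  have "wpol c x y - wpol c x' y' = (y - y') * (y + y' + c 1 * x + c 3)
     + (x - x') * (c 1 * y' - (x * x + x * x' + x' * x') - c 2 * (x + x') - c 4)"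
    unfolding wpol_def by Groebner_Basis.algebra
  also have "vge 1 \<dots>" using i d cs by - (assumption | rule vge_rules)+
  finally show "vge 1 (wpol c x y) \<longleftrightarrow> vge 1 (wpol c x' y')" by (rule iff)
  have "dFx c x y - dFx c x' y' = (y - y') * c 1 - (x - x') * (3 * (x + x') + 2 * c 2)"
    unfolding dFx_def by Groebner_Basis.algebra
  also have "vge 1 \<dots>" using i d cs by - (assumption | rule vge_rules)+
  finally show "vge 1 (dFx c x y) \<longleftrightarrow> vge 1 (dFx c x' y')" by (rule iff)
  have "dFy c x y - dFy c x' y' = (y - y') * 2 + (x - x') * c 1"
    unfolding dFy_def by Groebner_Basis.algebra
  also have "vge 1 \<dots>" using i d cs by - (assumption | rule vge_rules)+
  finally show "vge 1 (dFy c x y) \<longleftrightarrow> vge 1 (dFy c x' y')" by (rule iff)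
qed

definition ratc :: "(nat \<Rightarrow> rat) \<Rightarrow> nat \<Rightarrow> padic" where "ratc a i = of_rat (a i)"

lemma icoef_ratc: "p_integral_model pp a \<longleftrightarrow> icoef (ratc a)"
  by (simp add: p_integral_model_def rat_pint_def rge_def[symmetric] icoef_def ratc_def)

definition ns_pts :: "(nat \<Rightarrow> rat) \<Rightarrow> (nat \<times> nat) set" where
  "ns_pts a = {(x, y). x < pp \<and> y < pp \<and> rge pp 1 (wpol a (of_nat x) (of_nat y)) \<and>
     \<not> (rge pp 1 (a 1 * of_nat y - 3 * of_nat x ^ 2 - 2 * a 2 * of_nat x - a 4) \<and>
        rge pp 1 (2 * of_nat y + a 1 * of_nat x + a 3))}"

lemma finite_ns_pts: "finite (ns_pts a)"
  by (rule finite_subset[of _ "{0..<pp} \<times> {0..<pp}"]) (auto simp: ns_pts_def)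

lemma Np_ns_pts: "Np pp a = card (ns_pts a) + 1"
proof -
  have "{(x, y) \<in> {0..<pp} \<times> {0..<pp}.
      (let S = of_nat x :: rat; T = of_nat y :: rat;
           F = T ^ 2 + a 1 * S * T + a 3 * T - S ^ 3 - a 2 * S ^ 2 - a 4 * S - a 6;
           Fx = a 1 * T - 3 * S ^ 2 - 2 * a 2 * S - a 4;
           Fy = 2 * T + a 1 * S + a 3
       in rat_red0 pp F \<and> \<not> (rat_red0 pp Fx \<and> rat_red0 pp Fy))} = ns_pts a"
    by (auto simp: ns_pts_def Let_def rat_red0_def rge_def wpol_def)
  thus ?thesis unfolding Np_def by simp
qed

lemma ns_pts_iff:
  "(m, n) \<in> ns_pts a \<longleftrightarrow> m < pp \<and> n < pp \<and> vge 1 (wpol (ratc a) (of_nat m) (of_nat n)) \<and>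
     \<not> (vge 1 (dFx (ratc a) (of_nat m) (of_nat n)) \<and> vge 1 (dFy (ratc a) (of_nat m) (of_nat n)))"
proof -
  have "wpol (ratc a) (of_nat m) (of_nat n) = of_rat (wpol a (of_nat m) (of_nat n))"
    by (simp add: wpol_def ratc_def of_rat_add of_rat_diff of_rat_mult of_rat_power)
  moreover have "dFx (ratc a) (of_nat m) (of_nat n) = of_rat (a 1 * of_nat n - 3 * of_nat m ^ 2 - 2 * a 2 * of_nat m - a 4)"
    by (simp add: dFx_def ratc_def of_rat_add of_rat_diff of_rat_mult of_rat_power power2_eq_square)
  moreover have "dFy (ratc a) (of_nat m) (of_nat n) = of_rat (2 * of_nat n + a 1 * of_nat m + a 3)"
    by (simp add: dFy_def ratc_def of_rat_add of_rat_diff of_rat_mult of_rat_power)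
  ultimately show ?thesis by (simp add: ns_pts_def)
qed

lemma vge_of_nat: "vge 0 (of_nat n)"
  using vge_of_rat[of 0 "of_nat n"] rge_of_int[OF prime_pp, of "int n"] by simp

text \<open>One coordinate stays the natural number representing its residue, and Hensel's lemma
  solves for the other: for y if F_y is a unit, otherwise for x. The equation to be solved thus has
  rational coefficients.\<close>

lemma ns_pts_lift:
  assumes ic: "icoef (ratc a)" and mn: "(m, n) \<in> ns_pts a"
  shows "\<exists>x y. on_curve (ratc a) x y \<and> vge 0 x \<and> vge 0 y \<and> vge 1 (x - of_nat m) \<and> vge 1 (y - of_nat n)"
proof -
  have cr: "rge pp 0 (a 1)" "rge pp 0 (a 2)" "rge pp 0 (a 3)" "rge pp 0 (a 4)" "rge pp 0 (a 6)"
    using ic by (auto simp: icoef_def ratc_def)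
  have nr: "rge pp 0 (of_nat k)" for k using vge_of_nat[of k] vge_of_rat[of 0 "of_nat k"] by simp
  have m0: "rge pp 0 (x * y)" if "rge pp 0 x" "rge pp 0 y" for x y using rge_mult[OF prime_pp that] by simp
  have o: "rge pp 0 1" by (simp add: rge_1)
  note rs = rge_add[OF prime_pp] rge_diff[OF prime_pp] m0 rge_minus[OF prime_pp, THEN iffD2] nr cr o
  define M where "M = (of_nat m :: rat)"
  define N where "N = (of_nat n :: rat)"
  have F: "rge pp 1 (wpol a M N)" 
    and FF: "\<not> (rge pp 1 (a 1 * N - 3 * M ^ 2 - 2 * a 2 * M - a 4) \<and> rge pp 1 (2 * N + a 1 * M + a 3))"
    using mn by (auto simp: ns_pts_def M_def N_def)
  have cvt: "of_rat M = (of_nat m :: padic)" "of_rat N = (of_nat n :: padic)" by (simp_all add: M_def N_def)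
  have lift0: "vge 0 x" if "vge 1 (x - of_nat k)" for x k
    using vge_add[OF vge_1_0[OF that] vge_of_nat[of k]] by simp
  show ?thesis
  proof (cases "rge pp 1 (2 * N + a 1 * M + a 3)")
    case False
    have "\<exists>y. of_rat (- (M ^ 3 + a 2 * M ^ 2 + a 4 * M + a 6)) + of_rat (a 1 * M + a 3) * y + of_rat 1 * y * y + of_rat 0 * y * y * y = 0
        \<and> vge 1 (y - of_rat N)"
    proof (rule hensel_cubic)
      show "rge pp 0 (- (M ^ 3 + a 2 * M ^ 2 + a 4 * M + a 6))" "rge pp 0 (a 1 * M + a 3)" "rge pp 0 1" "rge pp 0 0" "rge pp 0 N"
        unfolding M_def N_def power2_eq_square power3_eq_cube by (rule rs | simp)+
      show "rge pp 1 (- (M ^ 3 + a 2 * M ^ 2 + a 4 * M + a 6) + (a 1 * M + a 3) * N + 1 * N * N + 0 * N * N * N)"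
        using F unfolding wpol_def by (simp add: algebra_simps power2_eq_square)
      show "\<not> rge pp 1 (a 1 * M + a 3 + 2 * 1 * N + 3 * 0 * N * N)"
        using False by (simp add: algebra_simps)
    qed
    then obtain y where y: "of_rat (- (M ^ 3 + a 2 * M ^ 2 + a 4 * M + a 6)) + of_rat (a 1 * M + a 3) * y + y * y = 0"
       "vge 1 (y - of_nat n)" by (auto simp: cvt)
    have "wpol (ratc a) (of_nat m) y = 0"
      using y(1) unfolding wpol_def ratc_def cvt[symmetric]
      by (simp add: of_rat_add of_rat_diff of_rat_minus of_rat_mult of_rat_power) Groebner_Basis.algebra
    thus ?thesis using y(2) lift0[OF y(2)] vge_of_nat[of m] by (intro exI[of _ "of_nat m"] exI[of _ y]) (simp add: on_curve_wpol)
  next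
    case True
    hence Fx: "\<not> rge pp 1 (a 1 * N - 3 * M ^ 2 - 2 * a 2 * M - a 4)" using FF by blast
    have "\<exists>x. of_rat (N ^ 2 + a 3 * N - a 6) + of_rat (a 1 * N - a 4) * x + of_rat (- a 2) * x * x + of_rat (- 1) * x * x * x = 0
        \<and> vge 1 (x - of_rat M)"
    proof (rule hensel_cubic)
      show "rge pp 0 (N ^ 2 + a 3 * N - a 6)" "rge pp 0 (a 1 * N - a 4)" "rge pp 0 (- a 2)" "rge pp 0 (- 1)" "rge pp 0 M"
        unfolding M_def N_def power2_eq_square power3_eq_cube by (rule rs | simp)+
      show "rge pp 1 (N ^ 2 + a 3 * N - a 6 + (a 1 * N - a 4) * M + - a 2 * M * M + - 1 * M * M * M)"
        using F unfolding wpol_def by (simp add: algebra_simps power2_eq_square power3_eq_cube)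
      show "\<not> rge pp 1 (a 1 * N - a 4 + 2 * - a 2 * M + 3 * - 1 * M * M)"
        using Fx by (simp add: algebra_simps power2_eq_square)
    qed
    then obtain x where x: "of_rat (N ^ 2 + a 3 * N - a 6) + of_rat (a 1 * N - a 4) * x + of_rat (- a 2) * x * x + of_rat (- 1) * x * x * x = 0"
       "vge 1 (x - of_nat m)" by (auto simp: cvt)
    have "wpol (ratc a) x (of_nat n) = 0"
      using x(1) unfolding wpol_def ratc_def cvt[symmetric]
      by (simp add: of_rat_add of_rat_diff of_rat_minus of_rat_mult of_rat_power) Groebner_Basis.algebra
    thus ?thesis using x(2) lift0[OF x(2)] vge_of_nat[of n] by (intro exI[of _ x] exI[of _ "of_nat n"]) (simp add: on_curve_wpol)
  qed
qed

text \<open>\<open>None\<close> is the point at infinity, the reduction of the whole kernel, and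
  accounts for the + 1 in \<open>Np\<close>.\<close>

lemma red_pt_image:
  assumes ic: "icoef (ratc a)"
  shows "red_pt ` {P. ec_pt (ratc a) P \<and> nonsing_red (ratc a) P} = insert None (Some ` ns_pts a)" (is "?L = ?R")
proof
  show "?L \<subseteq> ?R"
  proof
    fix z assume "z \<in> ?L"
    then obtain P where P: "z = red_pt P" "ec_pt (ratc a) P" "nonsing_red (ratc a) P" by auto
    show "z \<in> ?R"
    proof (cases "in_kernel P")
      case True thus ?thesis using P red_pt_None_iff by auto
    next
      case False
      then obtain x y where xy: "P = Aff x y" "vge 0 x" by (cases P) auto
      have on: "on_curve (ratc a) x y" using P xy by simp
      have y: "vge 0 y" using integral_y[OF ic on xy(2)] .
      note cg = cong_polys[OF ic xy(2) y vge_of_nat vge_of_nat residue(2)[OF xy(2)] residue(2)[OF y]]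
      have "(residue x, residue y) \<in> ns_pts a" unfolding ns_pts_iff cg[symmetric]
        using residue(1)[OF xy(2)] residue(1)[OF y] on P(3) xy by (simp add: on_curve_wpol)
      thus ?thesis using P xy by simp
    qed
  qed
  show "?R \<subseteq> ?L"
  proof
    fix z assume "z \<in> ?R"
    then consider "z = None" | m n where "z = Some (m, n)" "(m, n) \<in> ns_pts a" by auto
    thus "z \<in> ?L"
    proof cases
      case 1 thus ?thesis by (intro image_eqI[of _ _ Inf]) auto
    next
      case 2
      obtain x y where xy: "on_curve (ratc a) x y" "vge 0 x" "vge 0 y" "vge 1 (x - of_nat m)" "vge 1 (y - of_nat n)"
        using ns_pts_lift[OF ic 2(2)] by blast
      note cg = cong_polys[OF ic xy(2,3) vge_of_nat vge_of_nat xy(4,5)]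
      have mn: "m < pp" "n < pp" "\<not> (vge 1 (dFx (ratc a) x y) \<and> vge 1 (dFy (ratc a) x y))"
        using 2(2) unfolding ns_pts_iff cg[symmetric] by auto
      have "red_pt (Aff x y) = z" using xy 2(1) residue_unique[OF xy(2) mn(1) xy(4)] residue_unique[OF xy(3) mn(2) xy(5)] by simp
      thus ?thesis using xy mn by (intro image_eqI[of _ _ "Aff x y"]) auto
    qed
  qed
qed

lemma card_red_pt_image:
  assumes "icoef (ratc a)" shows "card (red_pt ` {P. ec_pt (ratc a) P \<and> nonsing_red (ratc a) P}) = Np pp a"
  unfolding red_pt_image[OF assms] Np_ns_pts using finite_ns_pts[of a] by (simp add: card_image)

section \<open>Counting points on the cusp\<close>

definition cusp_pts :: "(nat \<times> nat) set" where
  "cusp_pts = {(x, y). x < pp \<and> y < pp \<and> \<not> int pp dvd int x \<and> int pp dvd int y ^ 2 - int x ^ 3}"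

lemma dvd_pp_mult: "int pp dvd a * b \<longleftrightarrow> int pp dvd a \<or> int pp dvd b"
  using prime_pp by (simp add: prime_dvd_mult_iff)

lemma dvd_pp_power: "int pp dvd a ^ Suc k \<longleftrightarrow> int pp dvd a"
  by (induction k) (simp_all add: dvd_pp_mult)

lemma residue_eqI: "m < pp \<Longrightarrow> n < pp \<Longrightarrow> int pp dvd int m - int n \<Longrightarrow> m = n"
  by (metis mod_eq_dvd_iff mod_less of_nat_eq_iff of_nat_mod)

lemma pp_gt_1: "pp > 1" using prime_pp prime_gt_1_nat by blast

lemma not_dvd_pp: "0 < t \<Longrightarrow> t < pp \<Longrightarrow> \<not> int pp dvd int t"
  by (meson int_dvd_int_iff nat_dvd_not_less)

text \<open>The punctured cusp y^2 = x^3 is parametrised by t -> (t^2, t^3) with nonzero t, and the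
  inverse is t = y / x.\<close>

lemma card_cusp_pts: "card cusp_pts = pp - 1"
proof -
  define f where "f t = ((t ^ 2) mod pp, (t ^ 3) mod pp)" for t :: nat
  have md: "int pp dvd int (k mod pp) - int k" for k by (simp add: of_nat_mod mod_eq_dvd_iff[symmetric])
  have pos: "pp > 0" using pp_gt_1 by simp
  have "inj_on f {1..<pp}"
  proof (rule inj_onI)
    fix s t assume st: "s \<in> {1..<pp}" "t \<in> {1..<pp}" "f s = f t"
    have h: "int pp dvd int (s ^ 2) - int (t ^ 2)" "int pp dvd int (s ^ 3) - int (t ^ 3)"
      using st(3) by (simp_all add: f_def mod_eq_dvd_iff[symmetric] of_nat_mod[symmetric] del: of_nat_power)
    from dvd_diff[OF h(2) dvd_mult[OF h(1), of "int s"]]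
    have "int pp dvd (int s ^ 3 - int t ^ 3) - int s * (int s ^ 2 - int t ^ 2)" by simp
    also have "(int s ^ 3 - int t ^ 3) - int s * (int s ^ 2 - int t ^ 2) = int t ^ Suc 1 * (int s - int t)"
      by (simp add: algebra_simps power2_eq_square power3_eq_cube)
    finally have "int pp dvd int s - int t" unfolding dvd_pp_mult dvd_pp_power using not_dvd_pp[of t] st by auto
    thus "s = t" using st by (intro residue_eqI) auto
  qed
  moreover have "f ` {1..<pp} = cusp_pts"
  proof
    show "f ` {1..<pp} \<subseteq> cusp_pts"
    proof
      fix z assume "z \<in> f ` {1..<pp}"
      then obtain t where t: "t \<in> {1..<pp}" "z = f t" by auto
      define x where "x = t ^ 2 mod pp"
      define y where "y = t ^ 3 mod pp"
      have x: "int pp dvd int x - int t ^ 2" and y: "int pp dvd int y - int t ^ 3"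
        using md[of "t ^ 2"] md[of "t ^ 3"] by (simp_all add: x_def y_def)
      have "\<not> int pp dvd int x"
      proof
        assume "int pp dvd int x"
        from dvd_diff[OF this x]
        have "int pp dvd int t ^ Suc 1" by (simp add: numeral_2_eq_2)
        thus False unfolding dvd_pp_power using not_dvd_pp[of t] t by auto
      qed
      moreover have "int pp dvd int y ^ 2 - int x ^ 3"
      proof -
        have "int y ^ 2 - int x ^ 3 = (int y - int t ^ 3) * (int y + int t ^ 3)
          - (int x - int t ^ 2) * (int x ^ 2 + int x * int t ^ 2 + int t ^ 4)" by Groebner_Basis.algebra
        thus ?thesis using x y by (simp add: dvd_diff dvd_mult2)
      qed
      ultimately show "z \<in> cusp_pts" using t pos by (simp add: f_def cusp_pts_def x_def y_def)
    qed
    show "cusp_pts \<subseteq> f ` {1..<pp}"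
    proof
      fix z assume "z \<in> cusp_pts"
      then obtain x y where z: "z = (x, y)" "x < pp" "y < pp" "\<not> int pp dvd int x" "int pp dvd int y ^ 2 - int x ^ 3"
        by (auto simp: cusp_pts_def)
      have cop: "coprime (int x) (int pp)"
        using z(4) prime_pp by (metis coprime_commute prime_imp_coprime prime_nat_int_transfer)
      define c where "c = fst (bezout_coefficients (int x) (int pp))"
      have "c * int x + snd (bezout_coefficients (int x) (int pp)) * int pp = 1"
        unfolding c_def using cop by (simp add: bezout_coefficients_fst_snd)
      hence c: "int pp dvd 1 - int x * c" by (metis add_diff_cancel_left' dvd_triv_right mult.commute)
      define t where "t = nat ((int y * c) mod int pp)"
      have it: "int t = (int y * c) mod int pp" unfolding t_def using pos by simp
      have tp: "t < pp" using it pos by (metis of_nat_less_iff pos_mod_bound of_nat_0_less_iff)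
      have t1: "int pp dvd int t - int y * c" unfolding it by (simp add: mod_eq_dvd_iff[symmetric])
      have "int pp dvd (int t - int y * c) * int x - (1 - int x * c) * int y" by (intro dvd_diff dvd_mult2 t1 c)
      hence tx: "int pp dvd int t * int x - int y" by (simp add: algebra_simps)
      have "int pp dvd (int t * int x - int y) * (int t * int x + int y) + (int y ^ 2 - int x ^ 3)"
        by (intro dvd_add dvd_mult2 tx z(5))
      also have "(int t * int x - int y) * (int t * int x + int y) + (int y ^ 2 - int x ^ 3) = int x ^ Suc 1 * (int t ^ 2 - int x)"
        by (simp add: algebra_simps power2_eq_square power3_eq_cube)
      finally have t2: "int pp dvd int t ^ 2 - int x" unfolding dvd_pp_mult dvd_pp_power using z(4) by simp
      have "int pp dvd (int t ^ 2 - int x) * int t + (int t * int x - int y)" by (intro dvd_add dvd_mult2 t2 tx)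
      hence t3: "int pp dvd int t ^ 3 - int y" by (simp add: algebra_simps power2_eq_square power3_eq_cube)
      have "t \<noteq> 0"
      proof
        assume "t = 0"
        hence "int pp dvd - int x" using t2 by simp
        thus False using z(4) by simp
      qed
      moreover have "f t = (x, y)"
      proof -
        have "int pp dvd int (t ^ 2 mod pp) - int x" "int pp dvd int (t ^ 3 mod pp) - int y"
          using dvd_add[OF md[of "t ^ 2"] t2[folded of_nat_power]] dvd_add[OF md[of "t ^ 3"] t3[folded of_nat_power]] by simp_all
        thus ?thesis unfolding f_def using z pos by (auto intro!: residue_eqI)
      qed
      ultimately show "z \<in> f ` {1..<pp}" using tp z(1) by (intro image_eqI[of _ _ t]) auto
    qed
  qed
  ultimately have "card cusp_pts = card {1..<pp}" by (metis card_image)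
  thus ?thesis by simp
qed

lemma rge_iff_cong: assumes "rge pp 1 (r - s)" shows "rge pp 1 r \<longleftrightarrow> rge pp 1 s"
  using rge_add[OF prime_pp assms, of s] rge_diff[OF prime_pp, of 1 r "r - s"] assms by auto

text \<open>Modulo p the derivatives are - 3 x^2 and 2 y. One of them may vanish identically, in
  characteristic 3 or 2, but never both, and on the cusp x = 0 is equivalent to y = 0. So the
  singular point is the origin for every p.\<close>

lemma ns_pts_cusp:
  assumes a: "rge pp 1 (a 1)" "rge pp 1 (a 2)" "rge pp 1 (a 3)" "rge pp 1 (a 4)" "rge pp 1 (a 6)"
  shows "ns_pts a = cusp_pts"
proof -
  have nr: "rge pp 0 (of_nat k)" for k using rge_of_int[OF prime_pp, of "int k"] by simp
  have nm: "rge pp 0 (numeral k)" for k using rge_of_int[OF prime_pp, of "numeral k"] by simp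
  have m0: "rge pp 0 (x * y)" if "rge pp 0 x" "rge pp 0 y" for x y using rge_mult[OF prime_pp that] by simp
  have m1: "rge pp 1 (x * y)" if "rge pp 1 x" "rge pp 0 y" for x y using rge_mult[OF prime_pp that] by simp
  note rs = rge_add[OF prime_pp] rge_diff[OF prime_pp] m1 m0 rge_minus[OF prime_pp, THEN iffD2] nr nm a
  have "(x, y) \<in> ns_pts a \<longleftrightarrow> (x, y) \<in> cusp_pts" if xy: "x < pp" "y < pp" for x y
  proof -
    define u v where "u = (of_nat x :: rat)" and "v = (of_nat y :: rat)"
    have "wpol a u v - of_int (int y ^ 2 - int x ^ 3) = a 1 * (u * v) + a 3 * v - a 2 * (u * u) - a 4 * u - a 6"
      by (simp add: wpol_def u_def v_def power2_eq_square)
    also have "rge pp 1 \<dots>" unfolding u_def v_def by (rule rs)+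
    finally have 1: "rge pp 1 (wpol a u v) \<longleftrightarrow> int pp dvd int y ^ 2 - int x ^ 3"
      using rge_iff_cong rge_of_int_iff[OF prime_pp] by blast
    have "(a 1 * v - 3 * u ^ 2 - 2 * a 2 * u - a 4) - of_int (- (3 * int x ^ 2)) = a 1 * v - a 2 * (2 * u) - a 4"
      by (simp add: u_def v_def)
    also have "rge pp 1 \<dots>" unfolding u_def v_def by (rule rs)+
    finally have "rge pp 1 (a 1 * v - 3 * u ^ 2 - 2 * a 2 * u - a 4) \<longleftrightarrow> int pp dvd - (3 * int x ^ 2)"
      using rge_iff_cong rge_of_int_iff[OF prime_pp] by blast
    hence 2: "rge pp 1 (a 1 * v - 3 * u ^ 2 - 2 * a 2 * u - a 4) \<longleftrightarrow> int pp dvd 3 \<or> int pp dvd int x"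
      using dvd_pp_mult[of 3 "int x ^ Suc 1"] dvd_pp_power[of "int x" 1] by (simp add: numeral_2_eq_2)
    have "(2 * v + a 1 * u + a 3) - of_int (2 * int y) = a 1 * u + a 3" by (simp add: u_def v_def)
    also have "rge pp 1 \<dots>" unfolding u_def v_def by (rule rs)+
    finally have "rge pp 1 (2 * v + a 1 * u + a 3) \<longleftrightarrow> int pp dvd 2 * int y"
      using rge_iff_cong rge_of_int_iff[OF prime_pp] by blast
    hence 3: "rge pp 1 (2 * v + a 1 * u + a 3) \<longleftrightarrow> int pp dvd 2 \<or> int pp dvd int y" unfolding dvd_pp_mult .
    have 23: "\<not> (int pp dvd 2 \<and> int pp dvd 3)"
    proof
      assume "int pp dvd 2 \<and> int pp dvd 3"
      hence "int pp dvd 3 - 2" by (intro dvd_diff) auto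
      thus False using pp_gt_1 by simp
    qed
    have 4: "int pp dvd int y \<longleftrightarrow> int pp dvd int x" if h: "int pp dvd int y ^ 2 - int x ^ 3"
    proof -
      have "int pp dvd int y ^ Suc 1 \<longleftrightarrow> int pp dvd int x ^ Suc 2"
        using dvd_add_right_iff[OF h, of "int x ^ 3"] by (simp add: numeral_2_eq_2 numeral_3_eq_3)
      thus ?thesis unfolding dvd_pp_power .
    qed
    show ?thesis using xy 1 2 3 23 4 unfolding ns_pts_def cusp_pts_def u_def v_def by auto
  qed
  moreover have "x < pp \<and> y < pp" if "(x, y) \<in> ns_pts a \<or> (x, y) \<in> cusp_pts" for x y
    using that by (auto simp: ns_pts_def cusp_pts_def)
  ultimately show ?thesis by auto
qed

lemma Np_cusp:
  assumes "rge pp 1 (a 1)" "rge pp 1 (a 2)" "rge pp 1 (a 3)" "rge pp 1 (a 4)" "rge pp 1 (a 6)"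
  shows "Np pp a = pp"
  using ns_pts_cusp[OF assms] card_cusp_pts pp_gt_1 by (simp add: Np_ns_pts)

section \<open>Indices\<close>

lemma card_image_eq_kernel:
  assumes "\<And>a b. a \<in> A \<Longrightarrow> b \<in> A \<Longrightarrow> g a = g b \<longleftrightarrow> f a = f b"
  shows "card (g ` A) = card (f ` A)"
proof -
  define h where "h y = f (inv_into A g y)" for y
  have h: "h (g a) = f a" if "a \<in> A" for a
    using assms[OF inv_into_into[of "g a" g A] that] f_inv_into_f[of "g a" g A] that by (auto simp: h_def)
  have "inj_on h (g ` A)" using h assms by (auto intro!: inj_onI)
  moreover have "h ` g ` A = f ` A" using h by (auto simp: image_iff)
  ultimately show ?thesis by (metis card_image)
qed

section \<open>Cosets in a tower of subgroups\<close>

context group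
begin

lemma rcos_eq_iff:
  assumes "subgroup H G" "a \<in> carrier G" "b \<in> carrier G"
  shows "H #> a = H #> b \<longleftrightarrow> a \<otimes> inv b \<in> H"
proof -
  have "a \<in> H #> b \<longleftrightarrow> a \<otimes> inv b \<in> H" using subgroup.rcos_module[OF assms(1) is_group assms(3,2)] .
  thus ?thesis using rcos_self[OF assms(2,1)] repr_independence[OF _ assms(3,1)] by auto
qed

text \<open>No finiteness is needed: \<open>card\<close> is 0 on infinite sets and multiplicative on all products.\<close>

lemma card_rcosets_tower:
  assumes H: "subgroup H G" and H': "subgroup H' G" and K: "subgroup K G" and sub: "H \<subseteq> H'" "H' \<subseteq> K"
  shows "card ((\<lambda>a. H #> a) ` K) = card ((\<lambda>a. H' #> a) ` K) * card ((\<lambda>a. H #> a) ` H')"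
proof -
  have HK: "\<And>x. x \<in> H' \<Longrightarrow> x \<in> carrier G" "\<And>x. x \<in> K \<Longrightarrow> x \<in> carrier G" "H \<subseteq> carrier G"
    using subgroup.subset H H' K by blast+
  \<comment> \<open>A representative in \<open>K\<close> for each coset of \<open>H'\<close>. A
    coset of \<open>H\<close> in \<open>K\<close> is a coset of \<open>H\<close> in
    \<open>H'\<close> times exactly one such representative.\<close>
  define r where "r C = (SOME a. a \<in> K \<and> C = H' #> a)" for C
  have r: "r (H' #> a) \<in> K" "H' #> a = H' #> r (H' #> a)" if "a \<in> K" for a
    using someI_ex[of "\<lambda>x. x \<in> K \<and> H' #> a = H' #> x"] that unfolding r_def by blast+
  define \<Phi> where "\<Phi> = (\<lambda>(C, D). D #> r C)"
  have \<Phi>: "\<Phi> (H' #> a, H #> g) = H #> (g \<otimes> r (H' #> a))" if "a \<in> K" "g \<in> H'" for a g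
    using coset_mult_assoc[OF HK(3) HK(1)[OF that(2)] HK(2)[OF r(1)[OF that(1)]]] by (simp add: \<Phi>_def)
  have "bij_betw \<Phi> (((\<lambda>a. H' #> a) ` K) \<times> ((\<lambda>a. H #> a) ` H')) ((\<lambda>a. H #> a) ` K)"
    unfolding bij_betw_def
  proof
    show "inj_on \<Phi> (((\<lambda>a. H' #> a) ` K) \<times> ((\<lambda>a. H #> a) ` H'))"
    proof (rule inj_onI)
      fix z z' assume z: "z \<in> ((\<lambda>a. H' #> a) ` K) \<times> ((\<lambda>a. H #> a) ` H')" 
        "z' \<in> ((\<lambda>a. H' #> a) ` K) \<times> ((\<lambda>a. H #> a) ` H')" and eq: "\<Phi> z = \<Phi> z'"
      obtain a g where ag: "z = (H' #> a, H #> g)" "a \<in> K" "g \<in> H'" using z(1) by auto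
      obtain b k where bk: "z' = (H' #> b, H #> k)" "b \<in> K" "k \<in> H'" using z(2) by auto
      define x y where "x = r (H' #> a)" and "y = r (H' #> b)"
      have xy: "x \<in> carrier G" "y \<in> carrier G" using r(1) ag(2) bk(2) HK(2) by (auto simp: x_def y_def)
      have gk: "g \<in> carrier G" "k \<in> carrier G" using ag bk HK by auto
      have "H #> (g \<otimes> x) = H #> (k \<otimes> y)" using eq ag bk \<Phi> by (simp add: x_def y_def)
      hence 1: "(g \<otimes> x) \<otimes> inv (k \<otimes> y) \<in> H" using rcos_eq_iff[OF H, of "g \<otimes> x" "k \<otimes> y"] xy gk by simp
      hence "inv g \<otimes> ((g \<otimes> x) \<otimes> inv (k \<otimes> y)) \<otimes> k \<in> H'"
        using sub(1) ag(3) bk(3) H' by (meson subgroup.m_closed subgroup.m_inv_closed subsetD)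
      also have "inv g \<otimes> ((g \<otimes> x) \<otimes> inv (k \<otimes> y)) \<otimes> k = x \<otimes> inv y"
        using xy gk by (simp add: inv_mult_group m_assoc[symmetric]) (simp add: m_assoc)
      finally have "H' #> x = H' #> y" using rcos_eq_iff[OF H' xy] by simp
      hence C: "H' #> a = H' #> b" using r(2)[OF ag(2)] r(2)[OF bk(2)] by (simp add: x_def y_def)
      hence "x = y" by (simp add: x_def y_def)
      hence "g \<otimes> inv k \<in> H" using 1 xy gk by (simp add: inv_mult_group m_assoc) (simp add: m_assoc[symmetric])
      hence "H #> g = H #> k" using rcos_eq_iff[OF H gk] by simp
      thus "z = z'" using ag bk C by simp
    qed
    show "\<Phi> ` (((\<lambda>a. H' #> a) ` K) \<times> ((\<lambda>a. H #> a) ` H')) = (\<lambda>a. H #> a) ` K"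
    proof
      show "\<Phi> ` (((\<lambda>a. H' #> a) ` K) \<times> ((\<lambda>a. H #> a) ` H')) \<subseteq> (\<lambda>a. H #> a) ` K"
      proof
        fix z assume "z \<in> \<Phi> ` (((\<lambda>a. H' #> a) ` K) \<times> ((\<lambda>a. H #> a) ` H'))"
        then obtain a g where ag: "z = \<Phi> (H' #> a, H #> g)" "a \<in> K" "g \<in> H'" by auto
        have "g \<otimes> r (H' #> a) \<in> K" using r(1)[OF ag(2)] ag(3) sub(2) K by (meson subgroup.m_closed subsetD)
        thus "z \<in> (\<lambda>a. H #> a) ` K" using ag \<Phi> by auto
      qed
      show "(\<lambda>a. H #> a) ` K \<subseteq> \<Phi> ` (((\<lambda>a. H' #> a) ` K) \<times> ((\<lambda>a. H #> a) ` H'))"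
      proof
        fix z assume "z \<in> (\<lambda>a. H #> a) ` K"
        then obtain a where a: "a \<in> K" "z = H #> a" by auto
        define x where "x = r (H' #> a)"
        have x: "x \<in> carrier G" "a \<in> carrier G" using r(1)[OF a(1)] a(1) HK(2) by (auto simp: x_def)
        have g: "a \<otimes> inv x \<in> H'" using r(2)[OF a(1)] rcos_eq_iff[OF H' x(2,1)] by (simp add: x_def)
        have "a \<otimes> inv x \<otimes> x = a" using x by (simp add: m_assoc)
        hence "\<Phi> (H' #> a, H #> (a \<otimes> inv x)) = z" using \<Phi>[OF a(1) g] a(2) by (simp add: x_def)
        thus "z \<in> \<Phi> ` (((\<lambda>a. H' #> a) ` K) \<times> ((\<lambda>a. H #> a) ` H'))" using a(1) g by (intro image_eqI) auto
      qed
    qed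
  qed
  hence "card (((\<lambda>a. H' #> a) ` K) \<times> ((\<lambda>a. H #> a) ` H')) = card ((\<lambda>a. H #> a) ` K)" by (rule bij_betw_same_card)
  thus ?thesis by (simp add: card_cartesian_product)
qed

end

section \<open>The group of the minimal model and its filtration\<close>

instantiation padic :: weierstrass_field
begin
definition wcoef_padic :: "nat \<Rightarrow> padic" where "wcoef_padic = ratc test_model"
instance ..
end

definition ecg :: "(nat \<Rightarrow> padic) \<Rightarrow> padic ecpt monoid" where
  "ecg c = \<lparr>carrier = {P. ec_pt c P}, monoid.mult = ec_add c, one = Inf\<rparr>"

abbreviation ecgrp :: "padic ecpt monoid" where "ecgrp \<equiv> ecg (ratc test_model)"

lemma ec_add_Inf: "ec_add c Inf P = P" by (simp add: ec_add_def)

lemma ec_add_neg_self: "ec_add c (ec_neg c P) P = Inf"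
  by (cases P) (simp_all add: ec_add_def)

text \<open>Associativity is at hand for the coefficients built into the class, hence for the group
  of \<open>test_model\<close>. Cosets for the other models are transported to this group.\<close>

lemma ecgrp_group: assumes "disc test_model \<noteq> 0" shows "group ecgrp"
proof -
  have "wdisc (ratc test_model) \<noteq> 0"
    using assms wdisc_of_rat[of test_model, where 'a=padic] unfolding disc_wdisc ratc_def by simp
  hence ns: "\<And>x y. on_curve (ratc test_model) x y \<Longrightarrow> \<not> sing_pt (ratc test_model) x y" using sing_pt_wdisc by metis
  show ?thesis
  proof (rule groupI)
    fix P Q R assume "P \<in> carrier ecgrp" "Q \<in> carrier ecgrp" "R \<in> carrier ecgrp"
    thus "P \<otimes>\<^bsub>ecgrp\<^esub> Q \<otimes>\<^bsub>ecgrp\<^esub> R = P \<otimes>\<^bsub>ecgrp\<^esub> (Q \<otimes>\<^bsub>ecgrp\<^esub> R)"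
      using ec_add_assoc[of P Q R, unfolded wcoef_padic_def] ns by (simp add: ecg_def)
  next
    fix P assume "P \<in> carrier ecgrp"
    thus "\<exists>Q\<in>carrier ecgrp. Q \<otimes>\<^bsub>ecgrp\<^esub> P = \<one>\<^bsub>ecgrp\<^esub>"
      by (intro bexI[of _ "ec_neg (ratc test_model) P"]) (simp_all add: ecg_def ec_pt_neg ec_add_neg_self)
  qed (auto simp: ecg_def ec_pt_add ec_add_Inf)
qed

lemma ecgrp_inv: assumes "disc test_model \<noteq> 0" "ec_pt (ratc test_model) P" 
  shows "inv\<^bsub>ecgrp\<^esub> P = ec_neg (ratc test_model) P"
  using group.inv_equality[OF ecgrp_group[OF assms(1)], of "ec_neg (ratc test_model) P" P] assms(2)
  by (simp add: ecg_def ec_pt_neg ec_add_neg_self)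

definition scaled :: "nat \<Rightarrow> (nat \<Rightarrow> rat) \<Rightarrow> nat \<Rightarrow> rat" where
  "scaled k a i = of_nat pp ^ (k * i) * a i"

abbreviation scaled_pt :: "nat \<Rightarrow> padic ecpt \<Rightarrow> padic ecpt" where
  "scaled_pt k \<equiv> chg_pt (of_nat pp ^ k) 0 0 0"

lemma chg_scaled: "chg (ratc (scaled k a)) (ratc a) (of_nat pp ^ k) 0 0 0"
  using pp_gt_1 by (simp add: chg_def ratc_def scaled_def of_rat_mult of_rat_power power_mult)

lemma rge_scaled: "rge pp 0 (a i) \<Longrightarrow> rge pp (int (k * i)) (scaled k a i)"
  unfolding scaled_def using rge_mult[OF prime_pp, of "int (k * i)" "of_nat pp ^ (k * i)" 0 "a i"]
  by (simp add: rge_prime_power[OF prime_pp])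

lemma icoef_scaled: assumes "icoef (ratc a)" shows "icoef (ratc (scaled k a))"
proof -
  have "rge pp 0 (scaled k a i)" if "rge pp 0 (a i)" for i by (rule rge_mono[OF rge_scaled[of a i, OF that]]) simp
  thus ?thesis using assms by (simp add: icoef_def ratc_def)
qed

lemma vge_prime_power: "vge m (of_nat pp ^ k) \<longleftrightarrow> m \<le> int k"
  using vge_of_rat[of m "of_nat pp ^ k"] rge_prime_power[OF prime_pp, of m k] by (simp add: of_rat_power)

lemma filt_scaled:
  assumes "icoef (ratc a)" "ec_pt (ratc a) P"
  shows "filt (ratc (scaled k a)) n (scaled_pt k P) \<longleftrightarrow> filt (ratc a) (n + k) P"
proof (cases "k = 0")
  case True
  have "scaled 0 a = a" by (simp add: scaled_def fun_eq_iff)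
  moreover have "scaled_pt 0 P = P" by (cases P) simp_all
  ultimately show ?thesis using True by simp
next
  case False
  thus ?thesis using filt_chg[OF chg_scaled icoef_scaled[OF assms(1)] assms(1) _ _ _ assms(2), where k=k] by (simp add: vge_prime_power)
qed

lemma filt_0: "filt c 0 P \<longleftrightarrow> ec_pt c P \<and> nonsing_red c P" by (simp add: filt_def)

definition filtset :: "nat \<Rightarrow> padic ecpt set" where "filtset k = {P. filt (ratc test_model) k P}"

context
  assumes dn: "disc test_model \<noteq> 0" and ic: "icoef (ratc test_model)"
begin

interpretation group ecgrp by (rule ecgrp_group[OF dn])

text \<open>Each step, including k = 0, is the E^0 of an integral model with coefficients p^(k i)
  a_i. Closure under the group operations and the index of the next step are thereby questions about
  E^0.\<close>

lemma filtset_iff: "P \<in> filtset k \<longleftrightarrow> ec_pt (ratc test_model) P \<and> nonsing_red (ratc (scaled k test_model)) (scaled_pt k P)"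
proof -
  have "ec_pt (ratc (scaled k test_model)) (scaled_pt k P)" if "ec_pt (ratc test_model) P"
    using bij_betw_apply[OF chg_pt_bij[OF chg_scaled]] that by blast
  moreover have "ec_pt (ratc test_model) P" if "filt (ratc test_model) k P" using that by (simp add: filt_def)
  ultimately show ?thesis using filt_scaled[OF ic, of P k 0] by (auto simp: filtset_def filt_0)
qed

lemma ec_pt_scaled: "ec_pt (ratc test_model) P \<Longrightarrow> ec_pt (ratc (scaled k test_model)) (scaled_pt k P)"
  using bij_betw_apply[OF chg_pt_bij[OF chg_scaled]] by blast

lemma filtset_Suc_iff: "P \<in> filtset (Suc k) \<longleftrightarrow> ec_pt (ratc test_model) P \<and> in_kernel (scaled_pt k P)"
proof -
  have "ec_pt (ratc test_model) P" if "filt (ratc test_model) (Suc k) P" using that by (simp add: filt_def)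
  thus ?thesis using filt_scaled[OF ic, of P k 1] filt_1[OF icoef_scaled[OF ic]] ec_pt_scaled by (auto simp: filtset_def plus_1_eq_Suc)
qed

lemma filtset_subgroup: "subgroup (filtset k) ecgrp"
proof (rule subgroupI)
  show "filtset k \<subseteq> carrier ecgrp" by (auto simp: filtset_iff ecg_def)
  show "filtset k \<noteq> {}" using filtset_iff[of Inf k] by auto
next
  fix P assume P: "P \<in> filtset k"
  hence on: "ec_pt (ratc test_model) P" by (simp add: filtset_iff)
  show "inv\<^bsub>ecgrp\<^esub> P \<in> filtset k" unfolding ecgrp_inv[OF dn on]
    using P nonsing_red_neg[OF icoef_scaled[OF ic] ec_pt_scaled[OF on]]
    by (simp add: filtset_iff ec_pt_neg chg_pt_neg[OF chg_scaled])
next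
  fix P Q assume PQ: "P \<in> filtset k" "Q \<in> filtset k"
  hence on: "ec_pt (ratc test_model) P" "ec_pt (ratc test_model) Q" by (auto simp: filtset_iff)
  show "P \<otimes>\<^bsub>ecgrp\<^esub> Q \<in> filtset k"
    using PQ nonsing_red_add[OF icoef_scaled[OF ic] ec_pt_scaled[OF on(1)] ec_pt_scaled[OF on(2)]]
    by (simp add: filtset_iff ec_pt_add on chg_pt_add[OF chg_scaled on] ecg_def)
qed

lemma filtset_mono: "filtset (Suc k) \<subseteq> filtset k"
proof
  fix P assume "P \<in> filtset (Suc k)"
  thus "P \<in> filtset k" unfolding filtset_Suc_iff filtset_iff[of P k] using in_kernel_nonsing_red by blast
qed

text \<open>Two points lie in the same coset exactly if their scaled points have the same reduction,
  so cosets correspond to the image of the reduction map.\<close>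

lemma card_filtset_step: "card ((\<lambda>a. filtset (Suc k) #>\<^bsub>ecgrp\<^esub> a) ` filtset k) = Np pp (scaled k test_model)"
proof -
  let ?c = "ratc (scaled k test_model)"
  have "card ((\<lambda>a. filtset (Suc k) #>\<^bsub>ecgrp\<^esub> a) ` filtset k) = card ((\<lambda>P. red_pt (scaled_pt k P)) ` filtset k)"
  proof (rule card_image_eq_kernel)
    fix P Q assume PQ: "P \<in> filtset k" "Q \<in> filtset k"
    hence on: "ec_pt (ratc test_model) P" "ec_pt (ratc test_model) Q" by (auto simp: filtset_iff)
    hence car: "P \<in> carrier ecgrp" "Q \<in> carrier ecgrp" by (auto simp: ecg_def)
    have "filtset (Suc k) #>\<^bsub>ecgrp\<^esub> P = filtset (Suc k) #>\<^bsub>ecgrp\<^esub> Q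
       \<longleftrightarrow> ec_add (ratc test_model) P (ec_neg (ratc test_model) Q) \<in> filtset (Suc k)"
      using rcos_eq_iff[OF filtset_subgroup car] ecgrp_inv[OF dn on(2)] by (simp add: ecg_def)
    also have "\<dots> \<longleftrightarrow> in_kernel (ec_add ?c (scaled_pt k P) (ec_neg ?c (scaled_pt k Q)))"
      by (simp add: filtset_Suc_iff ec_pt_add ec_pt_neg on chg_pt_add[OF chg_scaled] chg_pt_neg[OF chg_scaled])
    also have "\<dots> \<longleftrightarrow> red_pt (scaled_pt k P) = red_pt (scaled_pt k Q)"
      using PQ by (intro red_pt_eq_iff icoef_scaled ic ec_pt_scaled on) (auto simp: filtset_iff)
    finally show "filtset (Suc k) #>\<^bsub>ecgrp\<^esub> P = filtset (Suc k) #>\<^bsub>ecgrp\<^esub> Q \<longleftrightarrow> red_pt (scaled_pt k P) = red_pt (scaled_pt k Q)" .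
  qed
  also have "(\<lambda>P. red_pt (scaled_pt k P)) ` filtset k = red_pt ` (scaled_pt k ` filtset k)" by (simp add: image_image)
  also have "scaled_pt k ` filtset k = {P. ec_pt ?c P \<and> nonsing_red ?c P}"
  proof
    show "scaled_pt k ` filtset k \<subseteq> {P. ec_pt ?c P \<and> nonsing_red ?c P}" using ec_pt_scaled by (auto simp: filtset_iff)
    show "{P. ec_pt ?c P \<and> nonsing_red ?c P} \<subseteq> scaled_pt k ` filtset k"
    proof
      fix Q assume Q: "Q \<in> {P. ec_pt ?c P \<and> nonsing_red ?c P}"
      hence "Q \<in> scaled_pt k ` {P. ec_pt (ratc test_model) P}" using bij_betw_imp_surj_on[OF chg_pt_bij[OF chg_scaled]] by blast
      then obtain P where "ec_pt (ratc test_model) P" "Q = scaled_pt k P" by blast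
      thus "Q \<in> scaled_pt k ` filtset k" using Q by (intro image_eqI[of _ _ P]) (auto simp: filtset_iff)
    qed
  qed
  also have "card (red_pt ` {P. ec_pt ?c P \<and> nonsing_red ?c P}) = Np pp (scaled k test_model)"
    by (rule card_red_pt_image[OF icoef_scaled[OF ic]])
  finally show ?thesis .
qed

lemma Np_scaled: assumes "k \<ge> 1" shows "Np pp (scaled k test_model) = pp"
proof -
  have "rge pp 1 (scaled k test_model i)" if "rge pp 0 (test_model i)" "i \<ge> 1" for i
  proof (rule rge_mono[OF rge_scaled[of test_model i, OF that(1)]])
    have "1 \<le> k * i" using mult_le_mono[OF assms that(2)] by simp
    thus "1 \<le> int (k * i)" by linarith
  qed
  thus ?thesis using ic by (intro Np_cusp) (auto simp: icoef_def ratc_def)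
qed

text \<open>The first step contributes \<open>Np\<close> of the minimal model. Each later one
  belongs to a scaled model with cuspidal reduction and contributes p.\<close>

lemma card_filtset: "card ((\<lambda>a. filtset (Suc k) #>\<^bsub>ecgrp\<^esub> a) ` filtset 0) = Np pp test_model * pp ^ k"
proof (induction k)
  case 0
  have "scaled 0 test_model = test_model" by (simp add: scaled_def fun_eq_iff)
  thus ?case using card_filtset_step[of 0] by simp
next
  case (Suc k)
  have sub: "filtset (Suc k) \<subseteq> filtset 0"
    by (rule lift_Suc_antimono_le[of filtset]) (auto intro: filtset_mono[THEN subsetD])
  show ?case
    using card_rcosets_tower[OF filtset_subgroup filtset_subgroup filtset_subgroup filtset_mono sub]
      Suc card_filtset_step[of "Suc k"] Np_scaled[of "Suc k"] by (simp add: algebra_simps)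
qed

lemma card_rcosets_filtset:
  "card (rcosets\<^bsub>ecgrp\<^esub> filtset (Suc k)) = card (rcosets\<^bsub>ecgrp\<^esub> filtset 0) * (Np pp test_model * pp ^ k)"
proof -
  have r: "rcosets\<^bsub>ecgrp\<^esub> H = (\<lambda>a. H #>\<^bsub>ecgrp\<^esub> a) ` carrier ecgrp" for H by (auto simp: RCOSETS_def)
  have sub: "filtset (Suc k) \<subseteq> filtset 0"
    by (rule lift_Suc_antimono_le[of filtset]) (auto intro: filtset_mono[THEN subsetD])
  show ?thesis unfolding r
    using card_rcosets_tower[OF filtset_subgroup filtset_subgroup subgroup_self sub]
      subgroup.subset[OF filtset_subgroup] card_filtset[of k] by simp
qed

end

section \<open>Transfer to the record \<open>Qp\<close>\<close>

text \<open>The isomorphism from the type to the carrier of the record. The operations of the record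
  choose representatives by \<open>SOME\<close>, so every compatibility goes through
  \<open>padic_rep_iota\<close>.\<close>

definition iota :: "padic \<Rightarrow> (nat \<Rightarrow> rat) set" where "iota x = padic_class pp (rep_padic x)"

lemma padic_class_eq_iff:
  assumes "padic_cauchy pp S" "padic_cauchy pp T"
  shows "padic_class pp S = padic_class pp T \<longleftrightarrow> padic_rel S T"
proof
  assume "padic_class pp S = padic_class pp T"
  moreover have "T \<in> padic_class pp T" using assms by (simp add: padic_class_def null_iff)
  ultimately have "T \<in> padic_class pp S" by simp
  thus "padic_rel S T" using assms by (simp add: padic_class_def padic_rel_def)
next
  assume ST: "padic_rel S T"
  have "U \<in> padic_class pp S \<longleftrightarrow> U \<in> padic_class pp T" for U
  proof -
    have "U \<in> padic_class pp S \<longleftrightarrow> padic_rel S U" "U \<in> padic_class pp T \<longleftrightarrow> padic_rel T U"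
      using assms by (auto simp: padic_class_def padic_rel_def)
    thus ?thesis using ST padic_rel_sym padic_rel_trans by blast
  qed
  thus "padic_class pp S = padic_class pp T" by blast
qed

lemma rep_padic_cauchy: "padic_cauchy pp (rep_padic x)"
  using Quotient_rep_reflp[OF Quotient_padic] padic_rel_refl_iff by blast

lemma abs_rep_padic: "abs_padic (rep_padic x) = x"
  using Quotient_abs_rep[OF Quotient_padic] .

lemma abs_padic_eq_iff: assumes "padic_cauchy pp S" "padic_cauchy pp T" 
  shows "abs_padic S = abs_padic T \<longleftrightarrow> padic_rel S T"
  using Quotient_rel[OF Quotient_padic, of S T] assms by (simp add: padic_rel_refl_iff)

lemma iota_abs: assumes "padic_cauchy pp S" shows "iota (abs_padic S) = padic_class pp S"
proof -
  have "padic_rel (rep_padic (abs_padic S)) S"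
    using abs_padic_eq_iff[OF rep_padic_cauchy assms] abs_rep_padic by blast
  thus ?thesis unfolding iota_def using padic_class_eq_iff[OF rep_padic_cauchy assms] by blast
qed

lemma iota_inj: "iota x = iota y \<longleftrightarrow> x = y"
  unfolding iota_def padic_class_eq_iff[OF rep_padic_cauchy rep_padic_cauchy]
    abs_padic_eq_iff[OF rep_padic_cauchy rep_padic_cauchy, symmetric] abs_rep_padic ..

lemma padic_rep_iota: "padic_cauchy pp (padic_rep (iota x))" "abs_padic (padic_rep (iota x)) = x"
proof -
  have "rep_padic x \<in> iota x" using rep_padic_cauchy by (simp add: iota_def padic_class_def null_iff)
  hence "padic_rep (iota x) \<in> iota x" unfolding padic_rep_def by (rule someI[of "\<lambda>S. S \<in> iota x"])
  hence *: "padic_cauchy pp (padic_rep (iota x))" "padic_rel (rep_padic x) (padic_rep (iota x))"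
    using rep_padic_cauchy by (auto simp: iota_def padic_class_def padic_rel_def)
  thus "padic_cauchy pp (padic_rep (iota x))" by simp
  show "abs_padic (padic_rep (iota x)) = x"
    using abs_padic_eq_iff[OF rep_padic_cauchy *(1)] *(2) abs_rep_padic by metis
qed

abbreviation "Q \<equiv> Qp pp"

lemma Q_carrier: "carrier Q = range iota"
proof
  show "carrier Q \<subseteq> range iota"
  proof
    fix A assume "A \<in> carrier Q"
    then obtain S where "A = padic_class pp S" "padic_cauchy pp S" by (auto simp: Qp_def)
    thus "A \<in> range iota" using iota_abs by (metis rangeI)
  qed
  show "range iota \<subseteq> carrier Q" using rep_padic_cauchy by (auto simp: iota_def Qp_def)
qed

lemma iota_carrier [simp]: "iota x \<in> carrier Q" by (simp add: Q_carrier)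

lemma Q_add [simp]: "iota x \<oplus>\<^bsub>Q\<^esub> iota y = iota (x + y)"
proof -
  let ?S = "padic_rep (iota x)" and ?T = "padic_rep (iota y)"
  have "iota x \<oplus>\<^bsub>Q\<^esub> iota y = padic_class pp (\<lambda>n. ?S n + ?T n)" by (simp add: Qp_def)
  also have "\<dots> = iota (abs_padic (\<lambda>n. ?S n + ?T n))"
    using iota_abs[OF cauchy_add[OF prime_pp padic_rep_iota(1) padic_rep_iota(1)]] by simp
  also have "abs_padic (\<lambda>n. ?S n + ?T n) = abs_padic ?S + abs_padic ?T"
    using padic_rep_iota(1) by (simp add: plus_padic.abs_eq padic_rel_refl_iff)
  finally show ?thesis by (simp add: padic_rep_iota(2))
qed

lemma Q_mult [simp]: "iota x \<otimes>\<^bsub>Q\<^esub> iota y = iota (x * y)"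
proof -
  let ?S = "padic_rep (iota x)" and ?T = "padic_rep (iota y)"
  have "iota x \<otimes>\<^bsub>Q\<^esub> iota y = padic_class pp (\<lambda>n. ?S n * ?T n)" by (simp add: Qp_def)
  also have "\<dots> = iota (abs_padic (\<lambda>n. ?S n * ?T n))"
    using iota_abs[OF cauchy_mult[OF prime_pp padic_rep_iota(1) padic_rep_iota(1)]] by simp
  also have "abs_padic (\<lambda>n. ?S n * ?T n) = abs_padic ?S * abs_padic ?T"
    using padic_rep_iota(1) by (simp add: times_padic.abs_eq padic_rel_refl_iff)
  finally show ?thesis by (simp add: padic_rep_iota(2))
qed

lemma Q_of_rat: "qp_of_rat pp r = iota (of_rat r)"
  unfolding of_rat_padic const_padic.abs_eq qp_of_rat_def
  using iota_abs[OF cauchy_const[OF prime_pp]] by simp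

lemma Q_zero [simp]: "\<zero>\<^bsub>Q\<^esub> = iota 0" using Q_of_rat[of 0] by (simp add: qp_of_rat_def Qp_def)
lemma Q_one [simp]: "\<one>\<^bsub>Q\<^esub> = iota 1" using Q_of_rat[of 1] by (simp add: qp_of_rat_def Qp_def)

lemma Q_cring: "cring Q"
proof (rule cringI)
  show "abelian_group Q"
  proof (rule abelian_groupI)
    fix x assume "x \<in> carrier Q"
    then obtain a where "x = iota a" by (auto simp: Q_carrier)
    thus "\<exists>y\<in>carrier Q. y \<oplus>\<^bsub>Q\<^esub> x = \<zero>\<^bsub>Q\<^esub>" by (intro bexI[of _ "iota (- a)"]) auto
  qed (auto simp: Q_carrier add.assoc add.commute add.left_commute)
  show "Group.comm_monoid Q" by (rule comm_monoidI) (auto simp: Q_carrier mult.assoc mult.commute mult.left_commute)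
qed (auto simp: Q_carrier distrib_right)

lemma Q_uminus [simp]: "\<ominus>\<^bsub>Q\<^esub> iota x = iota (- x)"
  using abelian_group.minus_equality[OF ring.is_abelian_group[OF cring.axioms(1)[OF Q_cring]], of "iota (- x)" "iota x"] by simp

lemma Q_minus [simp]: "iota x \<ominus>\<^bsub>Q\<^esub> iota y = iota (x - y)"
  by (simp add: a_minus_def)

lemma Q_inv: "x \<noteq> 0 \<Longrightarrow> inv\<^bsub>Q\<^esub> (iota x) = iota (inverse x)"
  using comm_monoid.comm_inv_char[OF cring.axioms(2)[OF Q_cring], of "iota x" "iota (inverse x)"] by simp

lemma Q_two [simp]: "add_pow Q (2::nat) (iota 1) = iota 2"
  by (simp add: add_pow_def nat_pow_def numeral_2_eq_2)

lemma Q_three [simp]: "add_pow Q (3::nat) (iota 1) = iota 3"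
  by (simp add: add_pow_def nat_pow_def numeral_3_eq_3)

lemma Ecoef_iota: "Ecoef pp a i = iota (ratc a i)" by (simp add: Ecoef_def Q_of_rat ratc_def)

text \<open>Along a non-null Cauchy sequence the valuation is eventually constant, which makes the
  description by \<open>THE\<close> meaningful.\<close>

lemma qp_val_iota: assumes "x \<noteq> 0" shows "m \<le> qp_val pp (iota x) \<longleftrightarrow> vge m x"
proof -
  define S where "S = padic_rep (iota x)"
  have c: "padic_cauchy pp S" and x: "abs_padic S = x" using padic_rep_iota by (simp_all add: S_def)
  have nn: "\<not> padic_null pp S"
  proof
    assume "padic_null pp S"
    hence "padic_rel S (\<lambda>_. 0)" using c by (simp add: padic_rel_def cauchy_const[OF prime_pp])
    hence "abs_padic S = 0" unfolding zero_padic.abs_eq using abs_padic_eq_iff[OF c cauchy_const[OF prime_pp]] by simp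
    thus False using x assms by simp
  qed
  obtain b N where b: "\<forall>i\<ge>N. \<not> rge pp b (S i)" using not_null_bounded[OF prime_pp c nn] by blast
  obtain M where M: "\<forall>i\<ge>M. \<forall>j\<ge>M. rge pp b (S i - S j)" using c[unfolded cauchy_iff, rule_format, of b] ..
  define K where "K = max N M"
  \<comment> \<open>Late terms have valuation below \<open>b\<close> and their differences at least
    \<open>b\<close>. The inequality is symmetric in i and j, so the valuations agree.\<close>
  have le: "rat_val pp (S j) \<le> rat_val pp (S i)" if "i \<ge> K" "j \<ge> K" for i j
  proof -
    have nb: "\<not> rge pp b (S i)" "\<not> rge pp b (S j)"
      using b[rule_format, of i] b[rule_format, of j] that by (simp_all add: K_def)
    let ?m = "rat_val pp (S j)"
    have "?m < b" "S i \<noteq> 0" using nb by (auto simp: rge_def)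
    hence "rge pp ?m (S i - S j)" using M[rule_format, of i j] that rge_mono[of pp b _ ?m] by (simp add: K_def)
    moreover have "rge pp ?m (S j)" by (simp add: rge_def)
    ultimately have "rge pp ?m ((S i - S j) + S j)" by (rule rge_add[OF prime_pp])
    thus ?thesis using \<open>S i \<noteq> 0\<close> by (simp add: rge_def)
  qed
  define k where "k = rat_val pp (S K)"
  have k: "S i \<noteq> 0 \<and> rat_val pp (S i) = k" if "i \<ge> K" for i
  proof
    show "S i \<noteq> 0" using b[rule_format, of i] that by (auto simp: K_def)
    show "rat_val pp (S i) = k" using le[of i K] le[of K i] that by (simp add: k_def)
  qed
  have "qp_val pp (iota x) = k" unfolding qp_val_def S_def[symmetric]
  proof (rule the_equality)
    show "\<exists>N. \<forall>i\<ge>N. S i \<noteq> 0 \<and> rat_val pp (S i) = k" by (intro exI[of _ K] allI impI k)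
    fix k' assume "\<exists>N. \<forall>i\<ge>N. S i \<noteq> 0 \<and> rat_val pp (S i) = k'"
    then obtain L where "\<forall>i\<ge>L. S i \<noteq> 0 \<and> rat_val pp (S i) = k'" by blast
    from this[rule_format, of "max L K"] k[of "max L K"] show "k' = k" by simp
  qed
  moreover have "vge m x \<longleftrightarrow> m \<le> k"
  proof -
    have "vge m x \<longleftrightarrow> (\<exists>N. \<forall>i\<ge>N. rge pp m (S i))"
      using vge.abs_eq[of S m] c x by (simp add: padic_rel_refl_iff)
    also have "\<dots> \<longleftrightarrow> m \<le> k"
    proof
      assume "\<exists>N. \<forall>i\<ge>N. rge pp m (S i)"
      then obtain L where "\<forall>i\<ge>L. rge pp m (S i)" by blast
      from this[rule_format, of "max L K"] k[of "max L K"] show "m \<le> k" by (simp add: rge_def)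
    next
      assume "m \<le> k"
      hence "\<forall>i\<ge>K. rge pp m (S i)" using k by (simp add: rge_def)
      thus "\<exists>N. \<forall>i\<ge>N. rge pp m (S i)" by (rule exI[of _ K])
    qed
    finally show ?thesis .
  qed
  ultimately show ?thesis by simp
qed

lemma qp_int_iota [simp]: "qp_int pp (iota x) \<longleftrightarrow> vge 0 x"
  by (cases "x = 0") (simp_all add: qp_int_def iota_inj qp_val_iota)

lemma qp_red0_iota [simp]: "qp_red0 pp (iota x) \<longleftrightarrow> vge 1 x"
  using qp_val_iota[of x 1] by (cases "x = 0") (simp_all add: qp_red0_def iota_inj int_one_le_iff_zero_less)

section \<open>Points, filtration and cosets over the record\<close>

abbreviation J :: "padic ecpt \<Rightarrow> (nat \<Rightarrow> rat) set ecpt" where "J \<equiv> map_ecpt iota"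

lemma J_inj: "inj J" by (rule ecpt.inj_map) (auto simp: inj_def iota_inj)

lemma wc_on_iota: "wc_on Q (Ecoef pp a) (iota x) (iota y) \<longleftrightarrow> on_curve (ratc a) x y"
  by (simp add: wc_on_def Let_def Ecoef_iota iota_inj on_curve_def)

lemma wc_points_J: "wc_points Q (Ecoef pp a) = J ` {P. ec_pt (ratc a) P}"
proof
  show "wc_points Q (Ecoef pp a) \<subseteq> J ` {P. ec_pt (ratc a) P}"
  proof
    fix A assume "A \<in> wc_points Q (Ecoef pp a)"
    then consider "A = Inf" | X' Y where "A = Aff X' Y" "wc_on Q (Ecoef pp a) X' Y" by (auto simp: wc_points_def)
    thus "A \<in> J ` {P. ec_pt (ratc a) P}"
    proof cases
      case 1 thus ?thesis by (intro image_eqI[of _ _ Inf]) auto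
    next
      case 2
      then obtain x y where "X' = iota x" "Y = iota y" unfolding wc_on_def Q_carrier by blast
      thus ?thesis using 2 wc_on_iota by (intro image_eqI[of _ _ "Aff x y"]) auto
    qed
  qed
  show "J ` {P. ec_pt (ratc a) P} \<subseteq> wc_points Q (Ecoef pp a)"
  proof
    fix A assume "A \<in> J ` {P. ec_pt (ratc a) P}"
    then obtain P where "A = J P" "ec_pt (ratc a) P" by blast
    thus "A \<in> wc_points Q (Ecoef pp a)" by (cases P) (auto simp: wc_points_def wc_on_iota)
  qed
qed

text \<open>The inverse in the record is only controlled on nonzero elements. The cases are arranged
  so that each denominator is known to be nonzero; for equal points it is F_y.\<close>

lemma wc_add_J: assumes "ec_pt (ratc a) P" "ec_pt (ratc a) R"
  shows "wc_add Q (Ecoef pp a) (J P) (J R) = J (ec_add (ratc a) P R)"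
proof (cases P)
  case Inf thus ?thesis by (simp add: wc_add_def ec_add_def)
next
  case P: (Aff x1 y1)
  show ?thesis
  proof (cases R)
    case Inf thus ?thesis using P by (simp add: wc_add_def ec_add_def)
  next
    case R: (Aff x2 y2)
    let ?c = "ratc a"
    consider "x1 = x2 \<and> y1 + y2 + ?c 1 * x2 + ?c 3 = 0" | "x1 = x2" "y1 + y2 + ?c 1 * x2 + ?c 3 \<noteq> 0" | "x1 \<noteq> x2" by blast
    thus ?thesis
    proof cases
      case 1 thus ?thesis by (simp add: P R wc_add_def ec_add_def Ecoef_iota iota_inj Let_def)
    next
      case 2
      have "y1 = y2" using same_x_same_y[of ?c x1 y1 y2] 2 assms P R by simp
      hence "2 * y1 + ?c 1 * x1 + ?c 3 \<noteq> 0" using 2 by simp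
      thus ?thesis using 2 by (simp add: P R wc_add_def ec_add_def Ecoef_iota iota_inj Let_def Q_inv)
    next
      case 3
      hence "x2 - x1 \<noteq> 0" by simp
      thus ?thesis using 3 by (simp add: P R wc_add_def ec_add_def Ecoef_iota iota_inj Let_def Q_inv)
    qed
  qed
qed

lemma Efilt_J: assumes "icoef (ratc a)" shows "Efilt pp a n = J ` {P. filt (ratc a) n P}"
proof -
  let ?c = "ratc a"
  have "J P \<in> Efilt pp a n \<longleftrightarrow> filt ?c n P" if on: "ec_pt ?c P" for P
  proof -
    have car: "J P \<in> wc_points Q (Ecoef pp a)" using on by (simp add: wc_points_J)
    show ?thesis
    proof (cases P)
      case Inf thus ?thesis using car by (simp add: Efilt_def E0_def filt_def)
    next
      case (Aff x y)
      show ?thesis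
      proof (cases "n = 0")
        case True
        have y: "vge 0 x \<Longrightarrow> vge 0 y" using integral_y[OF assms] on Aff by simp
        have "(J P \<in> E0 pp a) \<longleftrightarrow> (\<not> vge 0 x \<or> \<not> vge 0 y \<or> \<not> (vge 1 (dFx ?c x y) \<and> vge 1 (dFy ?c x y)))"
          using car by (simp add: E0_def Aff Let_def Ecoef_iota dFx_def dFy_def)
        thus ?thesis using True y on Aff by (auto simp: Efilt_def filt_def)
      next
        case False
        have "x \<noteq> 0 \<and> qp_val pp (iota x) \<le> - 2 * int n \<longleftrightarrow> \<not> vge (1 - 2 * int n) x"
          using qp_val_iota[of x "1 - 2 * int n"] by (cases "x = 0") auto
        thus ?thesis using False car on Aff by (simp add: Efilt_def filt_def iota_inj)
      qed
    qed
  qed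
  moreover have "Efilt pp a n \<subseteq> J ` {P. ec_pt ?c P}" using wc_points_J by (auto simp: Efilt_def E0_def)
  moreover have "ec_pt ?c P" if "filt ?c n P" for P using that by (simp add: filt_def)
  ultimately show ?thesis by blast
qed

lemma E0_J: "icoef (ratc a) \<Longrightarrow> E0 pp a = J ` {P. filt (ratc a) 0 P}"
  using Efilt_J[of a 0] by (simp add: Efilt_def)

lemma RCOSETS_eq_image: "RCOSETS G H = (\<lambda>a. r_coset G H a) ` carrier G" by (auto simp: RCOSETS_def)

text \<open>A multiplicative bijection suffices, so this applies to records that have not been shown
  to be groups.\<close>

lemma card_RCOSETS_transport:
  assumes bij: "bij_betw f (carrier G) (carrier G')"
    and hom: "\<And>x y. x \<in> carrier G \<Longrightarrow> y \<in> carrier G \<Longrightarrow> f (x \<otimes>\<^bsub>G\<^esub> y) = f x \<otimes>\<^bsub>G'\<^esub> f y"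
    and cl: "\<And>x y. x \<in> carrier G \<Longrightarrow> y \<in> carrier G \<Longrightarrow> x \<otimes>\<^bsub>G\<^esub> y \<in> carrier G"
    and H: "H \<subseteq> carrier G"
  shows "card (RCOSETS G' (f ` H)) = card (RCOSETS G H)"
proof -
  have r: "r_coset G' (f ` H) (f a) = f ` (r_coset G H a)" if "a \<in> carrier G" for a
  proof -
    have "f (h \<otimes>\<^bsub>G\<^esub> a) = f h \<otimes>\<^bsub>G'\<^esub> f a" if "h \<in> H" for h using hom that H \<open>a \<in> carrier G\<close> by blast
    thus ?thesis by (simp add: r_coset_def image_UN)
  qed
  note R = RCOSETS_eq_image
  have "RCOSETS G' (f ` H) = (\<lambda>a. r_coset G' (f ` H) (f a)) ` carrier G"
    unfolding R bij_betw_imp_surj_on[OF bij, symmetric] by (simp add: image_image)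
  also have "\<dots> = (\<lambda>C. f ` C) ` RCOSETS G H" unfolding R image_image using r by (intro image_cong) auto
  finally have e: "RCOSETS G' (f ` H) = (\<lambda>C. f ` C) ` RCOSETS G H" .
  have "RCOSETS G H \<subseteq> Pow (carrier G)" using cl H by (auto simp: RCOSETS_def r_coset_def)
  hence "inj_on (\<lambda>C. f ` C) (RCOSETS G H)"
    using inj_on_image_Pow[OF bij_betw_imp_inj_on[OF bij]] inj_on_subset by blast
  thus ?thesis unfolding e by (rule card_image)
qed

lemma Eindex_J: assumes "\<And>P. P \<in> H \<Longrightarrow> ec_pt (ratc a) P" shows "Eindex pp a (J ` H) = card (RCOSETS (ecg (ratc a)) H)"
  unfolding Eindex_def
proof (rule card_RCOSETS_transport)
  show "bij_betw J (carrier (ecg (ratc a))) (carrier (EQp pp a))"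
    using J_inj by (auto simp: bij_betw_def ecg_def EQp_def wc_group_def wc_points_J intro: inj_on_subset)
qed (use assms in \<open>auto simp: ecg_def EQp_def wc_group_def wc_add_J ec_pt_add\<close>)

lemma card_RCOSETS_chg:
  assumes c: "chg a b u r s t" and H: "\<And>P. P \<in> H \<Longrightarrow> ec_pt b P"
  shows "card (RCOSETS (ecg a) (chg_pt u r s t ` H)) = card (RCOSETS (ecg b) H)"
proof (rule card_RCOSETS_transport)
  show "bij_betw (chg_pt u r s t) (carrier (ecg b)) (carrier (ecg a))" using chg_pt_bij[OF c] by (simp add: ecg_def)
qed (use H in \<open>auto simp: ecg_def chg_pt_add[OF c] ec_pt_add\<close>)

lemma filt_ec_pt: "filt c n P \<Longrightarrow> ec_pt c P" by (simp add: filt_def)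

lemma filt_image_chg:
  assumes c: "chg a b u r s t" and ia: "icoef a" and ib: "icoef b" 
    and k: "k \<ge> 1" "vge (int k) u" "\<not> vge (int k + 1) u"
  shows "{P. filt a n P} = chg_pt u r s t ` {P. filt b (n + k) P}"
proof -
  have 1: "filt a n (chg_pt u r s t P) \<longleftrightarrow> filt b (n + k) P" if "ec_pt b P" for P
    using filt_chg[OF c ia ib k that] .
  have 2: "P \<in> chg_pt u r s t ` {P. ec_pt b P}" if "ec_pt a P" for P
    using bij_betw_imp_surj_on[OF chg_pt_bij[OF c]] that by blast
  show ?thesis using 1 2 filt_ec_pt by blast
qed

lemma filt_iso:
  assumes c: "chg (ratc a) (ratc b) u r s t" and ia: "icoef (ratc a)" and ib: "icoef (ratc b)" 
    and k: "k \<ge> 1" "vge (int k) u" "\<not> vge (int k + 1) u"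
  shows "((EQp pp a)\<lparr>carrier := Efilt pp a n\<rparr>) \<cong> ((EQp pp b)\<lparr>carrier := Efilt pp b (n + k)\<rparr>)"
proof -
  let ?S = "{P. filt (ratc b) (n + k) P}" and ?g = "\<lambda>P. J (chg_pt u r s t P)"
  have S: "\<And>P. P \<in> ?S \<Longrightarrow> ec_pt (ratc b) P" using filt_ec_pt by auto
  have Ea: "Efilt pp a n = ?g ` ?S"
    unfolding Efilt_J[OF ia] filt_image_chg[OF c ia ib k] by (simp add: image_image)
  have Eb: "Efilt pp b (n + k) = J ` ?S" by (rule Efilt_J[OF ib])
  have ponc: "ec_pt (ratc a) (chg_pt u r s t P)" if "ec_pt (ratc b) P" for P
    using bij_betw_apply[OF chg_pt_bij[OF c]] that by blast
  have inj: "inj_on ?g {P. ec_pt (ratc b) P}"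
    using bij_betw_imp_inj_on[OF chg_pt_bij[OF c]] J_inj by (auto simp: inj_on_def)
  \<comment> \<open>On points over the record, \<open>h\<close> undoes the change of
    variables.\<close>
  define h where "h = (\<lambda>A. J (inv_into {P. ec_pt (ratc b) P} ?g A))"
  have h: "h (?g P) = J P" if "ec_pt (ratc b) P" for P
    unfolding h_def using inv_into_f_f[OF inj] that by simp
  have "h \<in> iso ((EQp pp a)\<lparr>carrier := Efilt pp a n\<rparr>) ((EQp pp b)\<lparr>carrier := Efilt pp b (n + k)\<rparr>)"
  proof (rule isoI)
    show "h \<in> hom ((EQp pp a)\<lparr>carrier := Efilt pp a n\<rparr>) ((EQp pp b)\<lparr>carrier := Efilt pp b (n + k)\<rparr>)"
    proof (rule homI)
      fix A assume "A \<in> carrier ((EQp pp a)\<lparr>carrier := Efilt pp a n\<rparr>)"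
      then obtain P where "P \<in> ?S" "A = ?g P" unfolding Ea by auto
      thus "h A \<in> carrier ((EQp pp b)\<lparr>carrier := Efilt pp b (n + k)\<rparr>)" using h S unfolding Eb by auto
    next
      fix A B assume "A \<in> carrier ((EQp pp a)\<lparr>carrier := Efilt pp a n\<rparr>)" "B \<in> carrier ((EQp pp a)\<lparr>carrier := Efilt pp a n\<rparr>)"
      then obtain P R where P: "P \<in> ?S" "A = ?g P" and R: "R \<in> ?S" "B = ?g R" unfolding Ea by auto
      note on = S[OF P(1)] S[OF R(1)]
      have "wc_add Q (Ecoef pp a) A B = ?g (ec_add (ratc b) P R)"
        unfolding P(2) R(2) wc_add_J[OF ponc[OF on(1)] ponc[OF on(2)]] chg_pt_add[OF c on] ..
      hence "h (wc_add Q (Ecoef pp a) A B) = J (ec_add (ratc b) P R)" using h[OF ec_pt_add[OF on]] by simp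
      also have "\<dots> = wc_add Q (Ecoef pp b) (h A) (h B)"
        unfolding P(2) R(2) h[OF on(1)] h[OF on(2)] wc_add_J[OF on] ..
      finally show "h (A \<otimes>\<^bsub>(EQp pp a)\<lparr>carrier := Efilt pp a n\<rparr>\<^esub> B)
        = h A \<otimes>\<^bsub>(EQp pp b)\<lparr>carrier := Efilt pp b (n + k)\<rparr>\<^esub> h B" by (simp add: EQp_def wc_group_def)
    qed
    have "inj_on h (?g ` ?S)"
    proof (rule inj_onI)
      fix A B assume "A \<in> ?g ` ?S" "B \<in> ?g ` ?S" "h A = h B"
      then obtain P R where P: "P \<in> ?S" "A = ?g P" and R: "R \<in> ?S" "B = ?g R" and e: "h A = h B" by auto
      have "J P = J R" using e h[OF S[OF P(1)]] h[OF S[OF R(1)]] P(2) R(2) by simp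
      thus "A = B" using J_inj P(2) R(2) by (simp add: inj_eq)
    qed
    moreover have "h ` (?g ` ?S) = J ` ?S" unfolding image_image using h S by (intro image_cong) auto
    ultimately show "bij_betw h (carrier ((EQp pp a)\<lparr>carrier := Efilt pp a n\<rparr>)) (carrier ((EQp pp b)\<lparr>carrier := Efilt pp b (n + k)\<rparr>))"
      unfolding bij_betw_def Ea Eb by simp
  qed
  thus ?thesis unfolding is_iso_def by blast
qed

section \<open>Valuations of discriminants and conclusion\<close>

lemma rat_val_power: assumes "Factorial_Ring.prime p" "r \<noteq> 0" shows "rat_val p (r ^ n) = int n * rat_val p r"
  by (induction n) (use assms in \<open>simp_all add: rat_val_1 rat_val_mult algebra_simps\<close>)

lemma rat_val_disc_chg:
  assumes "Factorial_Ring.prime p" "chg a b u r s t" "disc a \<noteq> 0"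
  shows "rat_val p (disc a) = 12 * rat_val p u + rat_val p (disc b)"
proof -
  have d: "disc a = u ^ 12 * disc b" using chg_wdisc[OF assms(2)] by (simp add: disc_wdisc)
  have "u \<noteq> 0" "disc b \<noteq> 0" using assms(3) d by auto
  thus ?thesis unfolding d by (simp add: rat_val_mult[OF assms(1)] rat_val_power[OF assms(1)])
qed

text \<open>Non-minimality of \<open>a\<close> supplies an integral model of smaller discriminant
  valuation. It is reached from \<open>b\<close> as well, so the minimality of \<open>b\<close>
  applies to it.\<close>

lemma rat_val_disc_minimal_less:
  assumes "p_integral_model p a" "\<not> p_minimal p a" "models_iso a b" "p_minimal p b"
  shows "rat_val p (disc b) < rat_val p (disc a)"
proof -
  obtain c where c: "models_iso a c" "p_integral_model p c" "rat_val p (disc c) < rat_val p (disc a)"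
    using assms(1,2) unfolding p_minimal_def by auto
  have "models_iso b c" using assms(3) c(1) chg_comp unfolding models_iso_chg by metis
  hence "rat_val p (disc b) \<le> rat_val p (disc c)" using assms(4) c(2) unfolding p_minimal_def by blast
  thus ?thesis using c(3) by simp
qed

lemma filtration_claim_test: "filtration_claim pp test_model"
  unfolding filtration_claim_def
proof (intro allI impI)
  fix a
  assume dn: "is_weierstrass a" and ia: "p_integral_model pp a" and nm: "\<not> p_minimal pp a"
    and iso: "models_iso a test_model" and min: "p_minimal pp test_model"
  let ?b = test_model
  obtain u r s t where c: "chg a ?b u r s t" using iso models_iso_chg by blast
  have da: "disc a \<noteq> 0" using dn by (simp add: is_weierstrass_def)
  have u: "u \<noteq> 0" using c by (simp add: chg_def)
  have db: "disc ?b \<noteq> 0" using chg_wdisc[OF c] da by (auto simp: disc_wdisc)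
  have vd: "rat_val pp (disc a) = 12 * rat_val pp u + rat_val pp (disc ?b)" by (rule rat_val_disc_chg[OF prime_pp c da])
  have "rat_val pp (disc ?b) < rat_val pp (disc a)" by (rule rat_val_disc_minimal_less[OF ia nm iso min])
  hence vu: "rat_val pp u \<ge> 1" using vd by linarith
  define k where "k = nat ((rat_val pp (disc a) - rat_val pp (disc ?b)) div 12)"
  \<comment> \<open>The difference of the valuations is 12 v(u) with v(u) >= 1, so neither
    \<open>div\<close> nor \<open>nat\<close> loses anything.\<close>
  have k: "int k = rat_val pp u" using vd vu by (simp add: k_def)
  have k1: "k \<ge> 1" using k vu by linarith
  have ica: "icoef (ratc a)" using ia icoef_ratc by simp
  have icb: "icoef (ratc ?b)" using min icoef_ratc by (simp add: p_minimal_def)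
  have cK: "chg (ratc a) (ratc ?b) (of_rat u) (of_rat r) (of_rat s) (of_rat t)"
    using chg_of_rat[OF c, where 'a=padic] unfolding ratc_def .
  have ku: "vge (int k) (of_rat u)" "\<not> vge (int k + 1) (of_rat u)" using k u by (simp_all add: rge_def)
  have iso_n: "\<forall>n. ((EQp pp a)\<lparr>carrier := Efilt pp a n\<rparr>) \<cong> ((EQp pp ?b)\<lparr>carrier := Efilt pp ?b (n + k)\<rparr>)"
    using filt_iso[OF cK ica icb k1 ku] by blast
  have ind: "Eindex pp ?b (Efilt pp ?b n) = card (RCOSETS ecgrp (filtset n))" for n
    unfolding Efilt_J[OF icb] filtset_def by (rule Eindex_J) (auto dest: filt_ec_pt)
  have "Eindex pp a (E0 pp a) = card (RCOSETS (ecg (ratc a)) {P. filt (ratc a) 0 P})"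
    unfolding E0_J[OF ica] by (rule Eindex_J) (auto dest: filt_ec_pt)
  also have "\<dots> = card (RCOSETS (ecg (ratc ?b)) {P. filt (ratc ?b) (0 + k) P})"
    unfolding filt_image_chg[OF cK ica icb k1 ku] by (rule card_RCOSETS_chg[OF cK]) (auto dest: filt_ec_pt)
  also have "\<dots> = Eindex pp ?b (Efilt pp ?b k)" unfolding ind filtset_def by simp
  finally have E: "Eindex pp a (E0 pp a) = Eindex pp ?b (Efilt pp ?b k)" .
  have "tamagawa pp ?b = card (RCOSETS ecgrp (filtset 0))"
    unfolding tamagawa_def using ind[of 0] by (simp add: Efilt_def)
  moreover have "Eindex pp ?b (Efilt pp ?b k) = card (RCOSETS ecgrp (filtset 0)) * (Np pp ?b * pp ^ (k - 1))"
    using card_rcosets_filtset[OF db icb, of "k - 1"] k1 ind[of k] by simp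
  ultimately have T: "Eindex pp ?b (Efilt pp ?b k) = tamagawa pp ?b * Np pp ?b * pp ^ (k - 1)" by simp
  show "let k = nat ((rat_val pp (disc a) - rat_val pp (disc ?b)) div 12) in
       (\<forall>n. ((EQp pp a)\<lparr>carrier := Efilt pp a n\<rparr>) \<cong> ((EQp pp ?b)\<lparr>carrier := Efilt pp ?b (n + k)\<rparr>))
         \<and> (k \<ge> 1 \<longrightarrow>
           Eindex pp a (E0 pp a) = Eindex pp ?b (Efilt pp ?b k)
         \<and> Eindex pp ?b (Efilt pp ?b k) = tamagawa pp ?b * Np pp ?b * pp ^ (k - 1))"
    unfolding Let_def k_def[symmetric] using iso_n E T by blast
qed

theorem theorem1p6:
  fixes p :: nat and a amin :: "nat \<Rightarrow> rat" and k :: nat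
  assumes "Factorial_Ring.prime p"
    and "is_weierstrass a"
    and "p_integral_model p a"
    and "\<not> p_minimal p a"
    and "models_iso a amin"
    and "p_minimal p amin"
  defines "k \<equiv> nat ((rat_val p (disc a) - rat_val p (disc amin)) div 12)"
  shows "(\<forall>n. ((EQp p a)\<lparr>carrier := Efilt p a n\<rparr>) \<cong> ((EQp p amin)\<lparr>carrier := Efilt p amin (n + k)\<rparr>))
         \<and> (k \<ge> 1 \<longrightarrow>
           Eindex p a (E0 p a) = Eindex p amin (Efilt p amin k)
         \<and> Eindex p amin (Efilt p amin k) = tamagawa p amin * Np p amin * p ^ (k - 1))"
  using filtration_claim_from_test[OF filtration_claim_test assms(1), of amin] assms(2-6)
  unfolding filtration_claim_def Let_def k_def by blast

end
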